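(* The quintuple $(\mathcal H,\ш_*,\mathbf 1,\Delta_{\mathrm{desc}},\varepsilon)$ is a connected graded bialgebra (graded by weight $|[s_1,\dots,s_k]|=s_1+\dots+s_k$, $|\mathbf 1|=0$), and hence a Hopf algebra.
   Context: Let $\{x_i\}_{i\ge1}$ be variables. For $k\ge1$, distinct $i_1,\dots,i_k\in\mathbb Z_{\ge1}$ and $(s_1,\dots,s_k)\in\mathbb Z_{\ge1}^k$, the Chen fraction is $\Phi^{s_1,\dots,s_k}_{i_1,\dots,i_k}:=\frac{1}{(x_{i_1}+\dots+x_{i_k})^{s_1}(x_{i_2}+\dots+x_{i_k})^{s_2}\cdots x_{i_k}^{s_k}}$. Let $F^{ch}$ be the set of Chen fractions together with $1$, and $\mathbb Q F^{ch}$ its span, in which $F^{ch}$ is a basis. Let $\partial_i:=-\frac{\partial}{\partial x_i}$, $d_{i,j}:=\partial_i-\partial_j$, and for indices $i_1,\dots,i_k$ set $d_{i_1,i_0}:=\partial_{i_1}$; operators act on tensors factorwise. $\Delta^{ch}$ is the linear map with $\Delta^{ch}(1)=1\otimes1$, $\Delta^{ch}(\Phi^{1,\dots,1}_{i_1,\dots,i_k})=\sum_{j=0}^k\Phi^{1,\dots,1}_{i_1,\dots,i_j}\otimes\Phi^{1,\dots,1}_{i_{j+1},\dots,i_k}$ (empty index list meaning $1$), and recursively $\Delta^{ch}(\Phi^{s_1,\dots,s_j+1,\dots,s_k}_{i_1,\dots,i_k})=\frac1{s_j}(\mathrm{id}\otimes d_{i_j,i_{j-1}}+d_{i_j,i_{j-1}}\otimes\mathrm{id})\Delta^{ch}(\Phi^{s_1,\dots,s_k}_{i_1,\dots,i_k})$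 (well defined). Let $\mathcal H$ be the $\mathbb Q$-vector space with basis a symbol $\mathbf 1$ and symbols $[s_1,\dots,s_k]$, $k\ge1$, $s_j\in\mathbb Z_{\ge1}$; $\pi:\mathbb Q F^{ch}\to\mathcal H$ is linear with $\pi(1)=\mathbf 1$, $\pi(\Phi^{s_1,\dots,s_k}_{i_1,\dots,i_k})=[s_1,\dots,s_k]$. Let $\ш$ be the shuffle product on $\mathbb Q\langle x_0,x_1\rangle$ ($1\ш w=w\ш1=w$, $au\ш bv=a(u\ш bv)+b(au\ш v)$), $\rho:\mathcal H\to\mathbb Q\langle x_0,x_1\rangle$ the injective linear map $\rho(\mathbf 1)=1$, $\rho([s_1,\dots,s_k])=x_0^{s_1-1}x_1\cdots x_0^{s_k-1}x_1$ (image closed under $\ш$), and $u\ш_*v:=\rho^{-1}(\rho(u)\ш\rho(v))$. $\Delta_{\mathrm{desc}}:\mathcal H\to\mathcal H\otimes\mathcal H$ is the linear map with $\Delta_{\mathrm{desc}}(\mathbf 1)=\mathbf 1\otimes\mathbf 1$ and $\Delta_{\mathrm{desc}}([s_1,\dots,s_k])=(\pi\otimes\pi)\Delta^{ch}(\Phi^{s_1,\dots,s_k}_{i_1,\dots,i_k})$ for any pairwise distinct $i_1,\dots,i_k$ (independent of the choice). $\varepsilon:\mathcal H\to\mathbb Q$ is linear with $\varepsilon(\mathbf 1)=1$ and $\varepsilon([s_1,\dots,s_k])=0$ for $k\ge1$. *)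

theory Defs
  imports Complex_Main "HOL-Library.Poly_Mapping" "HOL-Computational_Algebra.Fraction_Field"
begin

abbreviation "single \<equiv> Poly_Mapping.single"
abbreviation "lookup \<equiv> Poly_Mapping.lookup"
abbreviation "keys \<equiv> Poly_Mapping.keys"

section \<open>Rational vector spaces with a distinguished basis\<close>

text \<open>
  The type \<open>'b \<Rightarrow>\<^sub>0 rat\<close> is the rational vector space with basis \<open>'b\<close>, the basis vector of \<open>b\<close>
  being \<open>single b 1\<close>.  The tensor product of the spaces with bases \<open>'a\<close> and \<open>'b\<close> is
  the space with basis \<open>'a \<times> 'b\<close>.
\<close>

definition smul :: "rat \<Rightarrow> ('b \<Rightarrow>\<^sub>0 rat) \<Rightarrow> ('b \<Rightarrow>\<^sub>0 rat)" where
  "smul c p = Poly_Mapping.map ((*) c) p"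

lemma lookup_smul [simp]: "lookup (smul c p) b = c * lookup p b"
  by (simp add: smul_def map.rep_eq when_def)

lemma vector_space_smul: "vector_space smul"
  by unfold_locales (auto intro!: poly_mapping_eqI simp: lookup_add algebra_simps)

abbreviation qlinear :: "(('a \<Rightarrow>\<^sub>0 rat) \<Rightarrow> ('b \<Rightarrow>\<^sub>0 rat)) \<Rightarrow> bool" where
  "qlinear \<equiv> Vector_Spaces.linear smul smul"

definition lin_ext :: "('a \<Rightarrow> ('b \<Rightarrow>\<^sub>0 rat)) \<Rightarrow> ('a \<Rightarrow>\<^sub>0 rat) \<Rightarrow> ('b \<Rightarrow>\<^sub>0 rat)" where
  "lin_ext f p = (\<Sum>b\<in>keys p. smul (lookup p b) (f b))"

definition tens :: "('a \<Rightarrow>\<^sub>0 rat) \<Rightarrow> ('b \<Rightarrow>\<^sub>0 rat) \<Rightarrow> ('a \<times> 'b \<Rightarrow>\<^sub>0 rat)" where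
  "tens p q = (\<Sum>a\<in>keys p. \<Sum>b\<in>keys q. single (a, b) (lookup p a * lookup q b))"

definition tens_map ::
  "(('a \<Rightarrow>\<^sub>0 rat) \<Rightarrow> ('c \<Rightarrow>\<^sub>0 rat)) \<Rightarrow> (('b \<Rightarrow>\<^sub>0 rat) \<Rightarrow> ('d \<Rightarrow>\<^sub>0 rat)) \<Rightarrow>
   ('a \<times> 'b \<Rightarrow>\<^sub>0 rat) \<Rightarrow> ('c \<times> 'd \<Rightarrow>\<^sub>0 rat)" where
  "tens_map f g = lin_ext (\<lambda>(a, b). tens (f (single a 1)) (g (single b 1)))"

definition tens_assoc :: "(('a \<times> 'b) \<times> 'c \<Rightarrow>\<^sub>0 rat) \<Rightarrow> ('a \<times> ('b \<times> 'c) \<Rightarrow>\<^sub>0 rat)" where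
  "tens_assoc = lin_ext (\<lambda>((a, b), c). single (a, (b, c)) 1)"

text \<open>The linear map \<open>V \<otimes> V \<rightarrow> V\<close> and the product on \<open>V \<otimes> V\<close> induced by a bilinear product on \<open>V\<close>.\<close>

definition tens_fold ::
  "(('b \<Rightarrow>\<^sub>0 rat) \<Rightarrow> ('b \<Rightarrow>\<^sub>0 rat) \<Rightarrow> ('b \<Rightarrow>\<^sub>0 rat)) \<Rightarrow> ('b \<times> 'b \<Rightarrow>\<^sub>0 rat) \<Rightarrow> ('b \<Rightarrow>\<^sub>0 rat)" where
  "tens_fold m = lin_ext (\<lambda>(a, b). m (single a 1) (single b 1))"

definition tens_mult ::
  "(('b \<Rightarrow>\<^sub>0 rat) \<Rightarrow> ('b \<Rightarrow>\<^sub>0 rat) \<Rightarrow> ('b \<Rightarrow>\<^sub>0 rat)) \<Rightarrow>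
   ('b \<times> 'b \<Rightarrow>\<^sub>0 rat) \<Rightarrow> ('b \<times> 'b \<Rightarrow>\<^sub>0 rat) \<Rightarrow> ('b \<times> 'b \<Rightarrow>\<^sub>0 rat)" where
  "tens_mult m t u =
     lin_ext (\<lambda>(a, b). lin_ext (\<lambda>(c, d).
       tens (m (single a 1) (single c 1)) (m (single b 1) (single d 1))) u) t"


section \<open>Bialgebras and Hopf algebras\<close>

locale rat_algebra =
  fixes mult :: "('b \<Rightarrow>\<^sub>0 rat) \<Rightarrow> ('b \<Rightarrow>\<^sub>0 rat) \<Rightarrow> ('b \<Rightarrow>\<^sub>0 rat)"
    and unit :: "'b \<Rightarrow>\<^sub>0 rat"
  assumes mult_linear_left: "qlinear (\<lambda>u. mult u v)"
    and mult_linear_right: "qlinear (\<lambda>v. mult u v)"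
    and mult_assoc: "mult (mult u v) w = mult u (mult v w)"
    and unit_left: "mult unit u = u"
    and unit_right: "mult u unit = u"

locale rat_coalgebra =
  fixes comult :: "('b \<Rightarrow>\<^sub>0 rat) \<Rightarrow> ('b \<times> 'b \<Rightarrow>\<^sub>0 rat)"
    and counit :: "('b \<Rightarrow>\<^sub>0 rat) \<Rightarrow> rat"
  assumes comult_linear: "qlinear comult"
    and counit_linear: "Vector_Spaces.linear smul (*) counit"
    and coassoc: "tens_assoc (tens_map comult id (comult u)) = tens_map id comult (comult u)"
    and counit_left: "lin_ext (\<lambda>(a, b). smul (counit (single a 1)) (single b 1)) (comult u) = u"
    and counit_right: "lin_ext (\<lambda>(a, b). smul (counit (single b 1)) (single a 1)) (comult u) = u"

locale rat_bialgebra = rat_algebra mult unit + rat_coalgebra comult counit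
  for mult :: "('b \<Rightarrow>\<^sub>0 rat) \<Rightarrow> ('b \<Rightarrow>\<^sub>0 rat) \<Rightarrow> ('b \<Rightarrow>\<^sub>0 rat)"
    and unit :: "'b \<Rightarrow>\<^sub>0 rat"
    and comult :: "('b \<Rightarrow>\<^sub>0 rat) \<Rightarrow> ('b \<times> 'b \<Rightarrow>\<^sub>0 rat)"
    and counit :: "('b \<Rightarrow>\<^sub>0 rat) \<Rightarrow> rat" +
  assumes comult_mult: "comult (mult u v) = tens_mult mult (comult u) (comult v)"
    and comult_unit: "comult unit = tens unit unit"
    and counit_mult: "counit (mult u v) = counit u * counit v"
    and counit_unit: "counit unit = 1"

text \<open>\<open>gr n\<close> is the homogeneous component of degree \<open>n\<close>.\<close>

locale connected_graded_rat_bialgebra = rat_bialgebra mult unit comult counit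
  for gr :: "nat \<Rightarrow> ('b \<Rightarrow>\<^sub>0 rat) set"
    and mult :: "('b \<Rightarrow>\<^sub>0 rat) \<Rightarrow> ('b \<Rightarrow>\<^sub>0 rat) \<Rightarrow> ('b \<Rightarrow>\<^sub>0 rat)"
    and unit :: "'b \<Rightarrow>\<^sub>0 rat"
    and comult :: "('b \<Rightarrow>\<^sub>0 rat) \<Rightarrow> ('b \<times> 'b \<Rightarrow>\<^sub>0 rat)"
    and counit :: "('b \<Rightarrow>\<^sub>0 rat) \<Rightarrow> rat" +
  assumes gr_subspace: "module.subspace smul (gr n)"
    and gr_direct_sum:
      "\<exists>!c. (\<forall>n. c n \<in> gr n) \<and> finite {n. c n \<noteq> 0} \<and> u = (\<Sum>n | c n \<noteq> 0. c n)"
    and gr_unit: "unit \<in> gr 0"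
    and gr_mult: "u \<in> gr m \<Longrightarrow> v \<in> gr n \<Longrightarrow> mult u v \<in> gr (m + n)"
    and gr_comult: "u \<in> gr n \<Longrightarrow>
      comult u \<in> module.span smul {tens v w | v w p q. v \<in> gr p \<and> w \<in> gr q \<and> p + q = n}"
    and gr_counit: "u \<in> gr n \<Longrightarrow> n \<noteq> 0 \<Longrightarrow> counit u = 0"
    and connected: "gr 0 = module.span smul {unit}"

locale rat_hopf_algebra = rat_bialgebra mult unit comult counit
  for mult :: "('b \<Rightarrow>\<^sub>0 rat) \<Rightarrow> ('b \<Rightarrow>\<^sub>0 rat) \<Rightarrow> ('b \<Rightarrow>\<^sub>0 rat)"
    and unit :: "'b \<Rightarrow>\<^sub>0 rat"
    and comult :: "('b \<Rightarrow>\<^sub>0 rat) \<Rightarrow> ('b \<times> 'b \<Rightarrow>\<^sub>0 rat)"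
    and counit :: "('b \<Rightarrow>\<^sub>0 rat) \<Rightarrow> rat" +
  assumes antipode: "\<exists>S. qlinear S \<and>
    (\<forall>u. tens_fold mult (tens_map S id (comult u)) = smul (counit u) unit \<and>
         tens_fold mult (tens_map id S (comult u)) = smul (counit u) unit)"


section \<open>Rational functions and partial derivatives\<close>

text \<open>
  Rational polynomials in variables indexed by \<open>nat\<close>: monomials are finitely supported exponent
  functions \<open>nat \<Rightarrow>\<^sub>0 nat\<close>.
\<close>

type_synonym mpol = "(nat \<Rightarrow>\<^sub>0 nat) \<Rightarrow>\<^sub>0 rat"
type_synonym ratfun = "mpol fract"

definition mpol_pderiv :: "nat \<Rightarrow> mpol \<Rightarrow> mpol" where
  "mpol_pderiv i p =
     (\<Sum>m\<in>keys p. single (m - single i 1) (of_nat (lookup m i) * lookup p m))"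

lemma mpol_pderiv_superset:
  assumes "finite A" "keys p \<subseteq> A"
  shows "mpol_pderiv i p = (\<Sum>m\<in>A. single (m - single i 1) (of_nat (lookup m i) * lookup p m))"
  unfolding mpol_pderiv_def
  by (rule sum.mono_neutral_left) (use assms in \<open>auto simp: in_keys_iff\<close>)

lemma mpol_pderiv_add: "mpol_pderiv i (p + q) = mpol_pderiv i p + mpol_pderiv i q"
proof -
  let ?A = "keys p \<union> keys q"
  have "keys (p + q) \<subseteq> ?A" by (rule Poly_Mapping.keys_add)
  then show ?thesis
    by (subst (1 2 3) mpol_pderiv_superset[of ?A])
       (auto simp: lookup_add algebra_simps single_add sum.distrib)
qed

lemma mpol_pderiv_0 [simp]: "mpol_pderiv i 0 = 0"
  by (simp add: mpol_pderiv_def)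

lemma mpol_pderiv_single:
  "mpol_pderiv i (single m c) = single (m - single i 1) (of_nat (lookup m i) * c)"
  by (subst mpol_pderiv_superset[of "{m}"]) (auto simp: lookup_single)

lemma mpol_pderiv_mult_single:
  "mpol_pderiv i (single m c * single n d)
   = mpol_pderiv i (single m c) * single n d + single m c * mpol_pderiv i (single n d)"
proof -
  have *: "single (a - single i 1 + b) (of_nat (lookup a i) * x)
         = single (a + b - single i 1) (of_nat (lookup a i) * x)" for a b :: "nat \<Rightarrow>\<^sub>0 nat" and x :: rat
  proof (cases "lookup a i = 0")
    case False
    then have "a - single i 1 + b = a + b - single i 1"
      by (intro poly_mapping_eqI) (auto simp: lookup_add lookup_minus lookup_single when_def)
    then show ?thesis by simp
  qed simp
  show ?thesis
    using *[of m n "c * d"] *[of n m "c * d"]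
    by (simp add: mpol_pderiv_single mult_single lookup_add algebra_simps single_add)
qed

lemma poly_mapping_single_add_induct [case_names zero add]:
  fixes p :: "'a \<Rightarrow>\<^sub>0 'b::monoid_add"
  assumes "P 0" and "\<And>f a b. P f \<Longrightarrow> P (f + single a b)"
  shows "P p"
proof (induction p rule: update_induct)
  case (update f a b)
  then have "Poly_Mapping.update a b f = f + single a b"
    by (intro poly_mapping_eqI) (auto simp: lookup_update lookup_add lookup_single in_keys_iff when_def)
  with update assms show ?case by simp
qed (use assms in auto)

lemma mpol_pderiv_mult: "mpol_pderiv i (p * q) = mpol_pderiv i p * q + p * mpol_pderiv i q"
proof -
  have *: "mpol_pderiv i (single m c * q)
      = mpol_pderiv i (single m c) * q + single m c * mpol_pderiv i q" for m c
  proof (induction q rule: poly_mapping_single_add_induct)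
    case (add f n d)
    then show ?case
      by (simp add: mpol_pderiv_add distrib_left distrib_right mpol_pderiv_mult_single)
  qed simp
  show ?thesis
  proof (induction p rule: poly_mapping_single_add_induct)
    case (add f m c)
    then show ?case
      by (simp add: mpol_pderiv_add distrib_left distrib_right *)
  qed simp
qed

lemma quotient_rule_cong:
  fixes a b c d :: "'a::comm_ring_1"
  assumes "a * d = c * b" and "a' * d + a * d' = c' * b + c * b'"
  shows "(a' * b - a * b') * (d * d) = (c' * d - c * d') * (b * b)"
proof -
  have *: "a' * d = c' * b + c * b' - a * d'" using assms(2) by (simp add: eq_diff_eq)
  have "(a' * b - a * b') * (d * d) = (a' * d) * (b * d) - (a * d) * (b' * d)"
    by (simp add: algebra_simps)
  also have "\<dots> = c' * b * (b * d) + c * b' * (b * d) - (a * d) * (d' * b) - (a * d) * (b' * d)"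
    by (simp only: *) (simp add: algebra_simps)
  also have "\<dots> = (c' * d - c * d') * (b * b)"
    by (simp only: assms(1)) (simp add: algebra_simps)
  finally show ?thesis .
qed

lift_definition pderiv_rf :: "nat \<Rightarrow> ratfun \<Rightarrow> ratfun" is
  "\<lambda>i f. (mpol_pderiv i (fst f) * snd f - fst f * mpol_pderiv i (snd f), snd f * snd f)"
proof -
  fix i :: nat and f g :: "mpol \<times> mpol"
  assume "fractrel f g"
  then obtain a b c d where fg: "f = (a, b)" "g = (c, d)" and nz: "b \<noteq> 0" "d \<noteq> 0"
    and eq: "a * d = c * b"
    by (cases f; cases g) auto
  let ?D = "mpol_pderiv i"
  have "?D (a * d) = ?D (c * b)" by (simp add: eq)
  then have deq: "?D a * d + a * ?D d = ?D c * b + c * ?D b"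
    by (simp only: mpol_pderiv_mult)
  show "fractrel
     (?D (fst f) * snd f - fst f * ?D (snd f), snd f * snd f)
     (?D (fst g) * snd g - fst g * ?D (snd g), snd g * snd g)"
    using nz quotient_rule_cong[OF eq deq]
    by (simp only: fg fractrel_iff fst_conv snd_conv mult_eq_0_iff simp_thms)
qed

lemma pderiv_rf_Fract:
  "b \<noteq> 0 \<Longrightarrow>
     pderiv_rf i (Fract a b) = Fract (mpol_pderiv i a * b - a * mpol_pderiv i b) (b * b)"
  by (simp only: Fract.abs_eq pderiv_rf.abs_eq eq_onp_same_args fractrel_iff if_False
        fst_conv snd_conv mult_eq_0_iff simp_thms)

definition var_rf :: "nat \<Rightarrow> ratfun" where
  "var_rf i = Fract (single (single i 1) 1) 1"

definition const_rf :: "rat \<Rightarrow> ratfun" where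
  "const_rf c = Fract (single 0 c) 1"


section \<open>Chen fractions\<close>

text \<open>Lists are 0-based: \<open>is ! j\<close> and \<open>ss ! j\<close> are the index and exponent usually written with subscript \<open>j + 1\<close>.\<close>

definition chen_index :: "nat list \<Rightarrow> nat list \<Rightarrow> bool" where
  "chen_index is ss \<longleftrightarrow>
     length is = length ss \<and> distinct is \<and> (\<forall>i\<in>set is. 1 \<le> i) \<and> (\<forall>s\<in>set ss. 1 \<le> s)"

definition chen_frac :: "nat list \<Rightarrow> nat list \<Rightarrow> ratfun" where
  "chen_frac is ss =
     1 / (\<Prod>j<length is. (\<Sum>l=j..<length is. var_rf (is ! l)) ^ (ss ! j))"

definition F_ch :: "ratfun set" where
  "F_ch = insert 1 {chen_frac is ss | is ss. is \<noteq> [] \<and> chen_index is ss}"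

text \<open>
  The span of \<open>F_ch\<close> is represented through its basis \<open>F_ch\<close> as \<open>chen \<Rightarrow>\<^sub>0 rat\<close>;
  \<open>chen_val\<close> is the inclusion into the field of rational functions.
\<close>

typedef chen = F_ch
  unfolding F_ch_def by blast

type_synonym QF_ch = "chen \<Rightarrow>\<^sub>0 rat"

definition chen_val :: "QF_ch \<Rightarrow> ratfun" where
  "chen_val p = (\<Sum>c\<in>keys p. const_rf (lookup p c) * Rep_chen c)"

text \<open>\<open>Phi [] []\<close> is the basis element \<open>1\<close>.\<close>

definition Phi :: "nat list \<Rightarrow> nat list \<Rightarrow> QF_ch" where
  "Phi is ss = single (Abs_chen (chen_frac is ss)) 1"

text \<open>The span of the Chen fractions is closed under partial derivatives, so \<open>the_inv\<close> is applied to a value of \<open>chen_val\<close>.\<close>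

definition dneg :: "nat \<Rightarrow> QF_ch \<Rightarrow> QF_ch" where
  "dneg i p = the_inv chen_val (- pderiv_rf i (chen_val p))"

definition dstep :: "nat list \<Rightarrow> nat \<Rightarrow> QF_ch \<Rightarrow> QF_ch" where
  "dstep is j p =
     (if j = 0 then dneg (is ! 0) p else dneg (is ! j) p - dneg (is ! (j - 1)) p)"

definition is_Delta_ch :: "(QF_ch \<Rightarrow> (chen \<times> chen \<Rightarrow>\<^sub>0 rat)) \<Rightarrow> bool" where
  "is_Delta_ch T \<longleftrightarrow>
     qlinear T \<and>
     T (Phi [] []) = tens (Phi [] []) (Phi [] []) \<and>
     (\<forall>is. is \<noteq> [] \<and> chen_index is (replicate (length is) 1) \<longrightarrow>
        T (Phi is (replicate (length is) 1)) =
          (\<Sum>j\<le>length is. tens (Phi (take j is) (replicate j 1))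
                            (Phi (drop j is) (replicate (length is - j) 1)))) \<and>
     (\<forall>is ss j. chen_index is ss \<and> j < length is \<longrightarrow>
        T (Phi is (ss[j := ss ! j + 1])) =
          smul (1 / of_nat (ss ! j))
            (tens_map id (dstep is j) (T (Phi is ss)) + tens_map (dstep is j) id (T (Phi is ss))))"

definition Delta_ch :: "QF_ch \<Rightarrow> (chen \<times> chen \<Rightarrow>\<^sub>0 rat)" where
  "Delta_ch = (THE T. is_Delta_ch T)"


section \<open>The space \<open>\<H>\<close> and its structure maps\<close>

typedef composition = "{ss :: nat list. \<forall>s\<in>set ss. 1 \<le> s}"
  by (rule exI[of _ "[]"]) simp

type_synonym H = "composition \<Rightarrow>\<^sub>0 rat"

definition brk :: "nat list \<Rightarrow> H" where
  "brk ss = single (Abs_composition ss) 1"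

definition one_H :: H where
  "one_H = brk []"

definition proj_H :: "QF_ch \<Rightarrow> H" where
  "proj_H = (THE P. qlinear P \<and> P (Phi [] []) = one_H \<and>
     (\<forall>is ss. is \<noteq> [] \<and> chen_index is ss \<longrightarrow> P (Phi is ss) = brk ss))"

definition Delta_desc :: "H \<Rightarrow> (composition \<times> composition \<Rightarrow>\<^sub>0 rat)" where
  "Delta_desc = (THE D. qlinear D \<and> D one_H = tens one_H one_H \<and>
     (\<forall>is ss. is \<noteq> [] \<and> chen_index is ss \<longrightarrow>
        D (brk ss) = tens_map proj_H proj_H (Delta_ch (Phi is ss))))"

definition counit_H :: "H \<Rightarrow> rat" where
  "counit_H u = lookup u (Abs_composition [])"

text \<open>The noncommutative polynomials in two letters form the space with basis the words.\<close>

datatype letter = X0 | X1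

type_synonym ncpol = "letter list \<Rightarrow>\<^sub>0 rat"

fun shuffle_word :: "letter list \<Rightarrow> letter list \<Rightarrow> ncpol" where
  "shuffle_word [] w = single w 1"
| "shuffle_word (a # u) [] = single (a # u) 1"
| "shuffle_word (a # u) (b # v) =
     lin_ext (\<lambda>w. single (a # w) 1) (shuffle_word u (b # v)) +
     lin_ext (\<lambda>w. single (b # w) 1) (shuffle_word (a # u) v)"

definition shuffle :: "ncpol \<Rightarrow> ncpol \<Rightarrow> ncpol" where
  "shuffle p q = lin_ext (\<lambda>u. lin_ext (\<lambda>v. shuffle_word u v) q) p"

definition rho :: "H \<Rightarrow> ncpol" where
  "rho = lin_ext (\<lambda>c.
     single (concat (map (\<lambda>s. replicate (s - 1) X0 @ [X1]) (Rep_composition c))) 1)"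

definition shuffle_star :: "H \<Rightarrow> H \<Rightarrow> H" where
  "shuffle_star u v = the_inv rho (shuffle (rho u) (rho v))"

definition weight :: "composition \<Rightarrow> nat" where
  "weight c = sum_list (Rep_composition c)"

definition weight_part :: "nat \<Rightarrow> H set" where
  "weight_part n = module.span smul {single c 1 | c. weight c = n}"

end

theory Submission
  imports Defs
begin

text \<open>
  Encode \<open>[s\<^sub>1, \<dots>, s\<^sub>k]\<close> and Chen fractions by words of letters \<open>(l, n)\<close> with exponents \<open>n = s - 1\<close>, and let
  \<open>\<Phi>(t\<^sub>1, \<dots>, t\<^sub>k)\<close> be the generating series of the \<open>\<Phi>\<^sup>s\<close> in depth \<open>k\<close>.  Putting
  \<open>t\<^sub>m = y\<^sub>m + \<dots> + y\<^sub>k\<close>, \<open>\<Phi>(t)\<close> becomes the fraction with all exponents \<open>1\<close> in the shifted variables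
  \<open>x\<^sub>i - y\<^sub>i\<close>.  Hence, in the basis formed by the coefficients of the monomials in \<open>y\<close>, the operator
  \<open>- \<partial>/\<partial>x\<^sub>i\<close> raises the letter with label \<open>i\<close>, the recursively defined coproduct is deconcatenation and the
  product is the shuffle product of words.  The map \<open>theta\<close> is this change of basis; it identifies \<open>\<H>\<close> with
  the shuffle Hopf algebra over the alphabet of natural numbers, whose antipode is \<open>w \<mapsto> (-1)\<^sup>|\<^sup>w\<^sup>| rev w\<close>.

  For the coproduct on Chen fractions to make sense, Chen fractions have to be linearly independent.  This is
  seen by evaluating at positive reals and letting the variable with the last index tend to \<open>0\<close>.
\<close>

section \<open>Linear extensions and tensor products\<close>

text \<open>The series is geometric: \<open>\<Phi>(t)\<close> is the product over \<open>m\<close>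
  of \<open>1 / (X_m - t_m)\<close>, where \<open>X_m = x_m + ... + x_k\<close> sums the variables
  of the last indices, and \<open>X_m - t_m\<close> is the sum of \<open>x_l - y_l\<close> over
  \<open>l \<ge> m\<close>. It depends only on the differences \<open>x - y\<close>, so minus a
  derivative in \<open>x\<close> is a derivative in \<open>y\<close>; this is the origin of the
  factor \<open>Suc n\<close> of a raised letter. The obstacle is that \<open>Delta_ch\<close>,
  \<open>proj_H\<close> and \<open>Delta_desc\<close> are definite descriptions and
  \<open>dneg\<close> inverts \<open>chen_val\<close>: existence and uniqueness come before any
  computation. Consistency of the recursion for the coproduct is not checked directly.
  Deconcatenation, transported along \<open>theta\<close>, is shown to satisfy every clause, and
  uniqueness identifies it with \<open>Delta_ch\<close>. Letters carry labels so that one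
  construction serves both spaces: labels in \<open>nat\<close> are the indices of Chen fractions,
  the label type \<open>unit\<close> gives compositions. As \<open>theta\<close> never inspects
  labels, \<open>Delta_desc\<close> does not depend on the chosen indices.\<close>

interpretation Q: vector_space "smul :: rat \<Rightarrow> ('b \<Rightarrow>\<^sub>0 rat) \<Rightarrow> ('b \<Rightarrow>\<^sub>0 rat)"
  by (rule vector_space_smul)

lemma qlinear_iff:
  "qlinear f \<longleftrightarrow> (\<forall>p q. f (p + q) = f p + f q) \<and> (\<forall>c p. f (smul c p) = smul c (f p))"
  by (auto simp: Vector_Spaces.linear_iff_module_hom module_hom_iff Q.module_axioms)

lemma qlinearI:
  "(\<And>p q. f (p + q) = f p + f q) \<Longrightarrow> (\<And>c p. f (smul c p) = smul c (f p)) \<Longrightarrow> qlinear f"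
  by (simp add: qlinear_iff)

lemma qlinear_add: "qlinear f \<Longrightarrow> f (p + q) = f p + f q"
  and qlinear_smul: "qlinear f \<Longrightarrow> f (smul c p) = smul c (f p)"
  by (auto simp: qlinear_iff)

lemma qlinear_0: "qlinear f \<Longrightarrow> f 0 = 0"
  using qlinear_smul[of f 0 0] by simp

lemma qlinear_diff: "qlinear f \<Longrightarrow> f (p - q) = f p - f q"
  using qlinear_add[of f "p - q" q] by simp

lemma qlinear_sum: "qlinear f \<Longrightarrow> f (sum g A) = (\<Sum>a\<in>A. f (g a))"
  by (induction A rule: infinite_finite_induct) (auto simp: qlinear_0 qlinear_add)

lemma qlinear_id: "qlinear (\<lambda>p. p)" "qlinear id"
  by (auto intro: qlinearI)

lemma qlinear_comp: "qlinear f \<Longrightarrow> qlinear g \<Longrightarrow> qlinear (\<lambda>p. f (g p))"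
  by (auto simp: qlinear_iff)

lemma qlinear_plus: "qlinear f \<Longrightarrow> qlinear g \<Longrightarrow> qlinear (\<lambda>p. f p + g p)"
  by (auto simp: qlinear_iff algebra_simps)

lemma qlinear_scale: "qlinear f \<Longrightarrow> qlinear (\<lambda>p. smul c (f p))"
  by (auto simp: qlinear_iff algebra_simps)

lemma smul_single [simp]: "smul c (single a d) = single a (c * d)"
  by (rule poly_mapping_eqI) (auto simp: lookup_single when_def)

lemma lin_ext_superset:
  assumes "finite A" "keys p \<subseteq> A"
  shows "lin_ext f p = (\<Sum>a\<in>A. smul (lookup p a) (f a))"
  unfolding lin_ext_def
  by (rule sum.mono_neutral_left) (use assms in \<open>auto simp: in_keys_iff\<close>)

lemma lin_ext_add [simp]: "lin_ext f (p + q) = lin_ext f p + lin_ext f q"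
proof -
  let ?A = "keys p \<union> keys q"
  have "keys (p + q) \<subseteq> ?A" by (rule Poly_Mapping.keys_add)
  then show ?thesis
    by (subst (1 2 3) lin_ext_superset[of ?A])
       (auto simp: lookup_add Q.scale_left_distrib sum.distrib)
qed

lemma lin_ext_smul [simp]: "lin_ext f (smul c p) = smul c (lin_ext f p)"
proof -
  have "keys (smul c p) \<subseteq> keys p" by (auto simp: in_keys_iff)
  then show ?thesis
    by (subst (1 2) lin_ext_superset[of "keys p"]) (auto simp: Q.scale_sum_right)
qed

lemma qlinear_lin_ext: "qlinear (lin_ext f)"
  by (simp add: qlinearI)

lemma lin_ext_0 [simp]: "lin_ext f 0 = 0"
  by (simp add: lin_ext_def)

lemma lin_ext_diff [simp]: "lin_ext f (p - q) = lin_ext f p - lin_ext f q"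
  by (rule qlinear_diff[OF qlinear_lin_ext])

lemma lin_ext_single [simp]: "lin_ext f (single a c) = smul c (f a)"
  by (subst lin_ext_superset[of "{a}"]) auto

lemma lin_ext_id: "lin_ext (\<lambda>a. single a 1) p = p"
  by (induction p rule: poly_mapping_single_add_induct) auto

text \<open>As a \<open>fundef_cong\<close> rule it tells the termination proof of a recursion
  through \<open>lin_ext\<close> that the argument lies in \<open>keys q\<close>;
  \<open>theta_word\<close> relies on this.\<close>

lemma lin_ext_cong [fundef_cong]:
  "p = q \<Longrightarrow> (\<And>a. a \<in> keys q \<Longrightarrow> f a = g a) \<Longrightarrow> lin_ext f p = lin_ext g q"
  by (simp add: lin_ext_def)

lemma lin_ext_fun_add: "lin_ext (\<lambda>a. f a + g a) p = lin_ext f p + lin_ext g p"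
  by (simp add: lin_ext_def Q.scale_right_distrib sum.distrib)

lemma lin_ext_fun_diff: "lin_ext (\<lambda>a. f a - g a) p = lin_ext f p - lin_ext g p"
  by (simp add: lin_ext_def Q.scale_right_diff_distrib sum_subtractf)

lemma lin_ext_fun_smul: "lin_ext (\<lambda>a. smul c (f a)) p = smul c (lin_ext f p)"
  by (simp add: lin_ext_def Q.scale_sum_right mult.commute)

lemma lin_ext_fun_0 [simp]: "lin_ext (\<lambda>a. 0) p = 0"
  by (simp add: lin_ext_def)

lemma qlinear_lin_ext_out:
  assumes "qlinear h"
  shows "h (lin_ext f p) = lin_ext (\<lambda>a. h (f a)) p"
  by (simp add: lin_ext_def qlinear_sum[OF assms] qlinear_smul[OF assms])

lemma lin_ext_lin_ext: "lin_ext f (lin_ext g p) = lin_ext (\<lambda>a. lin_ext f (g a)) p"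
  by (rule qlinear_lin_ext_out[OF qlinear_lin_ext])

lemma qlinear_eq_lin_ext: "qlinear f \<Longrightarrow> f p = lin_ext (\<lambda>b. f (single b 1)) p"
  using qlinear_lin_ext_out[of f "\<lambda>b. single b 1" p] by (simp add: lin_ext_id)

text \<open>Agreement is required only on \<open>keys p\<close>, so that facts about the support of
  \<open>p\<close>, such as smaller weight or admissible labels, can enter.\<close>

lemma qlinear_eqI:
  assumes "qlinear f" "qlinear g" "\<And>b. b \<in> keys p \<Longrightarrow> f (single b 1) = g (single b 1)"
  shows "f p = g p"
  using assms by (simp add: qlinear_eq_lin_ext[of f p] qlinear_eq_lin_ext[of g p] cong: lin_ext_cong)

lemma lookup_sum: "lookup (sum f A) b = (\<Sum>a\<in>A. lookup (f a) b)"
  by (induction A rule: infinite_finite_induct) (auto simp: lookup_add)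

lemma lookup_lin_ext: "lookup (lin_ext f p) b = (\<Sum>a\<in>keys p. lookup p a * lookup (f a) b)"
  by (simp add: lin_ext_def lookup_sum)

lemma keys_lin_ext: "keys (lin_ext f p) \<subseteq> (\<Union>a\<in>keys p. keys (f a))"
proof
  fix b assume "b \<in> keys (lin_ext f p)"
  then have "(\<Sum>a\<in>keys p. lookup p a * lookup (f a) b) \<noteq> 0"
    by (simp add: in_keys_iff lookup_lin_ext)
  then obtain a where "a \<in> keys p" "lookup p a * lookup (f a) b \<noteq> 0"
    by (meson sum.neutral)
  then show "b \<in> (\<Union>a\<in>keys p. keys (f a))" by (auto simp: in_keys_iff)
qed

lemma keys_lin_ext_subset:
  "(\<And>a. a \<in> keys p \<Longrightarrow> keys (f a) \<subseteq> A) \<Longrightarrow> keys (lin_ext f p) \<subseteq> A"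
  using keys_lin_ext[of f p] by fast

lemma keys_add_subset: "keys p \<subseteq> A \<Longrightarrow> keys q \<subseteq> A \<Longrightarrow> keys (p + q) \<subseteq> A"
  using Poly_Mapping.keys_add[of p q] by blast

lemma keys_smul_subset: "keys p \<subseteq> A \<Longrightarrow> keys (smul c p) \<subseteq> A"
  by (auto simp: in_keys_iff)

lemma keys_diff_subset:
  fixes p q :: "'a \<Rightarrow>\<^sub>0 rat"
  shows "keys p \<subseteq> A \<Longrightarrow> keys q \<subseteq> A \<Longrightarrow> keys (p - q) \<subseteq> A"
  by (auto simp: in_keys_iff lookup_minus subset_iff) (metis in_keys_iff)

lemma keys_single_subset: "a \<in> A \<Longrightarrow> keys (single a c) \<subseteq> A"
  by auto

lemma tens_eq: "tens p q = lin_ext (\<lambda>a. lin_ext (\<lambda>b. single (a, b) 1) q) p"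
  by (simp add: tens_def lin_ext_def Q.scale_sum_right)

lemma tens_single [simp]: "tens (single a c) (single b d) = single (a, b) (c * d)"
  by (simp add: tens_eq)

lemma qlinear_tens_left: "qlinear (\<lambda>p. tens p q)"
  by (simp add: tens_eq qlinear_lin_ext)

lemma qlinear_tens_right: "qlinear (\<lambda>q. tens p q)"
  by (simp add: tens_eq qlinear_iff lin_ext_fun_add lin_ext_fun_smul)

lemma tens_map_single [simp]:
  "tens_map f g (single (a, b) c) = smul c (tens (f (single a 1)) (g (single b 1)))"
  by (simp add: tens_map_def)

lemma qlinear_tens_map: "qlinear (tens_map f g)"
  by (simp add: tens_map_def qlinear_lin_ext)

lemma tens_map_tens:
  assumes "qlinear f" "qlinear g"
  shows "tens_map f g (tens p q) = tens (f p) (g q)"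
proof -
  have "tens_map f g (tens p q)
      = lin_ext (\<lambda>a. lin_ext (\<lambda>b. tens (f (single a 1)) (g (single b 1))) q) p"
    by (simp add: tens_map_def tens_eq[of p] lin_ext_lin_ext)
  also have "\<dots> = lin_ext (\<lambda>a. tens (f (single a 1)) (g q)) p"
    by (simp add: qlinear_eq_lin_ext[OF qlinear_comp[OF qlinear_tens_right assms(2)], of _ q])
  also have "\<dots> = tens (f p) (g q)"
    by (simp add: qlinear_eq_lin_ext[OF qlinear_comp[OF qlinear_tens_left assms(1)], of p])
  finally show ?thesis .
qed

lemma tens_map_tens_map:
  assumes "qlinear f" "qlinear g"
  shows "tens_map f g (tens_map f' g' t) = tens_map (\<lambda>p. f (f' p)) (\<lambda>p. g (g' p)) t"
  by (rule qlinear_eqI[OF qlinear_comp[OF qlinear_tens_map qlinear_tens_map] qlinear_tens_map])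
     (auto simp: tens_map_tens assms)

text \<open>\<open>tens_map\<close> evaluates its two maps only at basis vectors occurring in
  \<open>t\<close>. This permits exchanging maps that agree merely on
  \<open>chen_words\<close>.\<close>

lemma tens_map_cong:
  assumes "\<And>a b. (a, b) \<in> keys t \<Longrightarrow> f (single a 1) = f' (single a 1)"
    and "\<And>a b. (a, b) \<in> keys t \<Longrightarrow> g (single b 1) = g' (single b 1)"
  shows "tens_map f g t = tens_map f' g' t"
  unfolding tens_map_def by (rule lin_ext_cong) (use assms in auto)

section \<open>The shuffle Hopf algebra of words\<close>

definition cons_lin :: "'a \<Rightarrow> ('a list \<Rightarrow>\<^sub>0 rat) \<Rightarrow> ('a list \<Rightarrow>\<^sub>0 rat)" where
  "cons_lin a = lin_ext (\<lambda>w. single (a # w) 1)"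

definition snoc_lin :: "'a \<Rightarrow> ('a list \<Rightarrow>\<^sub>0 rat) \<Rightarrow> ('a list \<Rightarrow>\<^sub>0 rat)" where
  "snoc_lin a = lin_ext (\<lambda>w. single (w @ [a]) 1)"

lemma cons_lin_simps [simp]:
  "cons_lin a (single w c) = single (a # w) c"
  "cons_lin a (p + q) = cons_lin a p + cons_lin a q"
  "cons_lin a (p - q) = cons_lin a p - cons_lin a q"
  "cons_lin a (smul c p) = smul c (cons_lin a p)"
  "cons_lin a 0 = 0"
  by (simp_all add: cons_lin_def)

lemma snoc_lin_simps [simp]:
  "snoc_lin a (single w c) = single (w @ [a]) c"
  "snoc_lin a (p + q) = snoc_lin a p + snoc_lin a q"
  "snoc_lin a (p - q) = snoc_lin a p - snoc_lin a q"
  "snoc_lin a (smul c p) = smul c (snoc_lin a p)"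
  "snoc_lin a 0 = 0"
  by (simp_all add: snoc_lin_def)

lemma qlinear_cons_lin: "qlinear (cons_lin a)"
  by (simp add: qlinearI)

lemma cons_snoc_lin: "cons_lin a (snoc_lin b p) = snoc_lin b (cons_lin a p)"
  by (simp add: cons_lin_def snoc_lin_def lin_ext_lin_ext)

fun shuf_word :: "'a list \<Rightarrow> 'a list \<Rightarrow> ('a list \<Rightarrow>\<^sub>0 rat)" where
  "shuf_word [] w = single w 1"
| "shuf_word (a # u) [] = single (a # u) 1"
| "shuf_word (a # u) (b # v) =
     cons_lin a (shuf_word u (b # v)) + cons_lin b (shuf_word (a # u) v)"

lemma shuf_word_Nil2 [simp]: "shuf_word u [] = single u 1"
  by (cases u) auto

lemma shuf_word_commute: "shuf_word u v = shuf_word v u"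
  by (induction u v rule: shuf_word.induct) (auto simp: add.commute)

definition shuf :: "('a list \<Rightarrow>\<^sub>0 rat) \<Rightarrow> ('a list \<Rightarrow>\<^sub>0 rat) \<Rightarrow> ('a list \<Rightarrow>\<^sub>0 rat)" where
  "shuf p q = lin_ext (\<lambda>u. lin_ext (shuf_word u) q) p"

lemma shuf_single [simp]: "shuf (single u c) (single v d) = smul (c * d) (shuf_word u v)"
  by (simp add: shuf_def)

lemma qlinear_shuf_left: "qlinear (\<lambda>p. shuf p q)"
  by (simp add: shuf_def qlinear_lin_ext)

lemma qlinear_shuf_right: "qlinear (shuf p)"
  by (simp add: shuf_def qlinear_iff lin_ext_fun_add lin_ext_fun_smul)

lemmas shuf_left_simps = qlinear_add[OF qlinear_shuf_left] qlinear_diff[OF qlinear_shuf_left]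
  qlinear_smul[OF qlinear_shuf_left] qlinear_0[OF qlinear_shuf_left]

lemmas shuf_right_simps = qlinear_add[OF qlinear_shuf_right] qlinear_diff[OF qlinear_shuf_right]
  qlinear_smul[OF qlinear_shuf_right] qlinear_0[OF qlinear_shuf_right]

lemma bilinear_eqI:
  assumes "\<And>q. qlinear (\<lambda>p. f p q)" "\<And>p. qlinear (f p)" "\<And>q. qlinear (\<lambda>p. g p q)" "\<And>p. qlinear (g p)"
    and "\<And>a b. a \<in> keys p \<Longrightarrow> b \<in> keys q \<Longrightarrow> f (single a 1) (single b 1) = g (single a 1) (single b 1)"
  shows "f p q = g p q"
proof (rule qlinear_eqI[of "\<lambda>p. f p q" "\<lambda>p. g p q"])
  fix a assume "a \<in> keys p"
  show "f (single a 1) q = g (single a 1) q"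
    by (rule qlinear_eqI) (use assms \<open>a \<in> keys p\<close> in auto)
qed (use assms in auto)

lemma shuf_cons_cons:
  "shuf (cons_lin a p) (cons_lin b q) =
     cons_lin a (shuf p (cons_lin b q)) + cons_lin b (shuf (cons_lin a p) q)"
  by (rule bilinear_eqI)
     (auto intro!: qlinear_plus qlinear_comp[OF qlinear_cons_lin] qlinear_shuf_left
        qlinear_shuf_right qlinear_comp[OF qlinear_shuf_left]
        qlinear_comp[OF qlinear_shuf_right] qlinear_cons_lin)

lemma shuf_Nil_left [simp]: "shuf (single [] 1) q = q"
  by (rule qlinear_eqI[OF qlinear_shuf_right qlinear_id(1)]) simp

lemma shuf_Nil_right [simp]: "shuf p (single [] 1) = p"
  by (simp add: shuf_def lin_ext_id)

text \<open>Both triple products obey the same recursion: the first letter of a term comes from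
  \<open>u\<close>, \<open>v\<close> or \<open>w\<close>, and removing it leaves a triple of smaller
  total length.\<close>

lemma shuf_word_assoc: "shuf (shuf_word u v) (single w 1) = shuf (single u 1) (shuf_word v w)"
proof (induction "length u + length v + length w" arbitrary: u v w rule: less_induct)
  case less
  show ?case
  proof (cases "u = [] \<or> v = [] \<or> w = []")
    case True
    then show ?thesis by auto
  next
    case False
    then obtain a u' b v' c w' where [simp]: "u = a # u'" "v = b # v'" "w = c # w'"
      by (metis neq_Nil_conv)
    have 1: "shuf (cons_lin x p) (single (c # w') 1) =
        cons_lin x (shuf p (single (c # w') 1)) + cons_lin c (shuf (cons_lin x p) (single w' 1))"
      for x p using shuf_cons_cons[of x p c "single w' 1"] by simp
    have 2: "shuf (single (a # u') 1) (cons_lin x q) =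
        cons_lin a (shuf (single u' 1) (cons_lin x q)) + cons_lin x (shuf (single (a # u') 1) q)"
      for x q using shuf_cons_cons[of a "single u' 1" x q] by simp
    have "shuf (shuf_word u v) (single w 1) =
        cons_lin a (shuf (shuf_word u' v) (single w 1)) + cons_lin b (shuf (shuf_word u v') (single w 1))
        + cons_lin c (shuf (shuf_word u v) (single w' 1))"
      by (simp add: shuf_left_simps 1)
    also have "\<dots> = cons_lin a (shuf (single u' 1) (shuf_word v w))
        + cons_lin b (shuf (single u 1) (shuf_word v' w)) + cons_lin c (shuf (single u 1) (shuf_word v w'))"
      using less[of u' v w] less[of u v' w] less[of u v w'] by simp
    also have "\<dots> = shuf (single u 1) (shuf_word v w)"
      by (simp add: shuf_right_simps 2)
    finally show ?thesis .
  qed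
qed

lemma shuf_assoc: "shuf (shuf p q) r = shuf p (shuf q r)"
proof (rule qlinear_eqI[of "shuf (shuf p q)" "\<lambda>r. shuf p (shuf q r)"])
  fix w
  show "shuf (shuf p q) (single w 1) = shuf p (shuf q (single w 1))"
    by (rule bilinear_eqI)
       (auto intro!: qlinear_shuf_left qlinear_shuf_right qlinear_comp[OF qlinear_shuf_left]
         qlinear_comp[OF qlinear_shuf_right] simp: shuf_word_assoc)
qed (auto intro!: qlinear_shuf_right qlinear_comp[OF qlinear_shuf_right])

lemma shuf_word_snoc_single:
  "shuf_word [a] (v @ [b]) = single (v @ [b, a]) 1 + snoc_lin b (shuf_word [a] v)"
  by (induction v) (auto simp: cons_snoc_lin algebra_simps)

text \<open>Shuffles are symmetric under reversal of words, so the recursion also holds for last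
  letters; the right antipode identity consumes words from the end.\<close>

lemma shuf_word_snoc:
  "shuf_word (u @ [a]) (v @ [b]) =
     snoc_lin a (shuf_word u (v @ [b])) + snoc_lin b (shuf_word (u @ [a]) v)"
proof (induction u v rule: shuf_word.induct)
  case (1 w)
  then show ?case by (simp add: shuf_word_snoc_single)
next
  case (2 c u)
  then show ?case
    using shuf_word_snoc_single[of b "c # u" a]
    by (simp add: shuf_word_commute[of "[b]"] shuf_word_commute[of "_ # _" "[b]"] add.commute)
next
  case (3 c u d v)
  then show ?case
    by (simp add: cons_snoc_lin algebra_simps)
qed

section \<open>Deconcatenation and its compatibility with shuffles\<close>

definition consl :: "'a \<Rightarrow> ('a list \<times> 'b \<Rightarrow>\<^sub>0 rat) \<Rightarrow> ('a list \<times> 'b \<Rightarrow>\<^sub>0 rat)" where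
  "consl a = tens_map (cons_lin a) id"

definition snocr :: "'a \<Rightarrow> ('b \<times> 'a list \<Rightarrow>\<^sub>0 rat) \<Rightarrow> ('b \<times> 'a list \<Rightarrow>\<^sub>0 rat)" where
  "snocr a = tens_map id (snoc_lin a)"

lemma consl_simps [simp]:
  "consl a (single (u, v) c) = single (a # u, v) c"
  "consl a (p + q) = consl a p + consl a q"
  "consl a (smul c p) = smul c (consl a p)"
  by (simp_all add: consl_def qlinear_add qlinear_smul qlinear_tens_map)

lemma snocr_simps [simp]:
  "snocr a (single (u, v) c) = single (u, v @ [a]) c"
  "snocr a (p + q) = snocr a p + snocr a q"
  by (simp_all add: snocr_def qlinear_add qlinear_tens_map)

lemma qlinear_consl: "qlinear (consl a)"
  by (simp add: consl_def qlinear_tens_map)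

lemma qlinear_snocr: "qlinear (snocr a)"
  by (simp add: snocr_def qlinear_tens_map)

lemma consl_snocr: "consl a (snocr b t) = snocr b (consl a t)"
  by (rule qlinear_eqI) (auto intro!: qlinear_comp[of "consl a"] qlinear_comp[of "snocr b"] qlinear_consl qlinear_snocr)

fun decon_word :: "'a list \<Rightarrow> ('a list \<times> 'a list \<Rightarrow>\<^sub>0 rat)" where
  "decon_word [] = single ([], []) 1"
| "decon_word (a # w) = single ([], a # w) 1 + consl a (decon_word w)"

definition decon :: "('a list \<Rightarrow>\<^sub>0 rat) \<Rightarrow> ('a list \<times> 'a list \<Rightarrow>\<^sub>0 rat)" where
  "decon = lin_ext decon_word"

lemma qlinear_decon: "qlinear decon"
  by (simp add: decon_def qlinear_lin_ext)

lemma decon_simps [simp]: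
  "decon (single w c) = smul c (decon_word w)"
  "decon (p + q) = decon p + decon q"
  "decon (smul c p) = smul c (decon p)"
  "decon 0 = 0"
  by (simp_all add: decon_def)

lemma decon_cons_lin: "decon (cons_lin a p) = tens (single [] 1) (cons_lin a p) + consl a (decon p)"
  by (rule qlinear_eqI[where p = p])
     (auto intro!: qlinear_plus qlinear_comp[OF qlinear_decon] qlinear_comp[OF qlinear_tens_right]
        qlinear_comp[OF qlinear_consl] qlinear_cons_lin qlinear_decon)

lemma decon_word_snoc: "decon_word (w @ [b]) = single (w @ [b], []) 1 + snocr b (decon_word w)"
  by (induction w) (auto simp: consl_snocr algebra_simps)

lemma decon_word_sum: "decon_word w = (\<Sum>j\<le>length w. single (take j w, drop j w) 1)"
proof (induction w)
  case (Cons a w)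
  have "(\<Sum>j\<le>length (a # w). single (take j (a # w), drop j (a # w)) 1)
     = single ([], a # w) 1 + consl a (\<Sum>j\<le>length w. single (take j w, drop j w) (1::rat))"
    by (simp add: sum.atMost_Suc_shift qlinear_sum[OF qlinear_consl] del: sum.atMost_Suc)
  then show ?case using Cons by simp
qed simp

lemma keys_decon_word: "keys (decon_word w) \<subseteq> {(u, v). u @ v = w}"
  unfolding decon_word_sum
  using Poly_Mapping.keys_sum[of "\<lambda>j. single (take j w, drop j w) (1::rat)" "{..length w}"]
  by fastforce

lemma qlinear_tens_mult_left: "qlinear (\<lambda>t. tens_mult m t u)"
  by (simp add: tens_mult_def qlinear_lin_ext)

lemma qlinear_tens_mult_right: "qlinear (tens_mult m t)"
  by (simp add: tens_mult_def qlinear_iff split_def lin_ext_fun_add lin_ext_fun_smul)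

lemma tens_mult_single [simp]:
  "tens_mult m (single (a, b) x) (single (c, d) y) =
     smul (x * y) (tens (m (single a 1) (single c 1)) (m (single b 1) (single d 1)))"
  by (simp add: tens_mult_def)

lemma consl_tens: "consl a (tens p q) = tens (cons_lin a p) q"
  by (simp add: consl_def tens_map_tens qlinear_cons_lin qlinear_id)

lemmas tens_left_simps = qlinear_add[OF qlinear_tens_left] qlinear_smul[OF qlinear_tens_left]
lemmas tens_right_simps = qlinear_add[OF qlinear_tens_right] qlinear_smul[OF qlinear_tens_right]

lemma tens_mult_consl_consl:
  "tens_mult shuf (consl a t) (consl b u) =
     consl a (tens_mult shuf t (consl b u)) + consl b (tens_mult shuf (consl a t) u)"
  by (rule bilinear_eqI)
     (auto intro!: qlinear_plus qlinear_comp[OF qlinear_consl] qlinear_tens_mult_left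
        qlinear_tens_mult_right qlinear_comp[OF qlinear_tens_mult_left]
        qlinear_comp[OF qlinear_tens_mult_right] qlinear_consl
        simp: consl_tens tens_left_simps)

lemma tens_mult_consl_left:
  "tens_mult shuf (consl a t) (single ([], v) 1) = consl a (tens_mult shuf t (single ([], v) 1))"
  by (rule qlinear_eqI[where p = t])
     (auto intro!: qlinear_plus qlinear_comp[OF qlinear_consl] qlinear_tens_mult_left
        qlinear_comp[OF qlinear_tens_mult_left] qlinear_consl simp: consl_tens tens_left_simps)

lemma tens_mult_consl_right:
  "tens_mult shuf (single ([], v) 1) (consl a t) = consl a (tens_mult shuf (single ([], v) 1) t)"
  by (rule qlinear_eqI[where p = t])
     (auto intro!: qlinear_plus qlinear_comp[OF qlinear_consl] qlinear_tens_mult_right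
        qlinear_comp[OF qlinear_tens_mult_right] qlinear_consl simp: consl_tens tens_left_simps)

lemma tens_mult_unit:
  "tens_mult shuf (single ([], []) 1) t = t" "tens_mult shuf t (single ([], []) 1) = t"
  by (auto simp: tens_mult_def split_def lin_ext_id)

text \<open>Sorting the right-hand side by the first letter of the left tensor factor (none,
  \<open>a\<close> or \<open>b\<close>) reproduces the recursion of the shuffle.\<close>

lemma decon_shuf_word: "decon (shuf_word u v) = tens_mult shuf (decon_word u) (decon_word v)"
proof (induction u v rule: shuf_word.induct)
  case (3 a u b v)
  have "tens_mult shuf (decon_word (a # u)) (decon_word (b # v)) =
      tens (single [] 1) (shuf_word (a # u) (b # v))
      + consl a (tens_mult shuf (decon_word u) (decon_word (b # v)))
      + consl b (tens_mult shuf (decon_word (a # u)) (decon_word v))"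
    by (simp add: qlinear_add[OF qlinear_tens_mult_left] qlinear_add[OF qlinear_tens_mult_right]
        tens_mult_consl_consl tens_mult_consl_left tens_mult_consl_right algebra_simps)
  then show ?case
    using 3 by (simp add: decon_cons_lin tens_right_simps algebra_simps)
qed (simp_all add: tens_mult_unit)

lemma decon_shuf: "decon (shuf p q) = tens_mult shuf (decon p) (decon q)"
  by (rule bilinear_eqI)
     (auto intro!: qlinear_comp[OF qlinear_decon] qlinear_tens_mult_left qlinear_tens_mult_right
        qlinear_comp[OF qlinear_tens_mult_left] qlinear_comp[OF qlinear_tens_mult_right]
        qlinear_shuf_left qlinear_shuf_right qlinear_decon simp: decon_shuf_word)

lemma qlinear_tens_assoc: "qlinear tens_assoc"
  by (simp add: tens_assoc_def qlinear_lin_ext)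

lemma tens_assoc_single [simp]: "tens_assoc (single ((a, b), c) x) = single (a, (b, c)) x"
  by (simp add: tens_assoc_def)

lemma tens_assoc_tens: "tens_assoc (tens (tens p q) r) = tens p (tens q r)"
  by (simp add: tens_assoc_def tens_eq lin_ext_lin_ext)

lemma tens_map_decon_consl:
  "tens_map decon id (consl a t) =
     tens_map (\<lambda>p. tens (single [] 1) (cons_lin a p)) id t + tens_map (consl a) id (tens_map decon id t)"
  by (rule qlinear_eqI[where p = t])
     (auto intro!: qlinear_plus qlinear_comp[OF qlinear_tens_map] qlinear_consl qlinear_tens_map
       simp: tens_left_simps tens_map_tens qlinear_consl qlinear_id)

lemma coassoc_word:
  "tens_assoc (tens_map decon id (decon_word w)) = tens_map id decon (decon_word w)"
proof (induction w)
  case (Cons a w)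
  have 1: "tens_assoc (tens_map (\<lambda>p. tens (single [] 1) (cons_lin a p)) id t) =
        tens (single [] 1) (consl a t)" for t :: "'a list \<times> 'a list \<Rightarrow>\<^sub>0 rat"
    by (rule qlinear_eqI[where p = t])
       (auto intro!: qlinear_comp[OF qlinear_tens_assoc] qlinear_tens_map
         qlinear_comp[OF qlinear_tens_right] qlinear_consl)
  have 2: "tens_assoc (tens_map (consl a) id t) = consl a (tens_assoc t)"
    for t :: "('a list \<times> 'a list) \<times> 'a list \<Rightarrow>\<^sub>0 rat"
    by (rule qlinear_eqI[where p = t])
       (auto intro!: qlinear_comp[OF qlinear_tens_assoc] qlinear_tens_map
         qlinear_comp[OF qlinear_consl] qlinear_tens_assoc)
  have 3: "tens_map id decon (consl a t) = consl a (tens_map id decon t)"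
    for t :: "'a list \<times> 'a list \<Rightarrow>\<^sub>0 rat"
    by (rule qlinear_eqI[where p = t])
       (auto intro!: qlinear_comp[OF qlinear_tens_map] qlinear_tens_map
         qlinear_comp[OF qlinear_consl] qlinear_consl simp: consl_tens)
  show ?case
    by (simp add: qlinear_add[OF qlinear_tens_map] qlinear_add[OF qlinear_tens_assoc]
         tens_map_decon_consl[unfolded id_def] 1[unfolded id_def] 2[unfolded id_def]
         3[unfolded id_def] Cons[unfolded id_def] tens_assoc_tens tens_right_simps)
qed simp

lemma coassoc_decon: "tens_assoc (tens_map decon id (decon p)) = tens_map id decon (decon p)"
  by (rule qlinear_eqI[where p = p])
     (auto intro!: qlinear_comp[OF qlinear_tens_assoc] qlinear_comp[OF qlinear_tens_map]
        qlinear_decon simp: coassoc_word[unfolded id_def])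

section \<open>Counit and antipode\<close>

definition shuf_counit :: "('a list \<Rightarrow>\<^sub>0 rat) \<Rightarrow> rat" where
  "shuf_counit p = lookup p []"

definition shuf_antipode :: "('a list \<Rightarrow>\<^sub>0 rat) \<Rightarrow> ('a list \<Rightarrow>\<^sub>0 rat)" where
  "shuf_antipode = lin_ext (\<lambda>w. single (rev w) ((-1) ^ length w))"


lemma qlinear_tens_fold: "qlinear (tens_fold m)"
  by (simp add: tens_fold_def qlinear_lin_ext)

lemma tens_fold_single [simp]:
  "tens_fold m (single (a, b) c) = smul c (m (single a 1) (single b 1))"
  by (simp add: tens_fold_def)

lemma tens_fold_tens:
  assumes "\<And>q. qlinear (\<lambda>p. m p q)" "\<And>p. qlinear (m p)"
  shows "tens_fold m (tens p q) = m p q"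
  by (rule bilinear_eqI[where p = p and q = q])
     (auto intro!: assms qlinear_comp[OF qlinear_tens_fold] qlinear_tens_left qlinear_tens_right)

text \<open>\<open>r\<close> is an accumulator: \<open>r = []\<close> gives the product of the
  antipode of \<open>u\<close> with \<open>v\<close>, and a letter stripped from the front of
  \<open>u\<close> moves to the front of \<open>r\<close> with a change of sign.\<close>

definition antipode_left :: "'a list \<Rightarrow> ('a list \<times> 'a list \<Rightarrow>\<^sub>0 rat) \<Rightarrow> ('a list \<Rightarrow>\<^sub>0 rat)" where
  "antipode_left r = lin_ext (\<lambda>(u, v). smul ((-1) ^ length u) (shuf_word (rev u @ r) v))"

definition antipode_right :: "'a list \<Rightarrow> ('a list \<times> 'a list \<Rightarrow>\<^sub>0 rat) \<Rightarrow> ('a list \<Rightarrow>\<^sub>0 rat)" where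
  "antipode_right r = lin_ext (\<lambda>(u, v). smul ((-1) ^ length v) (shuf_word u (r @ rev v)))"

lemma qlinear_antipode_left: "qlinear (antipode_left r)"
  by (simp add: antipode_left_def qlinear_lin_ext)

lemma qlinear_antipode_right: "qlinear (antipode_right r)"
  by (simp add: antipode_right_def qlinear_lin_ext)

lemma antipode_left_consl: "antipode_left r (consl a t) = smul (-1) (antipode_left (a # r) t)"
  by (rule qlinear_eqI[OF qlinear_comp[OF qlinear_antipode_left qlinear_consl]
         qlinear_scale[OF qlinear_antipode_left]])
     (auto simp: antipode_left_def)

lemma antipode_right_snocr: "antipode_right r (snocr a t) = smul (-1) (antipode_right (r @ [a]) t)"
  by (rule qlinear_eqI[OF qlinear_comp[OF qlinear_antipode_right qlinear_snocr]
         qlinear_scale[OF qlinear_antipode_right]])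
     (auto simp: antipode_right_def)

text \<open>The terms starting with the last letter of the left factor cancel against those starting with
  the first letter of the right factor; only the boundary term of this telescoping sum survives.\<close>

lemma antipode_left_Cons: "antipode_left (c # r) (decon_word w) = cons_lin c (shuf_word r w)"
proof (induction w arbitrary: c r)
  case (Cons b w)
  have "antipode_left (c # r) (decon_word (b # w)) =
      shuf_word (c # r) (b # w) + antipode_left (c # r) (consl b (decon_word w))"
    by (simp add: antipode_left_def)
  then show ?case
    by (simp add: antipode_left_consl Cons del: decon_word.simps)
qed (simp add: antipode_left_def)

lemma antipode_right_snoc: "antipode_right (r @ [c]) (decon_word w) = snoc_lin c (shuf_word w r)"
proof (induction w arbitrary: c r rule: rev_induct)
  case (snoc b w)
  have "antipode_right (r @ [c]) (decon_word (w @ [b])) =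
      shuf_word (w @ [b]) (r @ [c]) + antipode_right (r @ [c]) (snocr b (decon_word w))"
    by (simp add: antipode_right_def decon_word_snoc)
  then show ?case
    using snoc[of "r @ [c]" b]
    by (simp add: antipode_right_snocr shuf_word_snoc del: decon_word.simps)
qed (simp add: antipode_right_def)

lemma qlinear_shuf_antipode: "qlinear shuf_antipode"
  by (simp add: shuf_antipode_def qlinear_lin_ext)

lemma shuf_antipode_single [simp]:
  "shuf_antipode (single w c) = single (rev w) (c * (-1) ^ length w)"
  by (simp add: shuf_antipode_def)

lemma tens_fold_antipode:
  "tens_fold shuf (tens_map shuf_antipode id t) = antipode_left [] t"
  "tens_fold shuf (tens_map id shuf_antipode t) = antipode_right [] t"
proof -
  show "tens_fold shuf (tens_map shuf_antipode id t) = antipode_left [] t"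
    by (rule qlinear_eqI[OF qlinear_comp[OF qlinear_tens_fold qlinear_tens_map]])
       (auto simp: antipode_left_def qlinear_lin_ext)
  show "tens_fold shuf (tens_map id shuf_antipode t) = antipode_right [] t"
    by (rule qlinear_eqI[OF qlinear_comp[OF qlinear_tens_fold qlinear_tens_map]])
       (auto simp: antipode_right_def qlinear_lin_ext)
qed

lemma antipode_left_word: "antipode_left [] (decon_word w) = (if w = [] then single [] 1 else 0)"
proof (cases w)
  case (Cons b v)
  have "antipode_left [] (decon_word (b # v)) = shuf_word [] (b # v) + antipode_left [] (consl b (decon_word v))"
    by (simp add: antipode_left_def)
  then show ?thesis using Cons
    by (simp add: antipode_left_consl antipode_left_Cons single_uminus)
qed (simp add: antipode_left_def)

lemma antipode_right_word: "antipode_right [] (decon_word w) = (if w = [] then single [] 1 else 0)"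
proof (cases w rule: rev_cases)
  case (snoc v b)
  have "antipode_right [] (decon_word (v @ [b])) =
      shuf_word (v @ [b]) [] + antipode_right [] (snocr b (decon_word v))"
    by (simp add: antipode_right_def decon_word_snoc)
  then show ?thesis using snoc antipode_right_snoc[of "[]" b v]
    by (simp add: antipode_right_snocr single_uminus)
qed (simp add: antipode_right_def)

lemma shuf_antipode:
  "tens_fold shuf (tens_map shuf_antipode id (decon p)) = smul (shuf_counit p) (single [] 1)"
  "tens_fold shuf (tens_map id shuf_antipode (decon p)) = smul (shuf_counit p) (single [] 1)"
proof -
  have *: "qlinear (\<lambda>p. smul (shuf_counit p) (single [] 1))"
    by (rule qlinearI) (auto simp: shuf_counit_def lookup_add single_add)
  show "tens_fold shuf (tens_map shuf_antipode id (decon p)) = smul (shuf_counit p) (single [] 1)"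
    unfolding tens_fold_antipode
    by (rule qlinear_eqI[OF qlinear_comp[OF qlinear_antipode_left qlinear_decon] *])
       (auto simp: antipode_left_word shuf_counit_def lookup_single)
  show "tens_fold shuf (tens_map id shuf_antipode (decon p)) = smul (shuf_counit p) (single [] 1)"
    unfolding tens_fold_antipode
    by (rule qlinear_eqI[OF qlinear_comp[OF qlinear_antipode_right qlinear_decon] *])
       (auto simp: antipode_right_word shuf_counit_def lookup_single)
qed

lemma shuf_counit_word: "lookup (shuf_word u v) [] = (if u = [] \<and> v = [] then 1 else 0)"
proof (induction u v rule: shuf_word.induct)
  case (3 a u b v)
  have "[] \<notin> keys (cons_lin c p)" for c :: 'a and p
    using keys_lin_ext[of "\<lambda>w. single (c # w) 1" p] by (auto simp: cons_lin_def split: if_splits)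
  then show ?case by (simp add: lookup_add in_keys_iff)
qed (auto simp: lookup_single when_def)

lemma counit_linear_iff:
  "Vector_Spaces.linear smul (*) f \<longleftrightarrow> (\<forall>p q. f (p + q) = f p + f q) \<and> (\<forall>c p. f (smul c p) = c * f p)"
proof -
  have "vector_space ((*) :: rat \<Rightarrow> rat \<Rightarrow> rat)"
    by unfold_locales (auto simp: algebra_simps)
  then show ?thesis
    using vector_space_smul
    by (auto simp: Vector_Spaces.linear_iff_module_hom module_hom_iff module_iff_vector_space)
qed

lemma counit_shuf: "shuf_counit (shuf p q) = shuf_counit p * shuf_counit q"
proof -
  \<comment> \<open>\<open>bilinear_eqI\<close> speaks of maps into spaces of finitely supported
    functions, so the scalars are turned into multiples of the empty word.\<close>
  have "smul (shuf_counit (shuf p q)) (single [] 1) = (smul (shuf_counit p * shuf_counit q) (single [] 1) :: 'a list \<Rightarrow>\<^sub>0 rat)"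
    by (rule bilinear_eqI[where p = p and q = q])
       (auto intro!: qlinearI simp: shuf_left_simps shuf_right_simps shuf_counit_def lookup_add
          single_add algebra_simps lookup_single shuf_counit_word when_def)
  then show ?thesis
    by (metis lookup_single_eq smul_single mult.right_neutral)
qed

lemma counit_left_decon:
  "lin_ext (\<lambda>(a, b). smul (shuf_counit (single a 1)) (single b 1)) (decon p) = p"
proof -
  define g :: "'a list \<times> 'a list \<Rightarrow> ('a list \<Rightarrow>\<^sub>0 rat)"
    where "g = (\<lambda>(a, b). smul (shuf_counit (single a 1)) (single b 1))"
  have g: "g (a, b) = (if a = [] then single b 1 else 0)" for a b
    by (auto simp: g_def shuf_counit_def lookup_single)
  have "lin_ext g (consl x t) = 0" for x t
    by (rule qlinear_eqI[OF qlinear_comp[OF qlinear_lin_ext qlinear_consl], where g = "\<lambda>t. 0"])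
       (auto intro!: qlinearI simp: g)
  then have "lin_ext g (decon (single w 1)) = single w 1" for w
    by (cases w) (auto simp: g)
  then have "lin_ext g (decon p) = p"
    by (rule qlinear_eqI[OF qlinear_comp[OF qlinear_lin_ext qlinear_decon] qlinear_id(1)])
  then show ?thesis by (simp only: g_def)
qed

lemma counit_right_decon:
  "lin_ext (\<lambda>(a, b). smul (shuf_counit (single b 1)) (single a 1)) (decon p) = p"
proof -
  define g :: "'a list \<times> 'a list \<Rightarrow> ('a list \<Rightarrow>\<^sub>0 rat)"
    where "g = (\<lambda>(a, b). smul (shuf_counit (single b 1)) (single a 1))"
  have g: "g (a, b) = (if b = [] then single a 1 else 0)" for a b
    by (auto simp: g_def shuf_counit_def lookup_single)
  have "lin_ext g (snocr x t) = 0" for x t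
    by (rule qlinear_eqI[OF qlinear_comp[OF qlinear_lin_ext qlinear_snocr], where g = "\<lambda>t. 0"])
       (auto intro!: qlinearI simp: g)
  then have "lin_ext g (decon (single w 1)) = single w 1" for w
    by (cases w rule: rev_cases) (auto simp: g decon_word_snoc)
  then have "lin_ext g (decon p) = p"
    by (rule qlinear_eqI[OF qlinear_comp[OF qlinear_lin_ext qlinear_decon] qlinear_id(1)])
  then show ?thesis by (simp only: g_def)
qed

lemma shuf_hopf_algebra: "rat_hopf_algebra shuf (single [] 1) decon shuf_counit"
proof (intro rat_hopf_algebra.intro rat_bialgebra.intro rat_algebra.intro rat_coalgebra.intro
      rat_bialgebra_axioms.intro rat_hopf_algebra_axioms.intro)
  show "\<exists>S. qlinear S \<and>
    (\<forall>u :: 'a list \<Rightarrow>\<^sub>0 rat. tens_fold shuf (tens_map S id (decon u)) = smul (shuf_counit u) (single [] 1) \<and>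
         tens_fold shuf (tens_map id S (decon u)) = smul (shuf_counit u) (single [] 1))"
    using qlinear_shuf_antipode shuf_antipode by blast
qed (simp_all only: qlinear_shuf_left qlinear_shuf_right shuf_assoc shuf_Nil_left shuf_Nil_right
    qlinear_decon coassoc_decon counit_left_decon counit_right_decon decon_shuf counit_shuf,
   simp_all add: counit_linear_iff shuf_counit_def lookup_add)

section \<open>Transport of a Hopf algebra structure along a linear bijection\<close>

lemma tens_assoc_tens_map:
  assumes "qlinear f" "qlinear g" "qlinear h"
  shows "tens_assoc (tens_map (tens_map f g) h t) = tens_map f (tens_map g h) (tens_assoc t)"
  by (rule qlinear_eqI[OF qlinear_comp[OF qlinear_tens_assoc qlinear_tens_map]
        qlinear_comp[OF qlinear_tens_map qlinear_tens_assoc]])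
     (auto simp: tens_assoc_tens)

lemma lin_ext_counit_tens:
  assumes "Vector_Spaces.linear smul (*) f"
  shows "lin_ext (\<lambda>(a, b). smul (f (single a 1)) (single b 1)) (tens p q) = smul (f p) q"
    and "lin_ext (\<lambda>(a, b). smul (f (single b 1)) (single a 1)) (tens p q) = smul (f q) p"
proof -
  have f: "f (p + q) = f p + f q" "f (smul c p) = c * f p" for c p q
    using assms by (auto simp: counit_linear_iff)
  show "lin_ext (\<lambda>(a, b). smul (f (single a 1)) (single b 1)) (tens p q) = smul (f p) q"
    by (rule bilinear_eqI[where p = p and q = q])
       (auto intro!: qlinear_comp[OF qlinear_lin_ext] qlinear_tens_left qlinear_tens_right qlinearI
         simp: f Q.scale_left_distrib Q.scale_right_distrib mult.commute)
  show "lin_ext (\<lambda>(a, b). smul (f (single b 1)) (single a 1)) (tens p q) = smul (f q) p"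
    by (rule bilinear_eqI[where p = p and q = q])
       (auto intro!: qlinear_comp[OF qlinear_lin_ext] qlinear_tens_left qlinear_tens_right qlinearI
         simp: f Q.scale_left_distrib Q.scale_right_distrib mult.commute)
qed

lemma tens_mult_tens:
  assumes l: "\<And>q. qlinear (\<lambda>p. m p q)" and r: "\<And>p. qlinear (m p)"
  shows "tens_mult m (tens p q) (tens p' q') = tens (m p p') (m q q')"
proof -
  note lins = qlinear_comp[OF qlinear_tens_mult_left] qlinear_comp[OF qlinear_tens_mult_right]
    qlinear_tens_left qlinear_tens_right qlinear_comp[OF qlinear_tens_left]
    qlinear_comp[OF qlinear_tens_right] l r
  have "tens_mult m (single (a, b) 1) (tens p' q') = tens (m (single a 1) p') (m (single b 1) q')" for a b
    by (rule bilinear_eqI[where p = p' and q = q']) (auto intro!: lins)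
  then show ?thesis
    by - (rule bilinear_eqI[where p = p and q = q], auto intro!: lins)
qed

text \<open>Since \<open>J\<close> is bijective, the target operations are the source operations
  conjugated by \<open>J\<close>; every axiom is pulled back along \<open>K = inv J\<close>, and the
  antipode is conjugated too.\<close>

lemma rat_hopf_algebra_transport:
  assumes hopf: "rat_hopf_algebra m e d \<epsilon>" and J: "qlinear J" "bij J"
    and m': "\<And>p q. J (m p q) = m' (J p) (J q)" and e': "J e = e'"
    and d': "\<And>p. tens_map J J (d p) = d' (J p)" and \<epsilon>': "\<And>p. \<epsilon>' (J p) = \<epsilon> p"
  shows "rat_hopf_algebra m' e' d' \<epsilon>'"
proof -
  interpret A: rat_hopf_algebra m e d \<epsilon> by (rule hopf)
  define K where "K = inv J"
  have JK [simp]: "J (K u) = u" and KJ [simp]: "K (J p) = p" for u p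
    using J by (auto simp: K_def bij_is_surj surj_f_inv_f bij_is_inj)
  have K: "qlinear K"
  proof (rule qlinearI)
    show "K (p + q) = K p + K q" for p q
      using qlinear_add[OF J(1), of "K p" "K q"] KJ[of "K p + K q"] by simp
    show "K (smul c p) = smul c (K p)" for c p
      using qlinear_smul[OF J(1), of c "K p"] KJ[of "smul c (K p)"] by simp
  qed
  have m'_eq: "m' u v = J (m (K u) (K v))" for u v by (simp add: m')
  have d'_eq: "d' u = tens_map J J (d (K u))" for u by (simp add: d')
  have \<epsilon>'_eq: "\<epsilon>' u = \<epsilon> (K u)" for u using \<epsilon>'[of "K u"] by simp
  have m'l: "qlinear (\<lambda>u. m' u v)" for v
    unfolding m'_eq by (intro qlinear_comp[OF J(1)] qlinear_comp[OF A.mult_linear_left K])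
  have m'r: "qlinear (m' u)" for u
    unfolding m'_eq[abs_def] by (intro qlinear_comp[OF J(1)] qlinear_comp[OF A.mult_linear_right K])
  have d'l: "qlinear d'"
    unfolding d'_eq[abs_def] by (intro qlinear_comp[OF qlinear_tens_map] qlinear_comp[OF A.comult_linear K])
  have \<epsilon>'l: "Vector_Spaces.linear smul (*) \<epsilon>'"
    using A.counit_linear K by (auto simp: counit_linear_iff \<epsilon>'_eq qlinear_iff)
  have TJ: "qlinear (tens_map J J)" by (rule qlinear_tens_map)
  show ?thesis
  proof (intro rat_hopf_algebra.intro rat_bialgebra.intro rat_algebra.intro rat_coalgebra.intro
      rat_bialgebra_axioms.intro rat_hopf_algebra_axioms.intro)
    fix u v w
    show "qlinear (\<lambda>u. m' u v)" "qlinear (m' u)" "qlinear d'" "Vector_Spaces.linear smul (*) \<epsilon>'"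
      by (fact m'l m'r d'l \<epsilon>'l)+
    show "m' (m' u v) w = m' u (m' v w)" by (simp add: m'_eq A.mult_assoc)
    show "m' e' u = u" "m' u e' = u" by (simp_all add: m'_eq e'[symmetric] A.unit_left A.unit_right)
    have "tens_map d' id (d' u) = tens_map (tens_map J J) J (tens_map d id (d (K u)))"
      by (simp only: d'_eq[of u] tens_map_tens_map[OF d'l qlinear_id(2)] tens_map_tens_map[OF TJ J(1)] id_apply)
         (simp only: d')
    moreover have "tens_map id d' (d' u) = tens_map J (tens_map J J) (tens_map id d (d (K u)))"
      by (simp only: d'_eq[of u] tens_map_tens_map[OF qlinear_id(2) d'l] tens_map_tens_map[OF J(1) TJ] id_apply)
         (simp only: d')
    ultimately show "tens_assoc (tens_map d' id (d' u)) = tens_map id d' (d' u)"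
      using A.coassoc[of "K u"] by (simp only: tens_assoc_tens_map[OF J(1) J(1) J(1)])
    have "lin_ext (\<lambda>(a, b). smul (\<epsilon>' (single a 1)) (single b 1)) (tens_map J J t)
        = J (lin_ext (\<lambda>(a, b). smul (\<epsilon> (single a 1)) (single b 1)) t)" for t
      by (rule qlinear_eqI[OF qlinear_comp[OF qlinear_lin_ext TJ] qlinear_comp[OF J(1) qlinear_lin_ext]])
         (auto simp: lin_ext_counit_tens[OF \<epsilon>'l] \<epsilon>' qlinear_smul[OF J(1)] simp flip: smul_single)
    then show "lin_ext (\<lambda>(a, b). smul (\<epsilon>' (single a 1)) (single b 1)) (d' u) = u"
      by (simp only: d'_eq A.counit_left JK)
    have "lin_ext (\<lambda>(a, b). smul (\<epsilon>' (single b 1)) (single a 1)) (tens_map J J t)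
        = J (lin_ext (\<lambda>(a, b). smul (\<epsilon> (single b 1)) (single a 1)) t)" for t
      by (rule qlinear_eqI[OF qlinear_comp[OF qlinear_lin_ext TJ] qlinear_comp[OF J(1) qlinear_lin_ext]])
         (auto simp: lin_ext_counit_tens[OF \<epsilon>'l] \<epsilon>' qlinear_smul[OF J(1)] simp flip: smul_single)
    then show "lin_ext (\<lambda>(a, b). smul (\<epsilon>' (single b 1)) (single a 1)) (d' u) = u"
      by (simp only: d'_eq A.counit_right JK)
    have "tens_mult m' (tens_map J J s) (tens_map J J t) = tens_map J J (tens_mult m s t)" for s t
      by (rule bilinear_eqI[where p = s and q = t])
         (auto intro!: qlinear_comp[OF qlinear_tens_mult_left] qlinear_comp[OF qlinear_tens_mult_right]
            qlinear_comp[OF TJ] qlinear_tens_mult_left qlinear_tens_mult_right TJ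
            simp: tens_mult_tens[OF m'l m'r] tens_map_tens[OF J(1) J(1)] m')
    then show "d' (m' u v) = tens_mult m' (d' u) (d' v)"
      by (simp add: d'_eq m'_eq A.comult_mult)
    show "d' e' = tens e' e'"
      by (simp add: d'_eq e'[symmetric] A.comult_unit tens_map_tens[OF J(1) J(1)])
    show "\<epsilon>' (m' u v) = \<epsilon>' u * \<epsilon>' v" "\<epsilon>' e' = 1"
      by (simp_all add: \<epsilon>'_eq m'_eq e'[symmetric] A.counit_mult A.counit_unit)
    obtain S where S: "qlinear S"
      "\<And>u. tens_fold m (tens_map S id (d u)) = smul (\<epsilon> u) e"
      "\<And>u. tens_fold m (tens_map id S (d u)) = smul (\<epsilon> u) e"
      using A.antipode by blast
    define S' where "S' u = J (S (K u))" for u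
    have S': "qlinear S'"
      unfolding S'_def[abs_def] by (intro qlinear_comp[OF J(1)] qlinear_comp[OF S(1) K])
    have S'J: "S' (J p) = J (S p)" for p by (simp add: S'_def)
    have fold: "tens_fold m' (tens_map J J t) = J (tens_fold m t)" for t
      by (rule qlinear_eqI[OF qlinear_comp[OF qlinear_tens_fold TJ] qlinear_comp[OF J(1) qlinear_tens_fold]])
         (auto simp: tens_fold_tens[OF m'l m'r] m')
    have "tens_fold m' (tens_map S' id (d' u)) = J (tens_fold m (tens_map S id (d (K u))))" for u
      by (simp only: d'_eq tens_map_tens_map[OF S' qlinear_id(2)] fold[symmetric]
           tens_map_tens_map[OF J(1) J(1)] S'J id_apply)
    moreover have "tens_fold m' (tens_map id S' (d' u)) = J (tens_fold m (tens_map id S (d (K u))))" for u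
      by (simp only: d'_eq tens_map_tens_map[OF qlinear_id(2) S'] fold[symmetric]
           tens_map_tens_map[OF J(1) J(1)] S'J id_apply)
    ultimately show "\<exists>S. qlinear S \<and>
      (\<forall>u. tens_fold m' (tens_map S id (d' u)) = smul (\<epsilon>' u) e' \<and>
           tens_fold m' (tens_map id S (d' u)) = smul (\<epsilon>' u) e')"
      using S' by (intro exI[of _ S']) (simp add: S(2,3) qlinear_smul[OF J(1)] e' \<epsilon>'_eq)
  qed
qed

section \<open>The change of basis\<close>

lemma qlinear_if: "qlinear f \<Longrightarrow> qlinear g \<Longrightarrow> qlinear (\<lambda>p. if b then f p else g p)"
  by (cases b) simp_all

lemma qlinear_const_0: "qlinear (\<lambda>p. 0)"
  by (simp add: qlinearI)

type_synonym 'l word = "('l \<times> nat) list"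

abbreviation wt :: "'l word \<Rightarrow> nat" where
  "wt w \<equiv> sum_list (map (\<lambda>a. Suc (snd a)) w)"

text \<open>Equal weight and equal labels, hence equal length. \<open>theta\<close> and its inverse
  send a word to a combination of similar words, which yields both the grading and the stability of
  \<open>chen_words\<close>.\<close>

definition similar :: "'l word \<Rightarrow> 'l word set" where
  "similar w = {v. wt v = wt w \<and> map fst v = map fst w}"

fun lower_word :: "'l word \<Rightarrow> ('l word \<Rightarrow>\<^sub>0 rat)" where
  "lower_word [] = 0"
| "lower_word ((l, n) # w) =
     (if n = 0 then 0 else single ((l, n - 1) # w) 1) + cons_lin (l, n) (lower_word w)"

definition lower :: "('l word \<Rightarrow>\<^sub>0 rat) \<Rightarrow> ('l word \<Rightarrow>\<^sub>0 rat)" where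
  "lower = lin_ext lower_word"

fun bump_word :: "'l word \<Rightarrow> ('l word \<Rightarrow>\<^sub>0 rat)" where
  "bump_word [] = 0"
| "bump_word ((l, n) # w) = single ((l, Suc n) # w) 1"

definition bump :: "('l word \<Rightarrow>\<^sub>0 rat) \<Rightarrow> ('l word \<Rightarrow>\<^sub>0 rat)" where
  "bump = lin_ext bump_word"

lemma keys_cons_lin: "keys (cons_lin a p) \<subseteq> (#) a ` keys p"
  unfolding cons_lin_def by (rule keys_lin_ext_subset) auto

lemma keys_lower_word: "keys (lower_word w) \<subseteq> {v. Suc (wt v) = wt w \<and> map fst v = map fst w}"
proof (induction w rule: lower_word.induct)
  case (2 l n w)
  let ?A = "{v. Suc (wt v) = wt ((l, n) # w) \<and> map fst v = map fst ((l, n) # w)}"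
  have "keys (if n = 0 then 0 else single ((l, n - 1) # w) (1::rat)) \<subseteq> ?A" by auto
  moreover have "keys (cons_lin (l, n) (lower_word w)) \<subseteq> ?A"
    by (rule subset_trans[OF keys_cons_lin]) (use 2 in auto)
  ultimately show ?case
    unfolding lower_word.simps by (rule keys_add_subset)
qed simp

text \<open>
  Write \<open>A(y\<^sub>1, \<dots>, y\<^sub>k)\<close> for the generating series \<open>\<Phi>\<close> in the variables \<open>y\<close>, with \<open>[s]\<close> read as the word
  \<open>x\<^sub>0\<^sup>s\<^sup>-\<^sup>1 x\<^sub>1\<close>.  Then \<open>A(y\<^sub>1, \<dots>, y\<^sub>k) = x\<^sub>1 A(y\<^sub>2, \<dots>, y\<^sub>k) + (y\<^sub>1 + \<dots> + y\<^sub>k) x\<^sub>0 A(y\<^sub>1, \<dots>, y\<^sub>k)\<close>, and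
  comparing coefficients gives the recursion below: \<open>lower\<close> comes from the factor \<open>y\<^sub>1 + \<dots> + y\<^sub>k\<close>, and \<open>bump\<close>
  prefixes \<open>x\<^sub>0\<close>.
\<close>

function theta_word :: "'l word \<Rightarrow> ('l word \<Rightarrow>\<^sub>0 rat)" where
  "theta_word [] = single [] 1"
| "theta_word ((l, n) # w) =
     (if n = 0 then cons_lin (l, 0) (theta_word w) else 0)
     + bump (lin_ext theta_word (lower_word ((l, n) # w)))"
  by pat_completeness auto
termination
proof (relation "measure wt")
  fix l :: 'a and n and w v :: "'a word"
  assume "v \<in> keys (lower_word ((l, n) # w))"
  then show "(v, (l, n) # w) \<in> measure wt"
    using keys_lower_word[of "(l, n) # w"] by auto
qed auto

declare theta_word.simps(2) [simp del]

definition theta :: "('l word \<Rightarrow>\<^sub>0 rat) \<Rightarrow> ('l word \<Rightarrow>\<^sub>0 rat)" where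
  "theta = lin_ext theta_word"

lemma qlinear_lower: "qlinear lower" and qlinear_bump: "qlinear bump" and qlinear_theta: "qlinear theta"
  by (simp_all add: lower_def bump_def theta_def qlinear_lin_ext)

lemma lower_simps [simp]:
  "lower (single w c) = smul c (lower_word w)"
  "lower (p + q) = lower p + lower q"
  "lower (smul c p) = smul c (lower p)"
  "lower 0 = 0"
  by (simp_all add: lower_def)

lemma bump_simps [simp]:
  "bump (single w c) = smul c (bump_word w)"
  "bump (p + q) = bump p + bump q"
  "bump (smul c p) = smul c (bump p)"
  "bump 0 = 0"
  by (simp_all add: bump_def)

lemma theta_simps [simp]:
  "theta (single w c) = smul c (theta_word w)"
  "theta (p + q) = theta p + theta q"
  "theta (p - q) = theta p - theta q"
  "theta (smul c p) = smul c (theta p)"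
  "theta 0 = 0"
  by (simp_all add: theta_def)

lemma theta_word_Cons:
  "theta_word ((l, n) # w) =
     (if n = 0 then cons_lin (l, 0) (theta_word w) else 0) + bump (theta (lower_word ((l, n) # w)))"
  by (simp only: theta_def theta_word.simps)

lemma bump_cons_lin: "bump (cons_lin (l, n) p) = cons_lin (l, Suc n) p"
  by (rule qlinear_eqI[OF qlinear_comp[OF qlinear_bump qlinear_cons_lin] qlinear_cons_lin]) auto

lemma theta_cons_lin:
  "theta (cons_lin (l, n) p) =
     (if n = 0 then cons_lin (l, 0) (theta p) else 0) + bump (theta (lower (cons_lin (l, n) p)))"
  by (rule qlinear_eqI[where p = p])
     (auto intro!: qlinear_plus qlinear_if qlinear_const_0 qlinear_comp[OF qlinear_bump] qlinear_comp[OF qlinear_theta]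
        qlinear_comp[OF qlinear_lower] qlinear_comp[OF qlinear_cons_lin] qlinear_cons_lin
        qlinear_theta simp: theta_word_Cons simp del: lower_word.simps)

lemma lower_cons_lin:
  "lower (cons_lin (l, n) p) = (if n = 0 then 0 else cons_lin (l, n - 1) p) + cons_lin (l, n) (lower p)"
  by (rule qlinear_eqI[where p = p])
     (auto intro!: qlinear_plus qlinear_if qlinear_const_0 qlinear_comp[OF qlinear_lower] qlinear_comp[OF qlinear_cons_lin] qlinear_cons_lin
        qlinear_lower)

lemma keys_bump_word: "keys (bump_word w) \<subseteq> {v. wt v = Suc (wt w) \<and> map fst v = map fst w \<and> (\<exists>l n v'. v = (l, Suc n) # v')}"
  by (induction w rule: bump_word.induct) auto

text \<open>\<open>lower\<close> loses one unit of weight, \<open>bump\<close> restores it, and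
  neither changes labels.\<close>

lemma keys_theta_word: "keys (theta_word w) \<subseteq> similar w"
proof (induction w rule: theta_word.induct)
  case (2 l n w)
  have "keys (bump_word u) \<subseteq> similar ((l, n) # w)"
    if "v \<in> keys (lower_word ((l, n) # w))" "u \<in> keys (theta_word v)" for u v
    using 2(2)[OF that(1)] that(2) keys_lower_word[of "(l, n) # w"] that(1) keys_bump_word[of u]
    by (fastforce simp: similar_def)
  then have "keys (bump_word u) \<subseteq> similar ((l, n) # w)"
    if "u \<in> keys (theta (lower_word ((l, n) # w)))" for u
    using subsetD[OF keys_lin_ext[of theta_word "lower_word ((l, n) # w)"]] that
    unfolding theta_def by blast
  then have "keys (bump (theta (lower_word ((l, n) # w)))) \<subseteq> similar ((l, n) # w)"
    unfolding bump_def by (rule keys_lin_ext_subset)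
  moreover have "keys (if n = 0 then cons_lin (l, 0) (theta_word w) else 0) \<subseteq> similar ((l, n) # w)"
  proof (cases "n = 0")
    case True
    have "(#) (l, 0) ` keys (theta_word w) \<subseteq> similar ((l, n) # w)"
      using 2(1)[OF True] True by (auto simp: similar_def)
    then show ?thesis
      using True keys_cons_lin[of "(l, 0)" "theta_word w"] by simp
  qed simp
  ultimately show ?case
    unfolding theta_word_Cons by (rule keys_add_subset[rotated])
qed (simp add: similar_def)

section \<open>Raising operators and their commutation with the change of basis\<close>

fun raise_word :: "nat \<Rightarrow> 'l word \<Rightarrow> ('l word \<Rightarrow>\<^sub>0 rat)" where
  "raise_word m [] = 0"
| "raise_word 0 ((l, n) # w) = single ((l, Suc n) # w) (of_nat (Suc n))"
| "raise_word (Suc m) ((l, n) # w) = cons_lin (l, n) (raise_word m w)"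

text \<open>On Chen fractions, minus the derivative in the variable at position \<open>m\<close>
  raises each exponent up to position \<open>m\<close>, because exactly these denominators contain
  that variable. \<open>raise_word\<close> is the same operator in the new basis.\<close>

fun raises_word :: "nat \<Rightarrow> 'l word \<Rightarrow> ('l word \<Rightarrow>\<^sub>0 rat)" where
  "raises_word m [] = 0"
| "raises_word 0 ((l, n) # w) = single ((l, Suc n) # w) (of_nat (Suc n))"
| "raises_word (Suc m) ((l, n) # w) =
     single ((l, Suc n) # w) (of_nat (Suc n)) + cons_lin (l, n) (raises_word m w)"

text \<open>The Heisenberg relation: in terms of coefficients \<open>lower\<close> is multiplication
  by \<open>y_1 + ... + y_k\<close> and \<open>raise_word m\<close> is differentiation in the
  variable \<open>y\<close> at position \<open>m\<close>; differentiating the sum gives the extra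
  summand.\<close>

lemma lower_raise_word:
  "m < length w \<Longrightarrow> lower (raise_word m w) = lin_ext (raise_word m) (lower_word w) + single w 1"
proof (induction m w rule: raise_word.induct)
  case (2 l n w)
  have "lin_ext (raise_word 0) (cons_lin (l, k) p) = smul (of_nat (Suc k)) (cons_lin (l, Suc k) p)" for k p
    by (rule qlinear_eqI[where p = p])
       (auto intro!: qlinear_comp[OF qlinear_lin_ext] qlinear_scale qlinear_cons_lin)
  then show ?case
    by (cases n) (auto intro!: poly_mapping_eqI simp: lookup_add lookup_single when_def algebra_simps)
next
  case (3 m l n w)
  have *: "lin_ext (raise_word (Suc m)) (cons_lin (l, k) p) = cons_lin (l, k) (lin_ext (raise_word m) p)" for k p
    by (rule qlinear_eqI[where p = p])
       (auto intro!: qlinear_comp[OF qlinear_lin_ext] qlinear_comp[OF qlinear_cons_lin] qlinear_lin_ext qlinear_cons_lin)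
  show ?case using 3
    by (auto simp: lower_cons_lin * algebra_simps)
qed simp

text \<open>The first letter is raised for every \<open>m\<close>, and its factor grows by one once
  it has been bumped; this surplus is the second summand.\<close>

lemma raises_bump: "lin_ext (raises_word m) (bump p) = bump (lin_ext (raises_word m) p) + bump (bump p)"
proof (rule qlinear_eqI[where p = p])
  fix w :: "'a word"
  show "lin_ext (raises_word m) (bump (single w 1)) =
      bump (lin_ext (raises_word m) (single w 1)) + bump (bump (single w 1))"
    by (cases "(m, w)" rule: raises_word.cases)
       (auto simp: bump_cons_lin algebra_simps single_add[symmetric])
qed (auto intro!: qlinear_plus qlinear_comp[OF qlinear_lin_ext] qlinear_comp[OF qlinear_bump] qlinear_lin_ext qlinear_bump)

text \<open>The same derivative in both bases. The surplus terms of \<open>lower_raise_word\<close>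
  and \<open>raises_bump\<close> cancel, except that for \<open>n = 0\<close> the term
  \<open>cons_lin (l, 1) (theta_word w')\<close> remains; it is the raise of the first letter
  \<open>(l, 0)\<close> in the other part of the recursion.\<close>

lemma theta_raise_word:
  "m < length w \<Longrightarrow> theta (raise_word m w) = lin_ext (raises_word m) (theta_word w)"
proof (induction "wt w" arbitrary: m w rule: less_induct)
  case less
  then obtain l n w' where w: "w = (l, n) # w'" by (cases w) auto
  have "theta (lin_ext (raise_word m) (lower_word w)) = lin_ext (raises_word m) (theta (lower_word w))"
  proof (rule qlinear_eqI[where p = "lower_word w"])
    fix v assume "v \<in> keys (lower_word w)"
    with keys_lower_word[of w] have "Suc (wt v) = wt w" "map fst v = map fst w" by auto
    moreover from this(2) have "length v = length w" by (rule map_eq_imp_length_eq)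
    ultimately show "theta (lin_ext (raise_word m) (single v 1)) = lin_ext (raises_word m) (theta (single v 1))"
      using less(1)[of v m] less(2) by simp
  qed (auto intro!: qlinear_comp[OF qlinear_lin_ext] qlinear_comp[OF qlinear_theta] qlinear_lin_ext qlinear_theta)
  then have 1: "bump (theta (lower (raise_word m w))) =
      bump (lin_ext (raises_word m) (theta (lower_word w))) + bump (theta_word w)"
    by (simp only: lower_raise_word[OF less(2)] theta_simps bump_simps Q.scale_one)
  have 2: "bump (theta_word w) =
      (if n = 0 then cons_lin (l, 1) (theta_word w') else 0) + bump (bump (theta (lower_word w)))"
    by (simp add: w theta_word_Cons bump_cons_lin del: lower_word.simps)
  have 3: "lin_ext (raises_word m) (theta_word w) =
     (if n = 0 then lin_ext (raises_word m) (cons_lin (l, 0) (theta_word w')) else 0)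
      + bump (lin_ext (raises_word m) (theta (lower_word w))) + bump (bump (theta (lower_word w)))"
    by (simp add: w theta_word_Cons raises_bump del: lower_word.simps)
  show ?case
  proof (cases m)
    case 0
    have "lin_ext (raises_word 0) (cons_lin (l, 0) p) = cons_lin (l, 1) p" for p
      by (rule qlinear_eqI[where p = p])
         (auto intro!: qlinear_comp[OF qlinear_lin_ext] qlinear_cons_lin)
    \<comment> \<open>The raised word starts with a positive exponent, so only the
      \<open>bump\<close> part of the recursion is left.\<close>
    moreover have "theta (raise_word m w) = bump (theta (lower (raise_word m w)))"
      by (simp add: w 0 theta_word_Cons del: lower_word.simps)
    ultimately show ?thesis unfolding 3 1 2 by (simp add: 0 algebra_simps)
  next
    case (Suc k)
    have 4: "lin_ext (raises_word (Suc k)) (cons_lin (l, 0) p) =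
        cons_lin (l, 1) p + cons_lin (l, 0) (lin_ext (raises_word k) p)" for p
      by (rule qlinear_eqI[where p = p])
         (auto intro!: qlinear_plus qlinear_comp[OF qlinear_lin_ext] qlinear_comp[OF qlinear_cons_lin]
            qlinear_lin_ext qlinear_cons_lin)
    have "theta (raise_word m w) = (if n = 0 then cons_lin (l, 0) (theta (raise_word k w')) else 0)
        + bump (theta (lower (raise_word m w)))"
      by (simp add: w Suc theta_cons_lin)
    moreover have "theta (raise_word k w') = lin_ext (raises_word k) (theta_word w')"
      using less by (simp add: w Suc)
    ultimately show ?thesis unfolding 3 1 2 by (simp add: Suc 4 algebra_simps)
  qed
qed

section \<open>Bijectivity of the change of basis\<close>

lemma keys_lin_extE:
  assumes "b \<in> keys (lin_ext f p)"
  obtains a where "a \<in> keys p" "b \<in> keys (f a)"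
  using assms keys_lin_ext[of f p] by blast

text \<open>Left division by the letter \<open>a\<close>, the adjoint of
  \<open>cons_lin a\<close>.\<close>

definition slice :: "'a \<Rightarrow> ('a list \<Rightarrow>\<^sub>0 rat) \<Rightarrow> ('a list \<Rightarrow>\<^sub>0 rat)" where
  "slice a = lin_ext (\<lambda>w. case w of [] \<Rightarrow> 0 | b # v \<Rightarrow> if b = a then single v 1 else 0)"

lemma qlinear_slice: "qlinear (slice a)"
  by (simp add: slice_def qlinear_lin_ext)

text \<open>\<open>coeff_map w\<close> is the linear functional \<open>lookup _ w\<close> with values in a one-dimensional space of the
  shape required by \<open>qlinear\<close>.\<close>

definition coeff_map :: "'a \<Rightarrow> ('a \<Rightarrow>\<^sub>0 rat) \<Rightarrow> (unit \<Rightarrow>\<^sub>0 rat)" where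
  "coeff_map w p = single () (lookup p w)"

lemma qlinear_coeff_map: "qlinear (coeff_map w)"
  by (auto intro!: qlinearI simp: coeff_map_def lookup_add single_add)

lemma coeff_map_eq_iff: "coeff_map w p = coeff_map v q \<longleftrightarrow> lookup p w = lookup q v"
  by (metis coeff_map_def lookup_single_eq)

lemma lookup_eqI:
  assumes "qlinear f" "qlinear g"
    and "\<And>b. b \<in> keys p \<Longrightarrow> lookup (f (single b 1)) w = lookup (g (single b 1)) v"
  shows "lookup (f p) w = lookup (g p) v"
  unfolding coeff_map_eq_iff[symmetric]
  by (rule qlinear_eqI[OF qlinear_comp[OF qlinear_coeff_map assms(1)]
        qlinear_comp[OF qlinear_coeff_map assms(2)]])
     (simp add: coeff_map_eq_iff assms(3))

lemma lookup_cons_lin_Cons: "lookup (cons_lin a p) (b # w) = (if a = b then lookup p w else 0)"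
proof -
  have "lookup (cons_lin a p) (b # w) = lookup ((if a = b then p else 0)) w"
    by (rule lookup_eqI[where p = p])
       (auto intro!: qlinear_if qlinear_const_0 qlinear_cons_lin qlinear_id
         simp: lookup_single when_def)
  then show ?thesis by simp
qed

lemma lookup_cons_lin_Nil [simp]: "lookup (cons_lin a p) [] = 0"
  using keys_cons_lin[of a p] by (auto simp: in_keys_iff)

lemma lookup_slice: "lookup (slice a p) w = lookup p (a # w)"
proof (rule lookup_eqI[OF qlinear_slice qlinear_id(1)])
  fix b show "lookup (slice a (single b 1)) w = lookup (single b 1) (a # w)"
    by (cases b) (auto simp: slice_def lookup_single when_def)
qed

lemma lookup_bump_Suc: "lookup (bump p) ((l, Suc n) # v) = lookup p ((l, n) # v)"
proof (rule lookup_eqI[OF qlinear_bump qlinear_id(1)])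
  fix b :: "'a word"
  show "lookup (bump (single b 1)) ((l, Suc n) # v) = lookup (single b 1) ((l, n) # v)"
    by (cases b rule: bump_word.cases) (auto simp: lookup_single when_def)
qed

lemma lookup_bump_0: "lookup (bump p) ((l, 0) # v) = 0"
proof -
  have "lookup (bump p) ((l, 0) # v) = lookup ((\<lambda>p. 0) p :: 'a word \<Rightarrow>\<^sub>0 rat) ((l, 0) # v)"
  proof (rule lookup_eqI[OF qlinear_bump qlinear_const_0])
    fix b :: "'a word"
    show "lookup (bump (single b 1)) ((l, 0) # v) = lookup (0 :: 'a word \<Rightarrow>\<^sub>0 rat) ((l, 0) # v)"
      by (cases b rule: bump_word.cases) (auto simp: lookup_single when_def)
  qed
  then show ?thesis by simp
qed

text \<open>In the recursion of \<open>theta\<close> only the \<open>bump\<close> part reaches words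
  with positive first exponent, and it shifts that exponent by one.\<close>

lemma lookup_theta_Suc: "lookup (theta p) ((l, Suc n) # v) = lookup (theta (lower p)) ((l, n) # v)"
proof (rule lookup_eqI[OF qlinear_theta qlinear_comp[OF qlinear_theta qlinear_lower]])
  fix b :: "'a word"
  show "lookup (theta (single b 1)) ((l, Suc n) # v) = lookup (theta (lower (single b 1))) ((l, n) # v)"
    by (cases b rule: lower_word.cases)
       (auto simp: lookup_single lookup_add theta_word_Cons lookup_bump_Suc lookup_cons_lin_Cons
         simp del: lower_word.simps(2))
qed

text \<open>\<open>bump\<close> never produces the first exponent \<open>0\<close>, so only the part
  that prefixes \<open>(l, 0)\<close> contributes, and only words starting with
  \<open>(l, 0)\<close> have that part.\<close>

lemma lookup_theta_0: "lookup (theta p) ((l, 0) # v) = lookup (theta (slice (l, 0) p)) v"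
proof (rule lookup_eqI[OF qlinear_theta qlinear_comp[OF qlinear_theta qlinear_slice]])
  fix b :: "'a word"
  show "lookup (theta (single b 1)) ((l, 0) # v) = lookup (theta (slice (l, 0) (single b 1))) v"
    by (cases b rule: lower_word.cases)
       (auto simp: lookup_single lookup_add theta_word_Cons lookup_bump_0 lookup_cons_lin_Cons slice_def
         simp del: lower_word.simps(2))
qed

lemma lookup_theta_Nil: "lookup (theta p) [] = lookup p []"
proof (rule lookup_eqI[OF qlinear_theta qlinear_id(1)])
  fix b :: "'a word"
  show "lookup (theta (single b 1)) [] = lookup (single b 1) []"
    using keys_theta_word[of b]
    by (cases b) (auto simp: lookup_single similar_def in_keys_iff)
qed

lemma lookup_lower_Cons:
  "lookup (lower p) ((l, n) # w) = lookup p ((l, Suc n) # w) + lookup (lower (slice (l, n) p)) w"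
proof -
  have "lookup (lower p) ((l, n) # w) = lookup (slice (l, Suc n) p + lower (slice (l, n) p)) w"
  proof (rule lookup_eqI[where p = p])
    fix b :: "'a word"
    show "lookup (lower (single b 1)) ((l, n) # w) =
       lookup (slice (l, Suc n) (single b 1) + lower (slice (l, n) (single b 1))) w"
      by (cases b rule: lower_word.cases)
         (auto simp: lookup_single lookup_add lookup_cons_lin_Cons slice_def when_def)
  qed (auto intro!: qlinear_plus qlinear_lower qlinear_slice qlinear_comp[OF qlinear_lower])
  then show ?thesis by (simp add: lookup_add lookup_slice)
qed

lemma keys_slice: "keys (slice a p) = {w. a # w \<in> keys p}"
  by (auto simp: in_keys_iff lookup_slice)

text \<open>The words with positive first exponent are recovered from the others and from \<open>lower p = 0\<close>.\<close>

lemma theta_kernel: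
  assumes "theta p = 0" "\<And>w. w \<in> keys p \<Longrightarrow> wt w < N"
  shows "p = 0"
  using assms
proof (induction N arbitrary: p)
  case 0
  then show ?case by (auto simp: poly_mapping_eq_iff in_keys_iff fun_eq_iff)
next
  case (Suc N)
  have Nil: "lookup p [] = 0" using lookup_theta_Nil[of p] Suc(2) by simp
  \<comment> \<open>At a nonempty word, the coefficient of \<open>theta (lower p)\<close> is that of
    \<open>theta p\<close> at the word with its first exponent increased.\<close>
  have "theta (lower p) = 0"
  proof (rule poly_mapping_eqI)
    fix v
    show "lookup (theta (lower p)) v = lookup 0 v"
    proof (cases v)
      case [simp]: Nil
      have "lookup (lower p) [] = lookup ((\<lambda>p. 0) p :: 'a word \<Rightarrow>\<^sub>0 rat) []"
      proof (rule lookup_eqI[OF qlinear_lower qlinear_const_0])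
        fix b :: "'a word"
        show "lookup (lower (single b 1)) [] = lookup (0 :: 'a word \<Rightarrow>\<^sub>0 rat) []"
          by (cases b rule: lower_word.cases) (auto simp: lookup_single lookup_add)
      qed
      then show ?thesis by (simp add: lookup_theta_Nil)
    next
      case (Cons a v')
      then show ?thesis using lookup_theta_Suc[of p "fst a" "snd a" v'] Suc(2) by simp
    qed
  qed
  moreover have "wt w < N" if "w \<in> keys (lower p)" for w
  proof -
    from that keys_lin_ext[of lower_word p] obtain v where "v \<in> keys p" "w \<in> keys (lower_word v)"
      by (auto simp: lower_def)
    then show ?thesis using Suc(3)[of v] keys_lower_word[of v] by auto
  qed
  ultimately have lower: "lower p = 0" by (rule Suc.IH)
  have slice0: "slice (l, 0) p = 0" for l
  proof (rule Suc.IH)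
    show "theta (slice (l, 0) p) = 0"
      by (rule poly_mapping_eqI) (simp flip: lookup_theta_0 add: Suc(2))
    show "wt w < N" if "w \<in> keys (slice (l, 0) p)" for w
      using that Suc(3)[of "(l, 0) # w"] by (auto simp: keys_slice)
  qed
  \<comment> \<open>With \<open>lower p = 0\<close>, \<open>lookup_lower_Cons\<close> says that
    \<open>slice (l, Suc n) p\<close> is minus \<open>lower (slice (l, n) p)\<close>.\<close>
  have slice: "slice (l, n) p = 0" for l n
  proof (induction n)
    case (Suc n)
    show ?case
      using lookup_lower_Cons[of p l n] by (intro poly_mapping_eqI) (simp add: lookup_slice lower Suc)
  qed (rule slice0)
  show "p = 0"
  proof (rule poly_mapping_eqI)
    fix w
    show "lookup p w = lookup 0 w"
    proof (cases w)
      case (Cons a v)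
      then show ?thesis using lookup_slice[of a p v] slice[of "fst a" "snd a"] by simp
    qed (simp add: Nil)
  qed
qed

lemma inj_theta: "inj theta"
proof (rule injI)
  fix p q :: "'a word \<Rightarrow>\<^sub>0 rat"
  assume "theta p = theta q"
  then have "theta (p - q) = 0" by simp
  moreover have "wt w < Suc (Max (wt ` keys (p - q)))" if "w \<in> keys (p - q)" for w
    using that by (auto simp: less_Suc_eq_le)
  ultimately have "p - q = 0" by (rule theta_kernel)
  then show "p = q" by simp
qed

lemma keys_raise_word_0: "keys (raise_word 0 w) \<subseteq> {v. wt v = Suc (wt w) \<and> map fst v = map fst w}"
  by (cases "(0 :: nat, w)" rule: raise_word.cases) auto

text \<open>A positive first exponent is reached by raising the first letter of a preimage of
  smaller weight; exponent \<open>0\<close> is reached by \<open>theta_cons_lin\<close>, whose error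
  term has positive first exponents only. The support bound is what makes the inverse respect weight
  and labels.\<close>

lemma theta_preimage: "\<exists>p. keys p \<subseteq> similar w \<and> theta p = single w 1"
proof (induction "wt w" arbitrary: w rule: less_induct)
  case less
  have pos: "\<exists>p. keys p \<subseteq> similar v \<and> theta p = single v 1"
    if "wt v = wt w" "v = (l, Suc n) # v'" for v :: "'a word" and l n v'
  proof -
    from less[of "(l, n) # v'"] that obtain p
      where p: "keys p \<subseteq> similar ((l, n) # v')" "theta p = single ((l, n) # v') 1" by force
    let ?q = "lin_ext (raise_word 0) p"
    have "theta ?q = lin_ext (raises_word 0) (theta p)"
    proof (rule qlinear_eqI[where p = p])
      fix u assume "u \<in> keys p"
      with p have "u \<noteq> []" by (auto simp: similar_def)
      then show "theta (lin_ext (raise_word 0) (single u 1)) = lin_ext (raises_word 0) (theta (single u 1))"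
        by (simp add: theta_raise_word)
    qed (auto intro!: qlinear_comp[OF qlinear_lin_ext] qlinear_comp[OF qlinear_theta] qlinear_lin_ext qlinear_theta)
    also have "\<dots> = smul (of_nat (Suc n)) (single v 1)" by (simp add: p that)
    finally have "theta (smul (1 / of_nat (Suc n)) ?q) = single v 1"
      by simp
    moreover have "keys (smul (1 / of_nat (Suc n)) ?q) \<subseteq> similar v"
    proof (intro keys_smul_subset keys_lin_ext_subset)
      fix u assume "u \<in> keys p"
      with p keys_raise_word_0[of u] show "keys (raise_word 0 u) \<subseteq> similar v"
        by (auto simp: similar_def that(2))
    qed
    ultimately show ?thesis by blast
  qed
  show ?case
  proof (cases w)
    case Nil
    then show ?thesis by (intro exI[of _ "single [] 1"]) (simp add: similar_def)
  next
    case (Cons a w')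
    then obtain l n where w: "w = (l, n) # w'" by (cases a) auto
    show ?thesis
    proof (cases n)
      case (Suc k)
      then show ?thesis using pos[of w l k w'] w by simp
    next
      case 0
      from less[of w'] w obtain p where p: "keys p \<subseteq> similar w'" "theta p = single w' 1" by force
      let ?c = "cons_lin (l, 0) p"
      let ?r = "bump (theta (lower ?c))"
      have eq: "theta ?c = single w 1 + ?r"
        by (subst theta_cons_lin) (simp add: p w 0)
      have c: "keys ?c \<subseteq> similar w"
        by (rule subset_trans[OF keys_cons_lin]) (use p in \<open>auto simp: similar_def w 0\<close>)
      have r: "v \<in> similar w \<and> (\<exists>l n v'. v = (l, Suc n) # v')" if "v \<in> keys ?r" for v
      proof -
        from that obtain u where u: "u \<in> keys (theta (lower ?c))" "v \<in> keys (bump_word u)"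
          unfolding bump_def by (rule keys_lin_extE)
        from u(1) obtain t where t: "t \<in> keys (lower ?c)" "u \<in> keys (theta_word t)"
          unfolding theta_def by (rule keys_lin_extE)
        from t(1) obtain s where s: "s \<in> keys ?c" "t \<in> keys (lower_word s)"
          unfolding lower_def by (rule keys_lin_extE)
        have "s \<in> similar w" "Suc (wt t) = wt s" "map fst t = map fst s" "u \<in> similar t"
          using c s keys_lower_word[of s] t(2) keys_theta_word[of t] by blast+
        moreover have "wt v = Suc (wt u)" "map fst v = map fst u" "\<exists>l n v'. v = (l, Suc n) # v'"
          using u(2) keys_bump_word[of u] by blast+
        ultimately show ?thesis by (simp add: similar_def)
      qed
      \<comment> \<open>Every word of the error term \<open>?r\<close> is similar to
        \<open>w\<close> with positive first exponent, so \<open>pos\<close> supplies the preimages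
        to be subtracted.\<close>
      define P where "P v = (SOME p. keys p \<subseteq> similar v \<and> theta p = single v 1)" for v :: "'a word"
      have P: "keys (P v) \<subseteq> similar w \<and> theta (P v) = single v 1" if v: "v \<in> keys ?r" for v
      proof -
        from r[OF v] obtain l n v' where "v = (l, Suc n) # v'" and sim: "v \<in> similar w" by blast
        then have "\<exists>p. keys p \<subseteq> similar v \<and> theta p = single v 1"
          by (intro pos) (auto simp: similar_def)
        from someI_ex[OF this] sim show ?thesis by (simp add: P_def similar_def)
      qed
      have "theta (lin_ext P ?r) = ?r"
        unfolding qlinear_lin_ext_out[OF qlinear_theta]
        using P by (subst (4) lin_ext_id[symmetric]) (rule lin_ext_cong, auto)
      then have "theta (?c - lin_ext P ?r) = single w 1" by (simp add: eq)
      moreover have "keys (?c - lin_ext P ?r) \<subseteq> similar w"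
        by (intro keys_diff_subset c keys_lin_ext_subset) (use P in auto)
      ultimately show ?thesis by blast
    qed
  qed
qed

lemma surj_theta: "surj theta"
proof -
  define P where "P v = (SOME p. keys p \<subseteq> similar v \<and> theta p = single v 1)" for v :: "'a word"
  have P: "theta (P v) = single v 1" for v
    using someI_ex[OF theta_preimage[of v]] by (simp add: P_def)
  have "q = theta (lin_ext P q)" for q
    by (simp add: qlinear_lin_ext_out[OF qlinear_theta] P lin_ext_id)
  then show ?thesis by (rule surjI[OF sym])
qed

lemma bij_theta: "bij theta"
  using inj_theta surj_theta by (rule bijI)

definition theta_inv :: "('l word \<Rightarrow>\<^sub>0 rat) \<Rightarrow> ('l word \<Rightarrow>\<^sub>0 rat)" where
  "theta_inv = inv theta"

lemma theta_theta_inv [simp]: "theta (theta_inv p) = p"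
  and theta_inv_theta [simp]: "theta_inv (theta p) = p"
  by (simp_all add: theta_inv_def surj_f_inv_f surj_theta inj_theta)

lemma qlinear_theta_inv: "qlinear theta_inv"
proof (rule qlinearI)
  show "theta_inv (p + q) = theta_inv p + theta_inv q" for p q :: "'l word \<Rightarrow>\<^sub>0 rat"
    using theta_inv_theta[of "theta_inv p + theta_inv q"] by simp
  show "theta_inv (smul c p) = smul c (theta_inv p)" for c and p :: "'l word \<Rightarrow>\<^sub>0 rat"
    using theta_inv_theta[of "smul c (theta_inv p)"] by simp
qed

lemma keys_theta_inv_single: "keys (theta_inv (single w 1)) \<subseteq> similar w"
  using theta_preimage[of w] by (metis theta_inv_theta)

section \<open>Compatibility with labels, derivations and shuffles\<close>

definition relabel :: "('l \<Rightarrow> 'm) \<Rightarrow> ('l word \<Rightarrow>\<^sub>0 rat) \<Rightarrow> ('m word \<Rightarrow>\<^sub>0 rat)" where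
  "relabel f = lin_ext (\<lambda>w. single (map (apfst f) w) 1)"

lemma qlinear_relabel: "qlinear (relabel f)"
  by (simp add: relabel_def qlinear_lin_ext)

lemma relabel_simps [simp]:
  "relabel f (single w c) = single (map (apfst f) w) c"
  "relabel f (p + q) = relabel f p + relabel f q"
  "relabel f 0 = 0"
  by (simp_all add: relabel_def)

lemma relabel_cons_lin: "relabel f (cons_lin (l, n) p) = cons_lin (f l, n) (relabel f p)"
  by (rule qlinear_eqI[where p = p])
     (auto intro!: qlinear_comp[OF qlinear_relabel] qlinear_comp[OF qlinear_cons_lin] qlinear_relabel qlinear_cons_lin)

lemma relabel_lower_word: "relabel f (lower_word w) = lower_word (map (apfst f) w)"
  by (induction w rule: lower_word.induct) (auto simp: relabel_cons_lin)

lemma relabel_bump: "relabel f (bump p) = bump (relabel f p)"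
proof (rule qlinear_eqI[OF qlinear_comp[OF qlinear_relabel qlinear_bump] qlinear_comp[OF qlinear_bump qlinear_relabel]])
  fix w show "relabel f (bump (single w 1)) = bump (relabel f (single w 1))"
    by (cases w rule: bump_word.cases) auto
qed

text \<open>The recursion copies labels without inspecting them. For the constant map to
  \<open>unit\<close> this becomes the passage from Chen fractions to compositions.\<close>

lemma relabel_theta_word: "relabel f (theta_word w) = theta_word (map (apfst f) w)"
proof (induction w rule: theta_word.induct)
  case (2 l n w)
  have "relabel f (theta (lower_word ((l, n) # w))) = theta (relabel f (lower_word ((l, n) # w)))"
    by (rule qlinear_eqI[OF qlinear_comp[OF qlinear_relabel qlinear_theta] qlinear_comp[OF qlinear_theta qlinear_relabel]])
       (simp add: 2)
  then show ?case
    using 2(1)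
    by (simp add: theta_word_Cons relabel_bump relabel_cons_lin relabel_lower_word del: lower_word.simps)
qed simp

lemma relabel_theta: "relabel f (theta p) = theta (relabel f p)"
  by (rule qlinear_eqI[OF qlinear_comp[OF qlinear_relabel qlinear_theta] qlinear_comp[OF qlinear_theta qlinear_relabel]])
     (simp add: relabel_theta_word)

lemma decon_word_map:
  "tens_map (lin_ext (\<lambda>w. single (map f w) 1)) (lin_ext (\<lambda>w. single (map f w) 1)) (decon_word w)
     = decon_word (map f w)"
  by (simp add: decon_word_sum qlinear_sum[OF qlinear_tens_map] take_map drop_map)

lemma decon_relabel: "tens_map (relabel f) (relabel f) (decon p) = decon (relabel f p)"
  by (rule qlinear_eqI[OF qlinear_comp[OF qlinear_tens_map qlinear_decon] qlinear_comp[OF qlinear_decon qlinear_relabel]])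
     (simp add: relabel_def decon_word_map)

lemma theta_word_zeros: "(\<And>a. a \<in> set w \<Longrightarrow> snd a = 0) \<Longrightarrow> theta_word w = single w 1"
proof (induction w)
  case (Cons a w)
  have "(\<And>a. a \<in> set w \<Longrightarrow> snd a = 0) \<Longrightarrow> lower_word w = 0" for w :: "'a word"
    by (induction w rule: lower_word.induct) fastforce+
  from this[of "a # w"] Cons have "lower_word (a # w) = 0" "theta_word w = single w 1" by auto
  moreover obtain l where "a = (l, 0)" using Cons(2)[of a] by (cases a) auto
  ultimately show ?case by (simp add: theta_word_Cons)
qed simp

section \<open>Derivations on words\<close>

fun diff_word :: "'l \<Rightarrow> 'l word \<Rightarrow> ('l word \<Rightarrow>\<^sub>0 rat)" where
  "diff_word i [] = 0"
| "diff_word i ((l, n) # w) =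
     (if l = i then single ((l, Suc n) # w) (of_nat (Suc n)) else 0) + cons_lin (l, n) (diff_word i w)"

definition diff :: "'l \<Rightarrow> ('l word \<Rightarrow>\<^sub>0 rat) \<Rightarrow> ('l word \<Rightarrow>\<^sub>0 rat)" where
  "diff i = lin_ext (diff_word i)"

lemma qlinear_diff_op: "qlinear (diff i)"
  by (simp add: diff_def qlinear_lin_ext)

lemma diff_single [simp]: "diff i (single w c) = smul c (diff_word i w)"
  by (simp add: diff_def)

lemma diff_word_notin: "i \<notin> fst ` set w \<Longrightarrow> diff_word i w = 0"
  by (induction w rule: diff_word.induct) auto

lemma diff_word_eq_raise_word:
  "distinct (map fst w) \<Longrightarrow> m < length w \<Longrightarrow> diff_word (fst (w ! m)) w = raise_word m w"
proof (induction m w rule: raise_word.induct)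
  case (2 l n w)
  then show ?case by (simp add: diff_word_notin)
next
  case (3 m l n w)
  then have "fst (w ! m) \<in> fst ` set w" by simp
  with 3 show ?case by auto
qed simp

text \<open>\<open>diff_word\<close> acts on one letter at a time, and each letter lies on exactly
  one side of a cut; hence it is a coderivation.\<close>

lemma decon_diff_word:
  "decon (diff_word i w) = tens_map id (diff i) (decon_word w) + tens_map (diff i) id (decon_word w)"
proof (induction w)
  case (Cons a w)
  obtain l n where a: "a = (l, n)" by force
  have 1: "tens_map id (diff i) (consl (l, n) t) = consl (l, n) (tens_map id (diff i) t)" for t :: "'a word \<times> 'a word \<Rightarrow>\<^sub>0 rat"
    by (rule qlinear_eqI[where p = t])
       (auto intro!: qlinear_comp[OF qlinear_tens_map] qlinear_comp[OF qlinear_consl] qlinear_tens_map qlinear_consl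
          simp: consl_tens)
  have 2: "tens_map (diff i) id (consl (l, n) t) =
      (if l = i then smul (of_nat (Suc n)) (consl (l, Suc n) t) else 0) + consl (l, n) (tens_map (diff i) id t)"
    for t :: "'a word \<times> 'a word \<Rightarrow>\<^sub>0 rat"
    by (rule qlinear_eqI[where p = t])
       (auto intro!: qlinear_comp[OF qlinear_tens_map] qlinear_comp[OF qlinear_consl] qlinear_tens_map qlinear_consl
          qlinear_plus qlinear_if qlinear_const_0 qlinear_scale
          simp: consl_tens tens_left_simps simp del: of_nat_Suc)
  have 3: "tens_map id (diff i) (single ([], (l, n) # w) 1) = tens (single [] 1) (diff_word i ((l, n) # w))"
    "tens_map (diff i) id (single ([], (l, n) # w) 1) = 0"
    by (simp_all add: qlinear_0[OF qlinear_tens_left] qlinear_0[OF qlinear_tens_right])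
  have 4: "decon (diff_word i ((l, n) # w)) =
      tens (single [] 1) (diff_word i ((l, n) # w))
      + (if l = i then smul (of_nat (Suc n)) (consl (l, Suc n) (decon_word w)) else 0)
      + consl (l, n) (decon (diff_word i w))"
    by (simp add: decon_cons_lin tens_right_simps Q.scale_right_distrib qlinear_0[OF qlinear_tens_right] algebra_simps del: of_nat_Suc)
  show ?case
    unfolding a 4 decon_word.simps qlinear_add[OF qlinear_tens_map] 1 2 3 Cons
    by (simp add: algebra_simps del: diff_word.simps of_nat_Suc)
qed (simp add: qlinear_0[OF qlinear_tens_left] qlinear_0[OF qlinear_tens_right])

section \<open>Words as noncommutative polynomials, and the product\<close>

fun code_word :: "'l word \<Rightarrow> letter list" where
  "code_word [] = []"
| "code_word ((l, n) # w) = replicate n X0 @ X1 # code_word w"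

definition word_poly :: "('l word \<Rightarrow>\<^sub>0 rat) \<Rightarrow> ncpol" where
  "word_poly = lin_ext (\<lambda>w. single (code_word w) 1)"

lemma qlinear_word_poly: "qlinear word_poly"
  by (simp add: word_poly_def qlinear_lin_ext)

lemma word_poly_single [simp]: "word_poly (single w c) = single (code_word w) c"
  by (simp add: word_poly_def)

lemma word_poly_cons_lin: "word_poly (cons_lin (l, 0) p) = cons_lin X1 (word_poly p)"
  by (rule qlinear_eqI[where p = p])
     (auto intro!: qlinear_comp[OF qlinear_word_poly] qlinear_comp[OF qlinear_cons_lin] qlinear_word_poly qlinear_cons_lin)

text \<open>\<open>bump\<close> annihilates the empty word while prefixing \<open>X0\<close> does
  not; hence the condition on the support.\<close>

lemma word_poly_bump: "[] \<notin> keys p \<Longrightarrow> word_poly (bump p) = cons_lin X0 (word_poly p)"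
proof (rule qlinear_eqI[OF qlinear_comp[OF qlinear_word_poly qlinear_bump] qlinear_comp[OF qlinear_cons_lin qlinear_word_poly]])
  fix b assume "[] \<notin> keys p" "b \<in> keys p"
  then show "word_poly (bump (single b 1)) = cons_lin X0 (word_poly (single b 1))"
    by (cases b rule: bump_word.cases) auto
qed

definition theta_poly :: "('l word \<Rightarrow>\<^sub>0 rat) \<Rightarrow> ncpol" where
  "theta_poly p = word_poly (theta p)"

lemma qlinear_theta_poly: "qlinear theta_poly"
  unfolding theta_poly_def[abs_def] by (rule qlinear_comp[OF qlinear_word_poly qlinear_theta])

lemma theta_poly_Cons:
  "theta_poly (single ((l, n) # w) 1) =
     cons_lin X1 (if n = 0 then theta_poly (single w 1) else 0)
     + cons_lin X0 (theta_poly (lower_word ((l, n) # w)))"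
proof -
  have "[] \<notin> keys (theta (lower_word ((l, n) # w)))"
  proof
    assume "[] \<in> keys (theta (lower_word ((l, n) # w)))"
    then obtain v where "v \<in> keys (lower_word ((l, n) # w))" "[] \<in> keys (theta_word v)"
      unfolding theta_def by (rule keys_lin_extE)
    then have "map fst v = map fst ((l, n) # w)" "[] \<in> similar v"
      using keys_lower_word[of "(l, n) # w"] keys_theta_word[of v] by blast+
    then show False by (auto simp: similar_def)
  qed
  from word_poly_bump[OF this] show ?thesis
    by (simp add: theta_poly_def theta_word_Cons qlinear_add[OF qlinear_word_poly] word_poly_cons_lin
        qlinear_0[OF qlinear_word_poly] del: lower_word.simps)
qed

lemma theta_poly_cons_lin:
  "theta_poly (cons_lin (l, n) p) =
     cons_lin X1 (if n = 0 then theta_poly p else 0) + cons_lin X0 (theta_poly (lower (cons_lin (l, n) p)))"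
  by (rule qlinear_eqI[where p = p])
     (auto intro!: qlinear_comp[OF qlinear_theta_poly] qlinear_comp[OF qlinear_cons_lin] qlinear_theta_poly
        qlinear_cons_lin qlinear_comp[OF qlinear_lower] qlinear_plus qlinear_if qlinear_const_0
        simp: theta_poly_Cons simp del: lower_word.simps)

text \<open>\<open>lower\<close> acts on one letter at a time and shuffling keeps letters intact, so
  \<open>lower\<close> is a derivation of the shuffle product.\<close>

lemma lower_shuf_word:
  "lower (shuf_word u v) = shuf (lower_word u) (single v 1) + shuf (single u 1) (lower_word v)"
proof (induction u v rule: shuf_word.induct)
  case (3 a u b v)
  obtain l m k n where ab [simp]: "a = (l, m)" "b = (k, n)" by (metis surj_pair)
  have 1: "shuf (cons_lin x p) (single (y # v) 1) =
      cons_lin x (shuf p (single (y # v) 1)) + cons_lin y (shuf (cons_lin x p) (single v 1))" for x y p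
    using shuf_cons_cons[of x p y "single v 1"] by simp
  have 2: "shuf (single (y # u) 1) (cons_lin x p) =
      cons_lin x (shuf (single (y # u) 1) p) + cons_lin y (shuf (single u 1) (cons_lin x p))" for x y p
    using shuf_cons_cons[of y "single u 1" x p] by simp
  from 3 show ?case
    by (cases m; cases n; simp add: lower_cons_lin shuf_left_simps shuf_right_simps 1 2 algebra_simps)
qed (simp_all add: shuf_left_simps shuf_right_simps)

text \<open>Both sides have the same recursion: a leading \<open>X1\<close> strips a letter with
  exponent \<open>0\<close>, a leading \<open>X0\<close> applies the derivation
  \<open>lower\<close>. The induction is on total weight because \<open>lower\<close> decreases
  exponents and leaves lengths unchanged.\<close>

lemma theta_poly_shuf_word:
  "theta_poly (shuf_word u v) = shuf (theta_poly (single u 1)) (theta_poly (single v 1))"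
proof (induction "wt u + wt v" arbitrary: u v rule: less_induct)
  case less
  show ?case
  proof (cases "u = [] \<or> v = []")
    case True
    then show ?thesis by (auto simp: theta_poly_def)
  next
    case False
    then obtain l m u' k n v' where [simp]: "u = (l, m) # u'" "v = (k, n) # v'"
      by (metis neq_Nil_conv surj_pair)
    let ?u = "theta_poly (single u 1)" and ?v = "theta_poly (single v 1)"
    have 1: "theta_poly (shuf (lower_word u) (single v 1)) = shuf (theta_poly (lower_word u)) ?v"
    proof (rule qlinear_eqI[where p = "lower_word u"])
      fix b assume "b \<in> keys (lower_word u)"
      then have "wt b < wt u" using keys_lower_word[of u] by auto
      then show "theta_poly (shuf (single b 1) (single v 1)) = shuf (theta_poly (single b 1)) ?v"
        using less[of b v] by simp
    qed (intro qlinear_comp[OF qlinear_theta_poly] qlinear_comp[OF qlinear_shuf_left] qlinear_shuf_left qlinear_theta_poly)+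
    have 2: "theta_poly (shuf (single u 1) (lower_word v)) = shuf ?u (theta_poly (lower_word v))"
    proof (rule qlinear_eqI[where p = "lower_word v"])
      fix b assume "b \<in> keys (lower_word v)"
      then have "wt b < wt v" using keys_lower_word[of v] by auto
      then show "theta_poly (shuf (single u 1) (single b 1)) = shuf ?u (theta_poly (single b 1))"
        using less[of u b] by simp
    qed (intro qlinear_comp[OF qlinear_theta_poly] qlinear_comp[OF qlinear_shuf_right] qlinear_shuf_right qlinear_theta_poly)+
    define U1 where "U1 = (if m = 0 then theta_poly (single u' 1) else 0)"
    define V1 where "V1 = (if n = 0 then theta_poly (single v' 1) else 0)"
    have uv: "?u = cons_lin X1 U1 + cons_lin X0 (theta_poly (lower_word u))"
      "?v = cons_lin X1 V1 + cons_lin X0 (theta_poly (lower_word v))"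
      by (simp_all add: theta_poly_Cons U1_def V1_def del: lower_word.simps)
    have "theta_poly (shuf_word u v) =
        cons_lin X1 (if m = 0 then theta_poly (shuf_word u' v) else 0)
        + cons_lin X1 (if n = 0 then theta_poly (shuf_word u v') else 0)
        + cons_lin X0 (theta_poly (lower (shuf_word u v)))"
      by (simp add: theta_poly_cons_lin qlinear_add[OF qlinear_theta_poly] algebra_simps)
    also have "lower (shuf_word u v) = shuf (lower_word u) (single v 1) + shuf (single u 1) (lower_word v)"
      by (rule lower_shuf_word)
    also have "(if m = 0 then theta_poly (shuf_word u' v) else 0) = shuf U1 ?v"
      using less[of u' v] by (auto simp: U1_def shuf_left_simps)
    also have "(if n = 0 then theta_poly (shuf_word u v') else 0) = shuf ?u V1"
      using less[of u v'] by (auto simp: V1_def shuf_right_simps)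
    also have "cons_lin X1 (shuf U1 ?v) + cons_lin X1 (shuf ?u V1)
        + cons_lin X0 (theta_poly (shuf (lower_word u) (single v 1) + shuf (single u 1) (lower_word v)))
        = shuf ?u ?v"
      unfolding qlinear_add[OF qlinear_theta_poly] 1 2 unfolding uv
      by (simp add: shuf_left_simps shuf_right_simps shuf_cons_cons algebra_simps del: lower_word.simps)
    finally show ?thesis .
  qed
qed

lemma theta_poly_shuf: "theta_poly (shuf p q) = shuf (theta_poly p) (theta_poly q)"
  by (rule bilinear_eqI)
     (auto intro!: qlinear_comp[OF qlinear_theta_poly] qlinear_shuf_left qlinear_shuf_right
        qlinear_comp[OF qlinear_shuf_left] qlinear_comp[OF qlinear_shuf_right] qlinear_theta_poly
        simp: theta_poly_shuf_word)

lemma shuffle_word_eq: "shuffle_word u v = shuf_word u v"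
  by (induction u v rule: shuffle_word.induct) (auto simp: cons_lin_def)

lemma shuffle_eq: "shuffle p q = shuf p q"
  by (simp add: shuffle_def shuf_def shuffle_word_eq)

section \<open>Compositions as words\<close>

definition word_comp :: "'l word \<Rightarrow> composition" where
  "word_comp w = Abs_composition (map (\<lambda>a. Suc (snd a)) w)"

lemma Rep_word_comp: "Rep_composition (word_comp w) = map (\<lambda>a. Suc (snd a)) w"
  unfolding word_comp_def by (rule Abs_composition_inverse) auto

lemma weight_word_comp: "weight (word_comp w) = wt w"
  by (simp add: weight_def Rep_word_comp)

definition comp_word :: "composition \<Rightarrow> unit word" where
  "comp_word c = map (\<lambda>s. ((), s - 1)) (Rep_composition c)"

lemma word_comp_comp_word [simp]: "word_comp (comp_word c) = c"
proof -
  have "map (\<lambda>a. Suc (snd a)) (comp_word c) = Rep_composition c"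
    using Rep_composition[of c] by (auto simp: comp_word_def intro!: map_idI)
  then show ?thesis by (simp add: word_comp_def Rep_composition_inverse)
qed

lemma comp_word_word_comp [simp]: "comp_word (word_comp w) = w"
  by (auto simp: comp_word_def Rep_word_comp intro!: map_idI)

definition to_H :: "('l word \<Rightarrow>\<^sub>0 rat) \<Rightarrow> H" where
  "to_H = lin_ext (\<lambda>w. single (word_comp w) 1)"

lemma qlinear_to_H: "qlinear to_H"
  by (simp add: to_H_def qlinear_lin_ext)

lemma to_H_single [simp]: "to_H (single w c) = single (word_comp w) c"
  by (simp add: to_H_def)

lemma bij_to_H: "bij (to_H :: (unit word \<Rightarrow>\<^sub>0 rat) \<Rightarrow> H)"
proof (rule bijI')
  fix p q :: "unit word \<Rightarrow>\<^sub>0 rat"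
  have "lin_ext (\<lambda>c. single (comp_word c) 1) (to_H p) = p" for p :: "unit word \<Rightarrow>\<^sub>0 rat"
    by (simp add: to_H_def lin_ext_lin_ext lin_ext_id)
  then show "to_H p = to_H q \<longleftrightarrow> p = q" by metis
next
  fix u
  show "\<exists>p :: unit word \<Rightarrow>\<^sub>0 rat. u = to_H p"
    by (rule exI[of _ "lin_ext (\<lambda>c. single (comp_word c) 1) u"])
       (simp add: to_H_def lin_ext_lin_ext lin_ext_id)
qed

lemma rho_to_H: "rho (to_H p) = word_poly p"
proof -
  have "concat (map (\<lambda>s. replicate (s - 1) X0 @ [X1]) (Rep_composition (word_comp w))) = code_word w"
    for w :: "'a word"
    by (induction w rule: code_word.induct) (auto simp: Rep_word_comp)
  then show ?thesis
    by (simp add: rho_def to_H_def word_poly_def lin_ext_lin_ext)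
qed

lemma code_word_inj: "code_word u = code_word (v :: unit word) \<Longrightarrow> u = v"
proof (induction u arbitrary: v rule: code_word.induct)
  case 1
  then show ?case by (cases v rule: code_word.cases) auto
next
  case (2 l n w)
  have *: "m = n \<and> xs = ys"
    if "replicate m X0 @ X1 # xs = replicate n X0 @ X1 # ys" for m n xs ys
    using that
  proof (induction m arbitrary: n)
    case 0
    then show ?case by (cases n) auto
  next
    case (Suc m)
    then show ?case by (cases n) auto
  qed
  from 2(2) show ?case
  proof (cases v rule: code_word.cases)
    case (2 l' n' w')
    then show ?thesis using *[of n "code_word w" n' "code_word w'"] 2(1) \<open>code_word ((l, n) # w) = code_word v\<close> "2.IH"
      by auto
  qed auto
qed

lemma inj_word_poly: "inj (word_poly :: (unit word \<Rightarrow>\<^sub>0 rat) \<Rightarrow> ncpol)"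
proof (rule inj_on_inverseI)
  fix p :: "unit word \<Rightarrow>\<^sub>0 rat"
  have "inv code_word (code_word w) = (w :: unit word)" for w
    by (rule inv_f_f) (auto intro: injI code_word_inj)
  then show "lin_ext (\<lambda>x. single (inv code_word x) 1) (word_poly p) = p"
    by (simp add: word_poly_def lin_ext_lin_ext lin_ext_id)
qed

lemma inj_rho: "inj rho"
proof (rule injI)
  fix u v assume "rho u = rho v"
  moreover obtain p q where "u = to_H (p :: unit word \<Rightarrow>\<^sub>0 rat)" "v = to_H (q :: unit word \<Rightarrow>\<^sub>0 rat)"
    using bij_to_H by (metis bij_pointE)
  ultimately show "u = v"
    using inj_word_poly by (simp add: rho_to_H inj_eq)
qed

definition word_iso :: "(unit word \<Rightarrow>\<^sub>0 rat) \<Rightarrow> H" where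
  "word_iso p = to_H (theta p)"

lemma qlinear_word_iso: "qlinear word_iso"
  unfolding word_iso_def[abs_def] by (rule qlinear_comp[OF qlinear_to_H qlinear_theta])

lemma bij_word_iso: "bij word_iso"
  unfolding word_iso_def[abs_def] using bij_comp[OF bij_theta bij_to_H] by (simp add: o_def)

text \<open>The shuffle of two values of \<open>rho\<close> is exhibited as a value of
  \<open>rho\<close>. Since \<open>word_iso\<close> is onto, this includes closure of the image
  under shuffles, so \<open>the_inv\<close> in \<open>shuffle_star\<close> acts inside the
  image.\<close>

lemma word_iso_shuf: "word_iso (shuf p q) = shuffle_star (word_iso p) (word_iso q)"
proof -
  have "shuffle (rho (word_iso p)) (rho (word_iso q)) = rho (word_iso (shuf p q))"
    using theta_poly_shuf[of p q] by (simp add: word_iso_def rho_to_H shuffle_eq theta_poly_def)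
  then show ?thesis
    by (simp add: shuffle_star_def the_inv_f_f[OF inj_rho])
qed

section \<open>Linear independence of Chen fractions\<close>

definition monom_val :: "(nat \<Rightarrow> real) \<Rightarrow> (nat \<Rightarrow>\<^sub>0 nat) \<Rightarrow> real" where
  "monom_val x m = (\<Prod>i\<in>keys m. x i ^ lookup m i)"

definition mpol_val :: "(nat \<Rightarrow> real) \<Rightarrow> mpol \<Rightarrow> real" where
  "mpol_val x p = (\<Sum>m\<in>keys p. of_rat (lookup p m) * monom_val x m)"

lemma monom_val_superset:
  "finite A \<Longrightarrow> keys m \<subseteq> A \<Longrightarrow> monom_val x m = (\<Prod>i\<in>A. x i ^ lookup m i)"
  unfolding monom_val_def by (rule prod.mono_neutral_left) (auto simp: in_keys_iff)

lemma monom_val_add: "monom_val x (m + n) = monom_val x m * monom_val x n"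
proof -
  have "keys (m + n) \<subseteq> keys m \<union> keys n" by (rule Poly_Mapping.keys_add)
  then show ?thesis
    by (subst (1 2 3) monom_val_superset[of "keys m \<union> keys n"])
       (auto simp: lookup_add power_add prod.distrib)
qed

lemma mpol_val_superset:
  "finite A \<Longrightarrow> keys p \<subseteq> A \<Longrightarrow> mpol_val x p = (\<Sum>m\<in>A. of_rat (lookup p m) * monom_val x m)"
  unfolding mpol_val_def by (rule sum.mono_neutral_left) (auto simp: in_keys_iff)

lemma mpol_val_add: "mpol_val x (p + q) = mpol_val x p + mpol_val x q"
proof -
  have "keys (p + q) \<subseteq> keys p \<union> keys q" by (rule Poly_Mapping.keys_add)
  then show ?thesis
    by (subst (1 2 3) mpol_val_superset[of "keys p \<union> keys q"])
       (auto simp: lookup_add of_rat_add algebra_simps sum.distrib)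
qed

lemma mpol_val_0 [simp]: "mpol_val x 0 = 0"
  by (simp add: mpol_val_def)

lemma mpol_val_single: "mpol_val x (single m c) = of_rat c * monom_val x m"
  by (subst mpol_val_superset[of "{m}"]) auto

lemma mpol_val_mult: "mpol_val x (p * q) = mpol_val x p * mpol_val x q"
proof -
  have *: "mpol_val x (single m c * q) = mpol_val x (single m c) * mpol_val x q" for m c
    by (induction q rule: poly_mapping_single_add_induct)
       (simp_all add: distrib_left mpol_val_add mult_single mpol_val_single monom_val_add of_rat_mult)
  show ?thesis
    by (induction p rule: poly_mapping_single_add_induct)
       (simp_all add: distrib_right mpol_val_add *)
qed

lemma mpol_val_1 [simp]: "mpol_val x 1 = 1"
  by (simp add: mpol_val_single monom_val_def flip: single_one)

lemma mpol_val_var: "mpol_val x (single (single i 1) 1) = x i"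
  by (simp add: mpol_val_single monom_val_def)

text \<open>A relation and not a function, since a value at \<open>x\<close> is available only if
  some representing denominator does not vanish there.\<close>

definition has_value :: "(nat \<Rightarrow> real) \<Rightarrow> ratfun \<Rightarrow> real \<Rightarrow> bool" where
  "has_value x f r \<longleftrightarrow> (\<exists>a b. f = Fract a b \<and> mpol_val x b \<noteq> 0 \<and> r = mpol_val x a / mpol_val x b)"

lemma has_value_unique:
  assumes "has_value x f r" "has_value x f s"
  shows "r = s"
proof -
  obtain a b c d where f: "f = Fract a b" "f = Fract c d" and nz: "mpol_val x b \<noteq> 0" "mpol_val x d \<noteq> 0"
    and rs: "r = mpol_val x a / mpol_val x b" "s = mpol_val x c / mpol_val x d"
    using assms unfolding has_value_def by blast
  from nz have "b \<noteq> 0" "d \<noteq> 0" by auto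
  with f have "a * d = c * b" by (simp add: eq_fract)
  then have "mpol_val x a * mpol_val x d = mpol_val x c * mpol_val x b"
    by (metis mpol_val_mult)
  then show ?thesis using nz by (simp add: rs frac_eq_eq)
qed

lemma has_value_add:
  assumes "has_value x f r" "has_value x g s"
  shows "has_value x (f + g) (r + s)"
proof -
  obtain a b c d where fg: "f = Fract a b" "g = Fract c d" and nz: "mpol_val x b \<noteq> 0" "mpol_val x d \<noteq> 0"
    and rs: "r = mpol_val x a / mpol_val x b" "s = mpol_val x c / mpol_val x d"
    using assms by (auto simp: has_value_def)
  from nz have "b \<noteq> 0" "d \<noteq> 0" by auto
  then have "f + g = Fract (a * d + c * b) (b * d)" by (simp add: fg)
  then show ?thesis
    unfolding has_value_def using nz rs
    by (intro exI[of _ "a * d + c * b"] exI[of _ "b * d"])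
       (simp add: mpol_val_add mpol_val_mult add_frac_eq)
qed

lemma has_value_0: "has_value x 0 0"
  unfolding has_value_def by (intro exI[of _ 0] exI[of _ 1]) (simp add: Zero_fract_def)

lemma has_value_sum:
  "(\<And>a. a \<in> A \<Longrightarrow> has_value x (f a) (r a)) \<Longrightarrow> has_value x (sum f A) (sum r A)"
  by (induction A rule: infinite_finite_induct) (auto intro: has_value_0 has_value_add)

text \<open>The denominator of a Chen fraction, with factors read from the last index to the first;
  \<open>s\<close> is the sum of the variables already passed. This order puts the index whose
  variable tends to \<open>0\<close> at the head of the list.\<close>

fun rev_den :: "(nat \<Rightarrow> real) \<Rightarrow> real \<Rightarrow> nat word \<Rightarrow> real" where
  "rev_den x s [] = 1"
| "rev_den x s ((i, n) # w) = (s + x i) ^ Suc n * rev_den x (s + x i) w"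

lemma rev_den_append:
  "rev_den x s (u @ [(i, n)]) = rev_den x s u * (s + sum_list (map (\<lambda>a. x (fst a)) u) + x i) ^ Suc n"
  by (induction x s u rule: rev_den.induct) (auto simp: algebra_simps)

lemma rev_den_pos:
  "s > 0 \<Longrightarrow> (\<And>i. x i \<ge> 0) \<Longrightarrow> rev_den x s w > 0"
proof (induction x s w rule: rev_den.induct)
  case (2 x s i n w)
  then have "s + x i > 0" by (simp add: add_pos_nonneg)
  with 2 show ?case by simp
qed simp

lemma rev_den_pos_0: "(\<And>i. x i > 0) \<Longrightarrow> rev_den x 0 w > 0"
proof (cases w)
  case (Cons a w')
  assume "\<And>i. x i > 0"
  then show ?thesis using Cons rev_den_pos[of "x (fst a)" x w'] by (cases a) (auto simp: less_imp_le)
qed simp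

lemma rev_den_cong: "(\<And>a. a \<in> set w \<Longrightarrow> x (fst a) = y (fst a)) \<Longrightarrow> rev_den x s w = rev_den y s w"
  by (induction x s w rule: rev_den.induct) fastforce+

lemma tendsto_rev_den:
  assumes "(a \<longlongrightarrow> a0) F" "((\<lambda>t. t) \<longlongrightarrow> t0) F"
  shows "((\<lambda>t. rev_den (x(j := t)) (a t) w) \<longlongrightarrow> rev_den (x(j := t0)) a0 w) F"
  using assms(1)
proof (induction w arbitrary: a a0)
  case (Cons b w)
  obtain i n where b: "b = (i, n)" by force
  have "((\<lambda>t. (x(j := t)) i) \<longlongrightarrow> (x(j := t0)) i) F"
    using assms(2) by (cases "i = j") auto
  with Cons.prems have "((\<lambda>t. a t + (x(j := t)) i) \<longlongrightarrow> a0 + (x(j := t0)) i) F"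
    by (rule tendsto_add)
  from tendsto_mult[OF tendsto_power[OF this, of "Suc n"] Cons.IH[OF this]] show ?case
    unfolding b rev_den.simps .
qed simp

text \<open>Among the fractions whose last index is \<open>j\<close>, those with the largest last exponent \<open>Suc S\<close> dominate as
  \<open>x j\<close> tends to \<open>0\<close>, while fractions with another last index stay bounded.\<close>

lemma rev_den_limit:
  assumes x: "\<And>i. x i > 0" and w: "distinct (map fst w)"
    and S: "\<And>n r. w = (j, n) # r \<Longrightarrow> n \<le> S"
  shows "((\<lambda>t. t ^ Suc S / rev_den (x(j := t)) 0 w) \<longlongrightarrow>
           (if w \<noteq> [] \<and> hd w = (j, S) then 1 / rev_den x 0 (tl w) else 0)) (at_right 0)"
proof (cases w)
  case Nil
  then show ?thesis by (auto intro!: tendsto_eq_intros)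
next
  case (Cons a r)
  obtain k n where a: "a = (k, n)" by force
  have t0: "((\<lambda>t::real. t) \<longlongrightarrow> 0) (at_right 0)" by (rule tendsto_ident_at)
  have y: "(x(j := 0)) i \<ge> 0" for i using x[of i] by auto
  show ?thesis
  proof (cases "k = j")
    case False
    \<comment> \<open>The first factor is a power of \<open>x k\<close>, and every later sum
      contains \<open>x k\<close>, so nothing vanishes at \<open>t = 0\<close>.\<close>
    have "rev_den (x(j := 0)) 0 w > 0"
      using False x[of k] rev_den_pos[of "x k" "x(j := 0)" r] y by (simp add: Cons a)
    then have "((\<lambda>t. t ^ Suc S / rev_den (x(j := t)) 0 w) \<longlongrightarrow> 0 ^ Suc S / rev_den (x(j := 0)) 0 w) (at_right 0)"
      by (intro tendsto_divide tendsto_power t0 tendsto_rev_den tendsto_const) auto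
    then show ?thesis using False by (simp add: Cons a)
  next
    case [simp]: True
    have n: "n \<le> S" using S Cons a by simp
    have "j \<notin> fst ` set r" using w by (simp add: Cons a)
    then have eq: "rev_den (x(j := t)) s r = rev_den x s r" for s t
      by (intro rev_den_cong) auto
    have pos: "rev_den x 0 r > 0" by (rule rev_den_pos_0[OF x])
    \<comment> \<open>The head \<open>(j, n)\<close> contributes exactly \<open>t ^ Suc n\<close> to
      the denominator; the remaining \<open>t ^ (S - n)\<close> tends to \<open>0\<close> unless
      \<open>n = S\<close>.\<close>
    have "((\<lambda>t. t ^ (S - n) / rev_den (x(j := t)) t r) \<longlongrightarrow> 0 ^ (S - n) / rev_den (x(j := 0)) 0 r) (at_right 0)"
      using pos by (intro tendsto_divide tendsto_power t0 tendsto_rev_den) (auto simp: eq)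
    moreover have "eventually (\<lambda>t. t ^ (S - n) / rev_den (x(j := t)) t r = t ^ Suc S / rev_den (x(j := t)) 0 w) (at_right 0)"
      unfolding eventually_at_right_field
    proof (intro exI[of _ 1] conjI allI impI)
      fix t :: real assume "0 < t" "t < 1"
      have "t ^ Suc S = t ^ Suc n * t ^ (S - n)" using n by (simp flip: power_add)
      then show "t ^ (S - n) / rev_den (x(j := t)) t r = t ^ Suc S / rev_den (x(j := t)) 0 w"
        using \<open>0 < t\<close> by (simp add: Cons a)
    qed simp
    ultimately have "((\<lambda>t. t ^ Suc S / rev_den (x(j := t)) 0 w) \<longlongrightarrow> 0 ^ (S - n) / rev_den x 0 r) (at_right 0)"
      unfolding eq by (rule Lim_transform_eventually)
    moreover have "0 ^ (S - n) / rev_den x 0 r =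
        (if w \<noteq> [] \<and> hd w = (j, S) then 1 / rev_den x 0 (tl w) else 0)"
      using n by (auto simp: Cons a)
    ultimately show ?thesis by simp
  qed
qed

text \<open>Multiplying a relation by \<open>t ^ Suc S\<close> and letting \<open>x j = t\<close>
  tend to \<open>0\<close> leaves a relation among the tails of the words with head
  \<open>(j, S)\<close>; these are shorter, whence the induction on the length bound
  \<open>N\<close>.\<close>

lemma rev_den_independent:
  fixes c :: "nat word \<Rightarrow> real"
  assumes "finite A" "\<And>w. w \<in> A \<Longrightarrow> distinct (map fst w)" "\<And>w. w \<in> A \<Longrightarrow> length w < N"
    and "\<And>x. (\<And>i. x i > 0) \<Longrightarrow> (\<Sum>w\<in>A. c w / rev_den x 0 w) = 0"
    and "w \<in> A"
  shows "c w = 0"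
  using assms
proof (induction N arbitrary: A c w)
  case (Suc N)
  \<comment> \<open>Discarding zero coefficients first ensures that the maximal exponent
    \<open>S\<close> is attained by a word with nonzero coefficient.\<close>
  define B where "B = {w \<in> A. c w \<noteq> 0}"
  have B: "finite B" "\<And>w. w \<in> B \<Longrightarrow> distinct (map fst w)" "\<And>w. w \<in> B \<Longrightarrow> length w < Suc N"
    "\<And>w. w \<in> B \<Longrightarrow> c w \<noteq> 0"
    using Suc.prems by (auto simp: B_def)
  have sum0: "(\<Sum>w\<in>B. c w / rev_den x 0 w) = 0" if "\<And>i. x i > 0" for x
  proof -
    have "(\<Sum>w\<in>B. c w / rev_den x 0 w) = (\<Sum>w\<in>A. c w / rev_den x 0 w)"
      using Suc.prems(1) by (intro sum.mono_neutral_left) (auto simp: B_def)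
    then show ?thesis using Suc.prems(4)[OF that] by simp
  qed
  have nil: "v = []" if v: "v \<in> B" for v
  proof (rule ccontr)
    assume "v \<noteq> []"
    then obtain j n r where vj: "(j, n) # r \<in> B" using v by (metis neq_Nil_conv surj_pair)
    define E where "E = {n. \<exists>r. (j, n) # r \<in> B}"
    have "E \<subseteq> (\<lambda>w. snd (hd w)) ` B" by (force simp: E_def)
    then have finE: "finite E" using B(1) finite_subset by blast
    moreover have "E \<noteq> {}" using vj by (auto simp: E_def)
    ultimately have "Max E \<in> E" by (rule Max_in)
    define S where "S = Max E"
    have le: "m \<le> S" if "(j, m) # s \<in> B" for m s
      unfolding S_def using finE by (rule Max_ge) (use that in \<open>auto simp: E_def\<close>)
    define C where "C = {r. (j, S) # r \<in> B}"
    have finC: "finite C"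
      using finite_vimageI[OF B(1), of "(#) (j, S)"] by (simp add: C_def vimage_def)
    have "c ((j, S) # s) = 0" if s: "s \<in> C" for s
    proof (rule Suc.IH[of C "\<lambda>s. c ((j, S) # s)", OF finC _ _ _ s])
      show "distinct (map fst w)" if "w \<in> C" for w using B(2) that by (force simp: C_def)
      show "length w < N" if "w \<in> C" for w using B(3) that by (force simp: C_def)
      fix x :: "nat \<Rightarrow> real" assume x: "\<And>i. x i > 0"
      have "((\<lambda>t. \<Sum>w\<in>B. c w * (t ^ Suc S / rev_den (x(j := t)) 0 w)) \<longlongrightarrow>
          (\<Sum>w\<in>B. c w * (if w \<noteq> [] \<and> hd w = (j, S) then 1 / rev_den x 0 (tl w) else 0))) (at_right 0)"
        by (intro tendsto_sum tendsto_mult tendsto_const rev_den_limit x B(2)) (auto intro: le)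
      moreover have "eventually (\<lambda>t. (\<Sum>w\<in>B. c w * (t ^ Suc S / rev_den (x(j := t)) 0 w)) = 0) (at_right 0)"
        unfolding eventually_at_right_field
      proof (intro exI[of _ 1] conjI allI impI)
        fix t :: real assume "0 < t" "t < 1"
        have "(\<Sum>w\<in>B. c w * (t ^ Suc S / rev_den (x(j := t)) 0 w)) =
            t ^ Suc S * (\<Sum>w\<in>B. c w / rev_den (x(j := t)) 0 w)"
          by (simp add: sum_distrib_left mult_ac)
        also have "(\<Sum>w\<in>B. c w / rev_den (x(j := t)) 0 w) = 0"
          using x \<open>0 < t\<close> by (intro sum0) auto
        finally show "(\<Sum>w\<in>B. c w * (t ^ Suc S / rev_den (x(j := t)) 0 w)) = 0"
          by (simp only: mult_zero_right)
      qed simp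
      ultimately have lim: "((\<lambda>t. 0) \<longlongrightarrow>
          (\<Sum>w\<in>B. c w * (if w \<noteq> [] \<and> hd w = (j, S) then 1 / rev_den x 0 (tl w) else 0))) (at_right (0::real))"
        by (rule Lim_transform_eventually)
      have "(\<Sum>w\<in>B. c w * (if w \<noteq> [] \<and> hd w = (j, S) then 1 / rev_den x 0 (tl w) else 0)) =
          (\<Sum>w\<in>(#) (j, S) ` C. c w * (1 / rev_den x 0 (tl w)))"
      proof (rule sum.mono_neutral_cong_right)
        show "\<forall>w\<in>B - (#) (j, S) ` C. c w * (if w \<noteq> [] \<and> hd w = (j, S) then 1 / rev_den x 0 (tl w) else 0) = 0"
        proof
          fix w assume "w \<in> B - (#) (j, S) ` C"
          then have "\<not> (w \<noteq> [] \<and> hd w = (j, S))"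
            by (cases w) (auto simp: C_def)
          then show "c w * (if w \<noteq> [] \<and> hd w = (j, S) then 1 / rev_den x 0 (tl w) else 0) = 0"
            by (simp only: if_False mult_zero_right)
        qed
      qed (use B in \<open>auto simp: C_def\<close>)
      also have "\<dots> = (\<Sum>s\<in>C. c ((j, S) # s) / rev_den x 0 s)"
        by (subst sum.reindex) auto
      finally show "(\<Sum>s\<in>C. c ((j, S) # s) / rev_den x 0 s) = 0"
        using tendsto_unique[OF _ lim tendsto_const] by simp
    qed
    moreover obtain s where "s \<in> C" using \<open>Max E \<in> E\<close> by (auto simp: E_def C_def S_def)
    ultimately show False using B(4)[of "(j, S) # s"] by (simp add: C_def)
  qed
  show "c w = 0"
  proof (rule ccontr)
    assume "c w \<noteq> 0"
    then have "w \<in> B" using Suc.prems(5) by (simp add: B_def)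
    then have "B = {[]}" using nil by auto
    then have "c [] = 0" using sum0[of "\<lambda>_. 1"] by simp
    then show False using \<open>B = {[]}\<close> B(4) by auto
  qed
qed force

section \<open>Derivatives of Chen fractions\<close>

lemma has_value_mult:
  assumes "has_value x f r" "has_value x g s"
  shows "has_value x (f * g) (r * s)"
proof -
  obtain a b c d where fg: "f = Fract a b" "g = Fract c d" and nz: "mpol_val x b \<noteq> 0" "mpol_val x d \<noteq> 0"
    and rs: "r = mpol_val x a / mpol_val x b" "s = mpol_val x c / mpol_val x d"
    using assms unfolding has_value_def by blast
  then show ?thesis
    unfolding has_value_def
    by (intro exI[of _ "a * c"] exI[of _ "b * d"]) (simp add: mpol_val_mult)
qed

lemma has_value_inverse:
  assumes "has_value x f r" "r \<noteq> 0"
  shows "has_value x (1 / f) (1 / r)"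
proof -
  obtain a b where "f = Fract a b" "mpol_val x b \<noteq> 0" "r = mpol_val x a / mpol_val x b"
    using assms unfolding has_value_def by blast
  then show ?thesis
    unfolding has_value_def using assms(2)
    by (intro exI[of _ b] exI[of _ a]) (simp add: One_fract_def)
qed

lemma has_value_1: "has_value x 1 1"
  unfolding has_value_def by (intro exI[of _ 1]) (simp add: One_fract_def)

lemma has_value_power: "has_value x f r \<Longrightarrow> has_value x (f ^ n) (r ^ n)"
  by (induction n) (auto intro: has_value_1 has_value_mult)

lemma has_value_var_rf: "has_value x (var_rf i) (x i)"
  unfolding has_value_def var_rf_def
  by (intro exI[of _ "single (single i 1) 1"] exI[of _ 1]) (simp add: mpol_val_var[simplified])

lemma has_value_const_rf: "has_value x (const_rf c) (of_rat c)"
  unfolding has_value_def const_rf_def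
  by (intro exI[of _ "single 0 c"] exI[of _ 1]) (simp add: mpol_val_single monom_val_def)

definition index_sum :: "nat word \<Rightarrow> ratfun" where
  "index_sum w = sum_list (map (\<lambda>a. var_rf (fst a)) w)"

fun chen_word :: "nat word \<Rightarrow> ratfun" where
  "chen_word [] = 1"
| "chen_word ((i, n) # w) = (1 / index_sum ((i, n) # w)) ^ Suc n * chen_word w"

lemma chen_frac_eq: "chen_frac (map fst w) (map (\<lambda>a. Suc (snd a)) w) = chen_word w"
proof (induction w rule: chen_word.induct)
  case (2 i n w)
  have sum: "(\<Sum>l = 0..<length v. var_rf (map fst v ! l)) = index_sum v" for v
    by (simp add: index_sum_def sum_list_sum_nth)
  have "chen_frac (map fst ((i, n) # w)) (map (\<lambda>a. Suc (snd a)) ((i, n) # w)) =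
      1 / (index_sum ((i, n) # w) ^ Suc n *
        (\<Prod>j<length w. (\<Sum>l = j..<length w. var_rf (map fst w ! l)) ^ Suc (snd (w ! j))))"
    using sum[of "(i, n) # w"]
    by (simp add: chen_frac_def prod.lessThan_Suc_shift sum.shift_bounds_Suc_ivl del: prod.lessThan_Suc sum.op_ivl_Suc power_Suc)
  also have "\<dots> = (1 / index_sum ((i, n) # w)) ^ Suc n * chen_frac (map fst w) (map (\<lambda>a. Suc (snd a)) w)"
    by (simp add: chen_frac_def power_one_over del: power_Suc)
  finally show ?case using 2 by simp
qed (simp add: chen_frac_def)

lemma has_value_index_sum: "has_value x (index_sum w) (sum_list (map (\<lambda>a. x (fst a)) w))"
  by (induction w) (auto simp: index_sum_def intro: has_value_0 has_value_add has_value_var_rf)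

lemma has_value_chen_word:
  assumes x: "\<And>i. x i > 0"
  shows "has_value x (chen_word w) (1 / rev_den x 0 (rev w))"
proof (induction w rule: chen_word.induct)
  case (2 i n w)
  have "sum_list (map (\<lambda>a. x (fst a)) w) \<ge> 0"
    by (rule sum_list_nonneg) (use x in \<open>auto simp: less_imp_le\<close>)
  then have "sum_list (map (\<lambda>a. x (fst a)) ((i, n) # w)) \<noteq> 0"
    using x[of i] by simp
  from has_value_mult[OF has_value_power[OF has_value_inverse[OF has_value_index_sum this], of "Suc n"] 2]
  have "has_value x (chen_word ((i, n) # w))
     ((1 / sum_list (map (\<lambda>a. x (fst a)) ((i, n) # w))) ^ Suc n * (1 / rev_den x 0 (rev w)))"
    unfolding chen_word.simps .
  also have "(1 / sum_list (map (\<lambda>a. x (fst a)) ((i, n) # w))) ^ Suc n * (1 / rev_den x 0 (rev w)) =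
      1 / rev_den x 0 (rev ((i, n) # w))"
    by (simp add: rev_den_append rev_map[symmetric] sum_list_rev power_one_over add.commute del: power_Suc)
  finally show ?case .
qed (simp add: has_value_1)

text \<open>At the point with all coordinates \<open>1\<close> the sum takes the length of
  \<open>w\<close> as its value.\<close>

lemma index_sum_nonzero: "w \<noteq> [] \<Longrightarrow> index_sum w \<noteq> 0"
proof
  assume "w \<noteq> []" "index_sum w = 0"
  then have "(0::real) = sum_list (map (\<lambda>a. 1) w)"
    using has_value_unique[OF has_value_0 has_value_index_sum[of "\<lambda>_. 1" w, unfolded \<open>index_sum w = 0\<close>]] by simp
  with \<open>w \<noteq> []\<close> show False by (simp add: sum_list_triv)
qed

text \<open>\<open>chen_val\<close> is the case \<open>g = Rep_chen\<close>; the general form also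
  evaluates combinations of words.\<close>

definition comb :: "('b \<Rightarrow> ratfun) \<Rightarrow> ('b \<Rightarrow>\<^sub>0 rat) \<Rightarrow> ratfun" where
  "comb g p = (\<Sum>b\<in>keys p. const_rf (lookup p b) * g b)"

lemma const_rf_simps [simp]:
  "const_rf 0 = 0" "const_rf 1 = 1"
  "const_rf (a + b) = const_rf a + const_rf b"
  "const_rf (a * b) = const_rf a * const_rf b"
  by (simp_all add: const_rf_def Zero_fract_def One_fract_def single_add mult_single)

lemma const_rf_of_nat: "const_rf (of_nat n) = of_nat n"
  by (induction n) auto

lemma comb_superset:
  "finite A \<Longrightarrow> keys p \<subseteq> A \<Longrightarrow> comb g p = (\<Sum>b\<in>A. const_rf (lookup p b) * g b)"
  unfolding comb_def by (rule sum.mono_neutral_left) (auto simp: in_keys_iff)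

lemma comb_add: "comb g (p + q) = comb g p + comb g q"
proof -
  have "keys (p + q) \<subseteq> keys p \<union> keys q" by (rule Poly_Mapping.keys_add)
  then show ?thesis
    by (subst (1 2 3) comb_superset[of "keys p \<union> keys q"])
       (auto simp: lookup_add algebra_simps sum.distrib)
qed

lemma comb_0 [simp]: "comb g 0 = 0"
  by (simp add: comb_def)

lemma comb_diff: "comb g (p - q) = comb g p - comb g q"
  using comb_add[of g "p - q" q] by simp

lemma comb_single [simp]: "comb g (single b c) = const_rf c * g b"
  by (subst comb_superset[of "{b}"]) auto

lemma comb_smul: "comb g (smul c p) = const_rf c * comb g p"
  by (induction p rule: poly_mapping_single_add_induct)
     (auto simp: comb_add Q.scale_right_distrib algebra_simps)

lemma comb_lin_ext: "comb g (lin_ext f p) = comb (\<lambda>b. comb g (f b)) p"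
  by (induction p rule: poly_mapping_single_add_induct) (auto simp: comb_add comb_smul)

lemma comb_cong: "(\<And>b. b \<in> keys p \<Longrightarrow> g b = h b) \<Longrightarrow> comb g p = comb h p"
  by (simp add: comb_def)

lemma comb_mult: "comb (\<lambda>b. f * g b) p = f * comb g p"
  by (simp add: comb_def sum_distrib_left mult_ac)

text \<open>Evaluating at all positive points turns a vanishing combination into the hypothesis of
  \<open>rev_den_independent\<close> for the reversed words.\<close>

lemma chen_word_independent:
  assumes "\<And>w. w \<in> keys p \<Longrightarrow> distinct (map fst w)" "comb chen_word p = 0"
  shows "p = 0"
proof (rule poly_mapping_eqI)
  fix w
  define A where "A = rev ` keys p"
  define c :: "nat word \<Rightarrow> real" where "c v = of_rat (lookup p (rev v))" for v
  have "c v = 0" if "v \<in> A" for v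
  proof (rule rev_den_independent[of A "Suc (Max (length ` A))", OF _ _ _ _ that])
    show "finite A" by (simp add: A_def)
    then show "length w < Suc (Max (length ` A))" if "w \<in> A" for w
      using that by (simp add: less_Suc_eq_le)
    show "distinct (map fst w)" if "w \<in> A" for w
      using that assms(1) by (auto simp: A_def rev_map[symmetric])
    fix x :: "nat \<Rightarrow> real" assume x: "\<And>i. x i > 0"
    have "has_value x (comb chen_word p) (\<Sum>w\<in>keys p. of_rat (lookup p w) * (1 / rev_den x 0 (rev w)))"
      unfolding comb_def by (intro has_value_sum has_value_mult has_value_const_rf has_value_chen_word x)
    then have "(\<Sum>w\<in>keys p. of_rat (lookup p w) * (1 / rev_den x 0 (rev w))) = 0"
      using has_value_unique[OF has_value_0] assms(2) by metis
    then show "(\<Sum>w\<in>A. c w / rev_den x 0 w) = 0"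
      by (simp add: A_def c_def sum.reindex inj_on_def)
  qed
  from this[of "rev w"] show "lookup p w = lookup 0 w"
    by (cases "w \<in> keys p") (auto simp: A_def c_def in_keys_iff)
qed

section \<open>Rules of differentiation and derivatives of Chen fractions\<close>

lemma pderiv_rf_add: "pderiv_rf i (f + g) = pderiv_rf i f + pderiv_rf i g"
proof -
  obtain a b c d where "f = Fract a b" "b \<noteq> 0" "g = Fract c d" "d \<noteq> 0"
    by (metis Fract_cases)
  then show ?thesis
    by (simp add: pderiv_rf_Fract eq_fract mpol_pderiv_add mpol_pderiv_mult) (simp add: algebra_simps)
qed

lemma pderiv_rf_mult: "pderiv_rf i (f * g) = pderiv_rf i f * g + f * pderiv_rf i g"
proof -
  obtain a b c d where "f = Fract a b" "b \<noteq> 0" "g = Fract c d" "d \<noteq> 0"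
    by (metis Fract_cases)
  then show ?thesis
    by (simp add: pderiv_rf_Fract eq_fract mpol_pderiv_mult) (simp add: algebra_simps)
qed

lemma mpol_pderiv_1 [simp]: "mpol_pderiv i 1 = 0"
  by (simp add: mpol_pderiv_single flip: single_one)

lemma pderiv_rf_const [simp]: "pderiv_rf i (const_rf c) = 0"
  by (simp add: const_rf_def pderiv_rf_Fract mpol_pderiv_single Zero_fract_def)

lemma pderiv_rf_0 [simp]: "pderiv_rf i 0 = 0" and pderiv_rf_1 [simp]: "pderiv_rf i 1 = 0"
  using pderiv_rf_const[of i 0] pderiv_rf_const[of i 1] by (simp_all del: pderiv_rf_const)

lemma pderiv_rf_var: "pderiv_rf i (var_rf j) = (if i = j then 1 else 0)"
  by (auto simp: var_rf_def pderiv_rf_Fract mpol_pderiv_single Zero_fract_def One_fract_def lookup_single)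

lemma pderiv_rf_inverse:
  assumes "f \<noteq> 0"
  shows "pderiv_rf i (1 / f) = - pderiv_rf i f * (1 / f) ^ 2"
proof -
  have "0 = pderiv_rf i (f * (1 / f))" using assms by simp
  also have "\<dots> = pderiv_rf i f * (1 / f) + f * pderiv_rf i (1 / f)" by (rule pderiv_rf_mult)
  finally have "f * pderiv_rf i (1 / f) = - (pderiv_rf i f * (1 / f))" by (simp add: eq_neg_iff_add_eq_0 add.commute)
  then show ?thesis using assms by (simp add: field_simps power2_eq_square)
qed

lemma pderiv_rf_power: "pderiv_rf i (f ^ Suc n) = of_nat (Suc n) * f ^ n * pderiv_rf i f"
  by (induction n) (simp_all add: pderiv_rf_mult algebra_simps)

lemma pderiv_rf_sum: "pderiv_rf i (sum f A) = (\<Sum>a\<in>A. pderiv_rf i (f a))"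
  by (induction A rule: infinite_finite_induct) (auto simp: pderiv_rf_add)

lemma pderiv_rf_comb: "pderiv_rf i (comb g p) = comb (\<lambda>b. pderiv_rf i (g b)) p"
  by (simp add: comb_def pderiv_rf_sum pderiv_rf_mult)

text \<open>Only the factors whose sum contains the variable of \<open>i\<close> are affected, that
  is, those up to the position of \<open>i\<close>; the recursion stops once \<open>i\<close> no
  longer occurs.\<close>

fun chen_diff_word :: "nat \<Rightarrow> nat word \<Rightarrow> (nat word \<Rightarrow>\<^sub>0 rat)" where
  "chen_diff_word i [] = 0"
| "chen_diff_word i ((l, n) # w) =
     (if i \<in> fst ` set ((l, n) # w)
      then single ((l, Suc n) # w) (of_nat (Suc n)) + cons_lin (l, n) (chen_diff_word i w) else 0)"

lemma chen_diff_word_notin: "i \<notin> fst ` set w \<Longrightarrow> chen_diff_word i w = 0"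
  by (cases "(i, w)" rule: chen_diff_word.cases) auto

lemma chen_diff_word_eq_raises_word:
  "distinct (map fst w) \<Longrightarrow> m < length w \<Longrightarrow> chen_diff_word (fst (w ! m)) w = raises_word m w"
proof (induction m w rule: raises_word.induct)
  case (2 l n w)
  then show ?case by (simp add: chen_diff_word_notin)
next
  case (3 m l n w)
  then have "fst (w ! m) \<in> fst ` set w" by simp
  with 3 show ?case by auto
qed simp

lemma keys_chen_diff_word: "keys (chen_diff_word i w) \<subseteq> {v. map fst v = map fst w}"
proof (induction i w rule: chen_diff_word.induct)
  case (2 i l n w)
  have "keys (cons_lin (l, n) (chen_diff_word i w)) \<subseteq> {v. map fst v = map fst ((l, n) # w)}"
    if "i \<in> fst ` set ((l, n) # w)"
    by (rule subset_trans[OF keys_cons_lin]) (use 2[OF that] in auto)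
  moreover have "keys (single ((l, Suc n) # w) (of_nat (Suc n) :: rat)) \<subseteq> {v. map fst v = map fst ((l, n) # w)}"
    by (rule keys_single_subset) simp
  ultimately show ?case
    unfolding chen_diff_word.simps by (auto simp del: of_nat_Suc dest!: subsetD[OF Poly_Mapping.keys_add])
qed simp

lemma index_sum_cong: "map fst v = map fst w \<Longrightarrow> index_sum v = index_sum w"
  unfolding index_sum_def by (metis (no_types, lifting) map_map comp_def map_eq_conv)

text \<open>The words of \<open>p\<close> share their labels, so the new outer factor is the same
  for all of them and can be pulled out.\<close>

lemma comb_chen_word_cons_lin:
  assumes "keys p \<subseteq> {v. map fst v = map fst w}"
  shows "comb chen_word (cons_lin (l, n) p) = (1 / index_sum ((l, n) # w)) ^ Suc n * comb chen_word p"
proof -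
  have "comb chen_word (cons_lin (l, n) p) = comb (\<lambda>v. (1 / index_sum ((l, n) # w)) ^ Suc n * chen_word v) p"
    unfolding cons_lin_def comb_lin_ext
  proof (rule comb_cong)
    fix v assume "v \<in> keys p"
    with assms have "index_sum ((l, n) # v) = index_sum ((l, n) # w)"
      by (intro index_sum_cong) auto
    then show "comb chen_word (single ((l, n) # v) 1) = (1 / index_sum ((l, n) # w)) ^ Suc n * chen_word v"
      by simp
  qed
  then show ?thesis by (simp only: comb_mult)
qed

lemma pderiv_rf_index_sum:
  "distinct (map fst w) \<Longrightarrow> pderiv_rf i (index_sum w) = (if i \<in> fst ` set w then 1 else 0)"
  by (induction w) (auto simp: index_sum_def pderiv_rf_add pderiv_rf_var)

text \<open>Product rule: differentiating the outer factor raises its exponent by one with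
  coefficient \<open>Suc n\<close>; the inner product is handled by induction.\<close>

lemma pderiv_rf_chen_word:
  "distinct (map fst w) \<Longrightarrow> - pderiv_rf i (chen_word w) = comb chen_word (chen_diff_word i w)"
proof (induction w)
  case (Cons a w)
  obtain l n where a: "a = (l, n)" by force
  define Z where "Z = 1 / index_sum ((l, n) # w)"
  have Z: "pderiv_rf i Z = (if i \<in> fst ` set (a # w) then - (Z ^ 2) else 0)"
    using pderiv_rf_inverse[OF index_sum_nonzero, of "(l, n) # w" i] pderiv_rf_index_sum[OF Cons.prems, of i]
    by (simp add: Z_def a)
  have IH: "- pderiv_rf i (chen_word w) = comb chen_word (chen_diff_word i w)" using Cons by simp
  have "index_sum ((l, Suc n) # w) = index_sum ((l, n) # w)" by (rule index_sum_cong) simp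
  then have up: "chen_word ((l, Suc n) # w) = Z ^ Suc (Suc n) * chen_word w" by (simp add: Z_def)
  have "- pderiv_rf i (chen_word (a # w)) =
      of_nat (Suc n) * Z ^ n * (- pderiv_rf i Z) * chen_word w + Z ^ Suc n * (- pderiv_rf i (chen_word w))"
    unfolding a chen_word.simps Z_def[symmetric] pderiv_rf_mult pderiv_rf_power by (simp add: algebra_simps)
  also have "\<dots> = comb chen_word (chen_diff_word i (a # w))"
  proof (cases "i \<in> fst ` set (a # w)")
    case True
    have "comb chen_word (chen_diff_word i (a # w)) =
        of_nat (Suc n) * chen_word ((l, Suc n) # w) + Z ^ Suc n * comb chen_word (chen_diff_word i w)"
      using True by (simp only: a chen_diff_word.simps if_True comb_add comb_single const_rf_of_nat
          comb_chen_word_cons_lin[OF keys_chen_diff_word] Z_def)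
    then show ?thesis
      using True unfolding IH up by (simp add: Z power2_eq_square algebra_simps)
  next
    case False
    then show ?thesis by (simp add: IH Z chen_diff_word_notin a)
  qed
  finally show ?case .
qed simp

section \<open>The coproduct on Chen fractions\<close>

text \<open>The words that stand for genuine Chen fractions. Elsewhere \<open>chen_of\<close> may
  apply \<open>Abs_chen\<close> outside \<open>F_ch\<close>, so statements about it restrict the
  support to this set.\<close>

definition chen_words :: "nat word set" where
  "chen_words = {w. distinct (map fst w) \<and> (\<forall>a\<in>set w. 1 \<le> fst a)}"

lemma chen_words_iff: "w \<in> chen_words \<longleftrightarrow> distinct (map fst w) \<and> (\<forall>i\<in>set (map fst w). 1 \<le> i)"
  by (auto simp: chen_words_def)

lemma chen_words_cong: "map fst v = map fst w \<Longrightarrow> v \<in> chen_words \<longleftrightarrow> w \<in> chen_words"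
  by (simp only: chen_words_iff)

definition word_of :: "nat list \<Rightarrow> nat list \<Rightarrow> nat word" where
  "word_of is ss = zip is (map (\<lambda>s. s - 1) ss)"

lemma word_of:
  assumes "chen_index is ss"
  shows "map fst (word_of is ss) = is" "map (\<lambda>a. Suc (snd a)) (word_of is ss) = ss"
    "word_of is ss \<in> chen_words" "length (word_of is ss) = length is"
proof -
  have len: "length is = length ss" and pos: "\<And>s. s \<in> set ss \<Longrightarrow> 1 \<le> s"
    using assms by (auto simp: chen_index_def)
  show 1: "map fst (word_of is ss) = is" by (simp add: word_of_def len)
  have "map (\<lambda>a. Suc (snd a)) (word_of is ss) = map Suc (map snd (word_of is ss))" by simp
  also have "\<dots> = ss" by (auto simp: word_of_def len intro!: map_idI dest!: pos)
  finally show "map (\<lambda>a. Suc (snd a)) (word_of is ss) = ss" .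
  show "word_of is ss \<in> chen_words"
    unfolding chen_words_iff 1 using assms by (simp add: chen_index_def)
  show "length (word_of is ss) = length is" by (simp add: word_of_def len)
qed

lemma chen_index_word:
  "w \<in> chen_words \<Longrightarrow> chen_index (map fst w) (map (\<lambda>a. Suc (snd a)) w)"
  by (auto simp: chen_index_def chen_words_def)

definition chen_of :: "nat word \<Rightarrow> chen" where
  "chen_of w = Abs_chen (chen_word w)"

lemma Rep_chen_of: "w \<in> chen_words \<Longrightarrow> Rep_chen (chen_of w) = chen_word w"
proof -
  assume w: "w \<in> chen_words"
  have "chen_word w \<in> F_ch"
  proof (cases "w = []")
    case False
    then show ?thesis
      unfolding F_ch_def using chen_index_word[OF w] chen_frac_eq[of w]
      by (metis (mono_tags, lifting) insertI2 list.map_disc_iff mem_Collect_eq)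
  qed (simp add: F_ch_def)
  then show ?thesis by (simp add: chen_of_def Abs_chen_inverse)
qed

text \<open>Linear independence applied to a difference of two basis words; it makes the word of a
  basis element of the span of \<open>F_ch\<close> unique.\<close>

lemma chen_word_inj:
  assumes "u \<in> chen_words" "v \<in> chen_words" "chen_word u = chen_word v"
  shows "u = v"
proof (rule ccontr)
  assume "u \<noteq> v"
  let ?p = "single u 1 - single v (1::rat)"
  have "keys ?p \<subseteq> {u, v}" by (rule keys_diff_subset) auto
  then have "distinct (map fst w)" if "w \<in> keys ?p" for w
    using that assms by (auto simp: chen_words_def)
  moreover have "comb chen_word ?p = 0"
    unfolding comb_diff comb_single by (simp add: assms(3))
  ultimately have "?p = 0" by (rule chen_word_independent)
  then have "single u (1::rat) = single v 1" by simp
  with \<open>u \<noteq> v\<close> show False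
    by (metis lookup_single_eq lookup_single_not_eq zero_neq_one)
qed

definition word_of_chen :: "chen \<Rightarrow> nat word" where
  "word_of_chen c = (THE w. w \<in> chen_words \<and> chen_of w = c)"

lemma chen_of_inj: "u \<in> chen_words \<Longrightarrow> v \<in> chen_words \<Longrightarrow> chen_of u = chen_of v \<Longrightarrow> u = v"
  using Rep_chen_of chen_word_inj by metis

lemma word_of_chen_of: "w \<in> chen_words \<Longrightarrow> word_of_chen (chen_of w) = w"
  unfolding word_of_chen_def by (rule the_equality) (auto intro: chen_of_inj)

lemma chen_of_cases:
  obtains w where "w \<in> chen_words" "c = chen_of w"
proof -
  have "Rep_chen c \<in> F_ch" by (rule Rep_chen)
  then have "\<exists>w\<in>chen_words. Rep_chen c = chen_word w"
    unfolding F_ch_def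
  proof
    assume "Rep_chen c = 1"
    then show ?thesis by (intro bexI[of _ "[]"]) (auto simp: chen_words_def)
  next
    assume "Rep_chen c \<in> {chen_frac is ss |is ss. is \<noteq> [] \<and> chen_index is ss}"
    then obtain "is" ss where "Rep_chen c = chen_frac is ss" "chen_index is ss" by blast
    then show ?thesis
      using chen_frac_eq[of "word_of is ss"] word_of[of "is" ss] by auto
  qed
  then show ?thesis
    using that Rep_chen_of by (metis Rep_chen_inject)
qed

lemma word_of_chen: "word_of_chen c \<in> chen_words" "chen_of (word_of_chen c) = c"
  by (cases c rule: chen_of_cases; simp add: word_of_chen_of)+

definition to_QF :: "(nat word \<Rightarrow>\<^sub>0 rat) \<Rightarrow> QF_ch" where
  "to_QF = lin_ext (\<lambda>w. single (chen_of w) 1)"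

definition of_QF :: "QF_ch \<Rightarrow> (nat word \<Rightarrow>\<^sub>0 rat)" where
  "of_QF = lin_ext (\<lambda>c. single (word_of_chen c) 1)"

lemma qlinear_to_QF: "qlinear to_QF" and qlinear_of_QF: "qlinear of_QF"
  by (simp_all add: to_QF_def of_QF_def qlinear_lin_ext)

lemma to_QF_single [simp]: "to_QF (single w c) = single (chen_of w) c"
  by (simp add: to_QF_def)

lemma of_QF_single [simp]: "of_QF (single w c) = single (word_of_chen w) c"
  by (simp add: of_QF_def)

lemma to_QF_of_QF [simp]: "to_QF (of_QF u) = u"
  by (simp add: to_QF_def of_QF_def lin_ext_lin_ext word_of_chen lin_ext_id)

lemma keys_of_QF: "keys (of_QF u) \<subseteq> chen_words"
  unfolding of_QF_def by (rule keys_lin_ext_subset) (simp add: word_of_chen)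

lemma of_QF_to_QF: "keys p \<subseteq> chen_words \<Longrightarrow> of_QF (to_QF p) = p"
  by (rule qlinear_eqI[OF qlinear_comp[OF qlinear_of_QF qlinear_to_QF] qlinear_id(1)])
     (auto simp: word_of_chen_of)

lemma chen_val_eq: "chen_val u = comb Rep_chen u"
  by (simp add: chen_val_def comb_def)

lemma chen_val_to_QF: "keys p \<subseteq> chen_words \<Longrightarrow> chen_val (to_QF p) = comb chen_word p"
  unfolding chen_val_eq to_QF_def comb_lin_ext
  by (rule comb_cong) (auto simp: Rep_chen_of)

text \<open>Linear independence again, now in the form that gives \<open>the_inv chen_val\<close> in
  \<open>dneg\<close> its meaning.\<close>

lemma inj_chen_val: "inj chen_val"
proof (rule injI)
  fix u v assume "chen_val u = chen_val v"
  then have "comb chen_word (of_QF u - of_QF v) = 0"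
    using chen_val_to_QF[OF keys_of_QF[of u]] chen_val_to_QF[OF keys_of_QF[of v]] by (simp add: comb_diff)
  moreover have "distinct (map fst w)" if "w \<in> keys (of_QF u - of_QF v)" for w
    using that keys_diff_subset[OF keys_of_QF keys_of_QF] by (auto simp: chen_words_def)
  ultimately have "of_QF u - of_QF v = 0" by (intro chen_word_independent)
  then have "of_QF u = of_QF v" by simp
  then show "u = v" by (metis to_QF_of_QF)
qed

definition chen_diff :: "nat \<Rightarrow> (nat word \<Rightarrow>\<^sub>0 rat) \<Rightarrow> (nat word \<Rightarrow>\<^sub>0 rat)" where
  "chen_diff i = lin_ext (chen_diff_word i)"

lemma qlinear_chen_diff: "qlinear (chen_diff i)"
  by (simp add: chen_diff_def qlinear_lin_ext)

lemma keys_chen_diff: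
  assumes "keys p \<subseteq> chen_words"
  shows "keys (chen_diff i p) \<subseteq> chen_words"
  unfolding chen_diff_def
proof (rule keys_lin_ext_subset)
  fix w assume "w \<in> keys p"
  with assms have "w \<in> chen_words" by blast
  then show "keys (chen_diff_word i w) \<subseteq> chen_words"
    using keys_chen_diff_word[of i w] chen_words_cong by blast
qed

lemma comb_uminus: "comb (\<lambda>b. - g b) p = - comb g p"
  by (simp add: comb_def sum_negf)

text \<open>The derivative is displayed as a value of \<open>chen_val\<close>, which is closure of
  the span under derivatives; injectivity then evaluates \<open>the_inv\<close>.\<close>

lemma dneg_to_QF:
  assumes "keys p \<subseteq> chen_words"
  shows "dneg i (to_QF p) = to_QF (chen_diff i p)"
proof -
  have "- pderiv_rf i (chen_val (to_QF p)) = comb (\<lambda>w. - pderiv_rf i (chen_word w)) p"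
    by (simp add: chen_val_to_QF assms pderiv_rf_comb comb_uminus)
  also have "\<dots> = comb (\<lambda>w. comb chen_word (chen_diff_word i w)) p"
    using assms by (intro comb_cong pderiv_rf_chen_word) (auto simp: chen_words_def)
  also have "\<dots> = chen_val (to_QF (chen_diff i p))"
    by (simp add: chen_val_to_QF keys_chen_diff assms) (simp add: chen_diff_def comb_lin_ext)
  finally show ?thesis
    by (simp add: dneg_def the_inv_f_f[OF inj_chen_val])
qed

lemma dneg_eq: "dneg i u = to_QF (chen_diff i (of_QF u))"
  using dneg_to_QF[OF keys_of_QF, of i u] by simp

lemma qlinear_dneg: "qlinear (dneg i)"
  unfolding dneg_eq[abs_def]
  by (intro qlinear_comp[OF qlinear_to_QF] qlinear_comp[OF qlinear_chen_diff] qlinear_of_QF)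

section \<open>Chen fractions in the new basis\<close>

definition chen_iso :: "(nat word \<Rightarrow>\<^sub>0 rat) \<Rightarrow> QF_ch" where
  "chen_iso p = to_QF (theta p)"

lemma qlinear_chen_iso: "qlinear chen_iso"
  unfolding chen_iso_def[abs_def] by (rule qlinear_comp[OF qlinear_to_QF qlinear_theta])

lemma keys_theta_chen_words: "keys p \<subseteq> chen_words \<Longrightarrow> keys (theta p) \<subseteq> chen_words"
  unfolding theta_def
proof (rule keys_lin_ext_subset)
  fix w assume "keys p \<subseteq> chen_words" "w \<in> keys p"
  then show "keys (theta_word w) \<subseteq> chen_words"
    using keys_theta_word[of w] chen_words_cong[of _ w] by (auto simp: similar_def)
qed

lemma keys_theta_inv_chen_words: "keys p \<subseteq> chen_words \<Longrightarrow> keys (theta_inv p) \<subseteq> chen_words"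
  unfolding qlinear_eq_lin_ext[OF qlinear_theta_inv, of p]
proof (rule keys_lin_ext_subset)
  fix w assume "keys p \<subseteq> chen_words" "w \<in> keys p"
  then show "keys (theta_inv (single w 1)) \<subseteq> chen_words"
    using keys_theta_inv_single[of w] chen_words_cong[of _ w] by (auto simp: similar_def)
qed

definition chen_iso_inv :: "QF_ch \<Rightarrow> (nat word \<Rightarrow>\<^sub>0 rat)" where
  "chen_iso_inv u = theta_inv (of_QF u)"

lemma qlinear_chen_iso_inv: "qlinear chen_iso_inv"
  unfolding chen_iso_inv_def[abs_def] by (rule qlinear_comp[OF qlinear_theta_inv qlinear_of_QF])

lemma chen_iso_chen_iso_inv [simp]: "chen_iso (chen_iso_inv u) = u"
  by (simp add: chen_iso_def chen_iso_inv_def)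

lemma keys_chen_iso_inv: "keys (chen_iso_inv u) \<subseteq> chen_words"
  unfolding chen_iso_inv_def by (intro keys_theta_inv_chen_words keys_of_QF)

lemma chen_iso_inv_chen_iso: "keys p \<subseteq> chen_words \<Longrightarrow> chen_iso_inv (chen_iso p) = p"
  by (simp add: chen_iso_def chen_iso_inv_def of_QF_to_QF keys_theta_chen_words)

text \<open>At the position of \<open>i\<close>, \<open>diff_word\<close> is
  \<open>raise_word\<close> and \<open>chen_diff_word\<close> is \<open>raises_word\<close>. All
  words of \<open>theta_word w\<close> have the labels of \<open>w\<close>, so the position is the
  same throughout.\<close>

lemma theta_diff_word:
  assumes "w \<in> chen_words"
  shows "theta (diff_word i w) = chen_diff i (theta_word w)"
proof (cases "i \<in> fst ` set w")
  case True
  then obtain m where m: "m < length w" "i = fst (w ! m)"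
    by (metis (no_types, lifting) imageE in_set_conv_nth)
  have "theta (diff_word i w) = lin_ext (raises_word m) (theta_word w)"
    using assms m by (simp add: diff_word_eq_raise_word theta_raise_word chen_words_def)
  also have "\<dots> = chen_diff i (theta_word w)"
    unfolding chen_diff_def
  proof (rule lin_ext_cong[OF refl])
    fix v assume "v \<in> keys (theta_word w)"
    then have v: "map fst v = map fst w" using keys_theta_word[of w] by (auto simp: similar_def)
    then have "length v = length w" by (rule map_eq_imp_length_eq)
    moreover from this v m have "fst (v ! m) = i" by (metis nth_map)
    moreover have "distinct (map fst v)" using assms v by (simp add: chen_words_def)
    ultimately show "raises_word m v = chen_diff_word i v"
      using chen_diff_word_eq_raises_word[of v m] m by simp
  qed
  finally show ?thesis .
next
  case False
  have "chen_diff i (theta_word w) = lin_ext (\<lambda>v. 0) (theta_word w)"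
    unfolding chen_diff_def
  proof (rule lin_ext_cong[OF refl])
    fix v assume "v \<in> keys (theta_word w)"
    then have "map fst v = map fst w" using keys_theta_word[of w] by (auto simp: similar_def)
    then have "fst ` set v = fst ` set w" by (metis list.set_map)
    then show "chen_diff_word i v = 0" using False by (simp add: chen_diff_word_notin)
  qed
  then show ?thesis using False by (simp add: diff_word_notin)
qed

lemma keys_diff_word: "keys (diff_word i w) \<subseteq> {v. map fst v = map fst w}"
proof (induction i w rule: diff_word.induct)
  case (2 i l n w)
  have "keys (cons_lin (l, n) (diff_word i w)) \<subseteq> {v. map fst v = map fst ((l, n) # w)}"
    by (rule subset_trans[OF keys_cons_lin]) (use 2 in auto)
  moreover have "keys (if l = i then single ((l, Suc n) # w) (of_nat (Suc n) :: rat) else 0)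
      \<subseteq> {v. map fst v = map fst ((l, n) # w)}"
    by auto
  ultimately show ?case
    unfolding diff_word.simps by (intro keys_add_subset)
qed simp

lemma dneg_chen_iso:
  assumes "keys p \<subseteq> chen_words"
  shows "dneg i (chen_iso p) = chen_iso (diff i p)"
proof -
  have "theta (diff i p) = chen_diff i (theta p)"
    by (rule qlinear_eqI[where p = p])
       (use assms in \<open>auto intro!: qlinear_comp[OF qlinear_theta] qlinear_comp[OF qlinear_chen_diff]
          qlinear_theta qlinear_diff_op simp: theta_diff_word\<close>)
  then show ?thesis
    by (simp add: chen_iso_def dneg_to_QF keys_theta_chen_words assms)
qed

text \<open>The candidate for \<open>Delta_ch\<close>: deconcatenation conjugated by the change of
  basis.\<close>

definition chen_decon :: "QF_ch \<Rightarrow> (chen \<times> chen \<Rightarrow>\<^sub>0 rat)" where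
  "chen_decon u = tens_map chen_iso chen_iso (decon (chen_iso_inv u))"

lemma qlinear_chen_decon: "qlinear chen_decon"
  unfolding chen_decon_def[abs_def]
  by (intro qlinear_comp[OF qlinear_tens_map] qlinear_comp[OF qlinear_decon] qlinear_chen_iso_inv)

lemma chen_decon_chen_iso:
  "keys p \<subseteq> chen_words \<Longrightarrow> chen_decon (chen_iso p) = tens_map chen_iso chen_iso (decon p)"
  by (simp add: chen_decon_def chen_iso_inv_chen_iso)

lemma keys_decon_chen_words:
  assumes "keys p \<subseteq> chen_words" "(u, v) \<in> keys (decon p)"
  shows "u \<in> chen_words" "v \<in> chen_words"
proof -
  obtain w where "w \<in> keys p" "(u, v) \<in> keys (decon_word w)"
    using assms(2) unfolding decon_def by (rule keys_lin_extE)
  then have "u @ v \<in> chen_words" using keys_decon_word[of w] assms(1) by auto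
  then show "u \<in> chen_words" "v \<in> chen_words" by (auto simp: chen_words_def)
qed

text \<open>\<open>diff\<close> is a coderivation of deconcatenation, and both parts of a cut stay
  in \<open>chen_words\<close>, where \<open>chen_iso\<close> turns \<open>diff\<close> into
  \<open>dneg\<close>.\<close>

lemma chen_decon_dneg:
  "chen_decon (dneg i u) = tens_map id (dneg i) (chen_decon u) + tens_map (dneg i) id (chen_decon u)"
proof -
  define p where "p = chen_iso_inv u"
  have p: "keys p \<subseteq> chen_words" and u: "u = chen_iso p"
    by (simp_all add: p_def keys_chen_iso_inv)
  have "keys (diff i p) \<subseteq> chen_words"
    unfolding diff_def
  proof (rule keys_lin_ext_subset)
    fix w assume "w \<in> keys p"
    with p show "keys (diff_word i w) \<subseteq> chen_words"
      using keys_diff_word[of i w] chen_words_cong[of _ w] by auto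
  qed
  then have "chen_decon (dneg i u) = tens_map chen_iso chen_iso (decon (diff i p))"
    by (simp add: u dneg_chen_iso p chen_decon_chen_iso)
  also have "decon (diff i p) = tens_map id (diff i) (decon p) + tens_map (diff i) id (decon p)"
    by (rule qlinear_eqI[where p = p])
       (auto intro!: qlinear_comp[OF qlinear_decon] qlinear_comp[OF qlinear_tens_map] qlinear_plus
          qlinear_decon qlinear_diff_op simp: decon_diff_word[unfolded id_def])
  also have "tens_map chen_iso chen_iso \<dots> =
      tens_map chen_iso (\<lambda>q. chen_iso (diff i q)) (decon p) + tens_map (\<lambda>q. chen_iso (diff i q)) chen_iso (decon p)"
    by (simp only: qlinear_add[OF qlinear_tens_map] tens_map_tens_map[OF qlinear_chen_iso qlinear_chen_iso] id_apply)
  also have "tens_map chen_iso (\<lambda>q. chen_iso (diff i q)) (decon p) = tens_map chen_iso (\<lambda>q. dneg i (chen_iso q)) (decon p)"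
    by (rule tens_map_cong) (use keys_decon_chen_words[OF p] in \<open>auto simp: dneg_chen_iso\<close>)
  also have "tens_map (\<lambda>q. chen_iso (diff i q)) chen_iso (decon p) = tens_map (\<lambda>q. dneg i (chen_iso q)) chen_iso (decon p)"
    by (rule tens_map_cong) (use keys_decon_chen_words[OF p] in \<open>auto simp: dneg_chen_iso\<close>)
  also have "tens_map chen_iso (\<lambda>q. dneg i (chen_iso q)) (decon p) = tens_map id (dneg i) (chen_decon u)"
    by (simp only: u chen_decon_chen_iso[OF p] tens_map_tens_map[OF qlinear_id(2) qlinear_dneg] id_apply)
  also have "tens_map (\<lambda>q. dneg i (chen_iso q)) chen_iso (decon p) = tens_map (dneg i) id (chen_decon u)"
    by (simp only: u chen_decon_chen_iso[OF p] tens_map_tens_map[OF qlinear_dneg qlinear_id(2)] id_apply)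
  finally show ?thesis .
qed

section \<open>The defining recursion of the coproduct\<close>

lemma Phi_eq: "chen_index is ss \<Longrightarrow> Phi is ss = single (chen_of (word_of is ss)) 1"
  using chen_frac_eq[of "word_of is ss"] by (simp add: Phi_def chen_of_def word_of)

lemma raise_word_nth:
  "j < length w \<Longrightarrow>
     raise_word j w = single (w[j := (fst (w ! j), Suc (snd (w ! j)))]) (of_nat (Suc (snd (w ! j))))"
  by (induction j w rule: raise_word.induct) auto

lemma raises_word_0: "raises_word 0 w = raise_word 0 w"
  by (cases "(0::nat, w)" rule: raises_word.cases) auto

text \<open>The raised ranges of positions differ by one position. This is why a difference of two
  neighbouring derivatives affects a single exponent.\<close>

lemma raises_word_diff:
  "Suc j < length w \<Longrightarrow> raises_word (Suc j) w - raises_word j w = raise_word (Suc j) w"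
proof (induction j w rule: raise_word.induct)
  case (2 l n w)
  then show ?case by (cases w) (auto simp: raises_word_0)
next
  case (3 m l n w)
  then show ?case by (simp flip: cons_lin_simps)
qed simp

lemma chen_index_update:
  "chen_index is ss \<Longrightarrow> chen_index is (ss[j := ss ! j + 1])"
  by (cases "j < length ss") (auto simp: chen_index_def dest!: subsetD[OF set_update_subset_insert])

lemma word_of_update:
  assumes "chen_index is ss" "j < length is"
  shows "word_of is (ss[j := ss ! j + 1]) =
    (word_of is ss)[j := (is ! j, Suc (snd (word_of is ss ! j)))]"
proof -
  have "length is = length ss" "ss ! j \<ge> 1" using assms by (auto simp: chen_index_def)
  then have "Suc (snd (word_of is ss ! j)) = ss ! j"
    using assms(2) by (simp add: word_of_def)
  moreover have "zip is ((map (\<lambda>s. s - 1) ss)[j := ss ! j]) = (zip is (map (\<lambda>s. s - 1) ss))[j := (is ! j, ss ! j)]"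
    using zip_update[of "is" j "is ! j" "map (\<lambda>s. s - 1) ss" "ss ! j"] by simp
  ultimately show ?thesis by (simp add: word_of_def map_update)
qed

lemma dneg_Phi:
  assumes "chen_index is ss" "j < length is"
  shows "dneg (is ! j) (Phi is ss) = to_QF (raises_word j (word_of is ss))"
proof -
  let ?w = "word_of is ss"
  have "fst (?w ! j) = is ! j"
    using word_of[OF assms(1)] assms(2) by (metis nth_map)
  moreover have "distinct (map fst ?w)" using word_of(3)[OF assms(1)] by (simp add: chen_words_def)
  ultimately have "chen_diff_word (is ! j) ?w = raises_word j ?w"
    using chen_diff_word_eq_raises_word[of ?w j] word_of(4)[OF assms(1)] assms(2) by simp
  moreover have "dneg (is ! j) (to_QF (single ?w 1)) = to_QF (chen_diff (is ! j) (single ?w 1))"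
    by (rule dneg_to_QF) (simp add: word_of assms)
  ultimately show ?thesis by (simp add: Phi_eq assms chen_diff_def)
qed

text \<open>The factor \<open>ss ! j\<close> produced by differentiation is the one that the
  recursion for the coproduct divides by.\<close>

lemma dstep_Phi:
  assumes "chen_index is ss" "j < length is"
  shows "dstep is j (Phi is ss) = smul (of_nat (ss ! j)) (Phi is (ss[j := ss ! j + 1]))"
proof -
  let ?w = "word_of is ss"
  have len: "length ?w = length is" "j < length ?w" using word_of(4)[OF assms(1)] assms(2) by auto
  have "dstep is j (Phi is ss) = to_QF (raise_word j ?w)"
  proof (cases j)
    case 0
    then show ?thesis using dneg_Phi[OF assms] by (simp add: dstep_def raises_word_0)
  next
    case (Suc k)
    then show ?thesis
      using dneg_Phi[OF assms] dneg_Phi[OF assms(1), of k] assms(2) raises_word_diff[of k ?w] len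
      by (simp add: dstep_def flip: qlinear_diff[OF qlinear_to_QF])
  qed
  also have "\<dots> = smul (of_nat (ss ! j)) (Phi is (ss[j := ss ! j + 1]))"
  proof -
    have "fst (?w ! j) = is ! j" "Suc (snd (?w ! j)) = ss ! j"
      using word_of(1,2)[OF assms(1)] len by (metis nth_map)+
    then show ?thesis
      using len word_of_update[OF assms] Phi_eq[OF chen_index_update[OF assms(1)], of j]
      by (simp add: raise_word_nth del: of_nat_Suc)
  qed
  finally show ?thesis .
qed

lemma tens_map_diff_left:
  "tens_map (\<lambda>p. f p - g p) h t = tens_map f h t - tens_map g h t"
  by (simp add: tens_map_def split_def qlinear_diff[OF qlinear_tens_left] lin_ext_fun_diff)

lemma tens_map_diff_right:
  "tens_map h (\<lambda>p. f p - g p) t = tens_map h f t - tens_map h g t"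
  by (simp add: tens_map_def split_def qlinear_diff[OF qlinear_tens_right] lin_ext_fun_diff)

lemma chen_decon_dstep:
  "chen_decon (dstep is j u) = tens_map id (dstep is j) (chen_decon u) + tens_map (dstep is j) id (chen_decon u)"
proof (cases "j = 0")
  case True
  then have "dstep is j = dneg (is ! 0)" by (simp add: dstep_def fun_eq_iff)
  then show ?thesis by (simp only: chen_decon_dneg)
next
  case False
  then have "dstep is j = (\<lambda>p. dneg (is ! j) p - dneg (is ! (j - 1)) p)" by (simp add: dstep_def fun_eq_iff)
  then show ?thesis
    by (simp only: qlinear_diff[OF qlinear_chen_decon] chen_decon_dneg tens_map_diff_left tens_map_diff_right)
       (simp only: algebra_simps)
qed

lemma chen_iso_zeros:
  assumes "chen_index is (replicate (length is) 1)"
  shows "chen_iso (single (map (\<lambda>i. (i, 0)) is) 1) = Phi is (replicate (length is) 1)"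
proof -
  have "word_of is (replicate (length is) 1) = map (\<lambda>i. (i, 0)) is"
    by (auto simp: word_of_def intro!: nth_equalityI)
  moreover have "theta_word (map (\<lambda>i. (i, 0)) is) = single (map (\<lambda>i. (i, 0)) is) 1"
    by (rule theta_word_zeros) auto
  ultimately show ?thesis
    using Phi_eq[OF assms] by (simp add: chen_iso_def)
qed

text \<open>\<open>theta\<close> fixes words whose letters all have exponent \<open>0\<close>, so on
  these fractions \<open>chen_decon\<close> is plain deconcatenation.\<close>

lemma chen_decon_ones:
  assumes "chen_index is (replicate (length is) 1)"
  shows "chen_decon (Phi is (replicate (length is) 1)) =
    (\<Sum>j\<le>length is. tens (Phi (take j is) (replicate j 1)) (Phi (drop j is) (replicate (length is - j) 1)))"
proof -
  let ?z = "map (\<lambda>i. (i, 0 :: nat)) :: nat list \<Rightarrow> nat word"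
  have idx: "distinct is" "\<And>i. i \<in> set is \<Longrightarrow> 1 \<le> i" using assms by (auto simp: chen_index_def)
  have "keys (single (?z is) (1::rat)) \<subseteq> chen_words"
    using idx by (auto simp: chen_words_def comp_def)
  from chen_decon_chen_iso[OF this]
  have "chen_decon (Phi is (replicate (length is) 1)) =
      (\<Sum>j\<le>length is. tens (chen_iso (single (?z (take j is)) 1)) (chen_iso (single (?z (drop j is)) 1)))"
    by (simp add: chen_iso_zeros[OF assms, simplified] decon_word_sum qlinear_sum[OF qlinear_tens_map] take_map drop_map)
  also have "\<dots> = (\<Sum>j\<le>length is. tens (Phi (take j is) (replicate j 1)) (Phi (drop j is) (replicate (length is - j) 1)))"
  proof (rule sum.cong[OF refl])
    fix j assume "j \<in> {..length is}"
    moreover have "chen_index (take j is) (replicate (length (take j is)) 1)"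
      "chen_index (drop j is) (replicate (length (drop j is)) 1)"
      using idx by (auto simp: chen_index_def dest: in_set_takeD in_set_dropD)
    ultimately show "tens (chen_iso (single (?z (take j is)) 1)) (chen_iso (single (?z (drop j is)) 1)) =
        tens (Phi (take j is) (replicate j 1)) (Phi (drop j is) (replicate (length is - j) 1))"
      using chen_iso_zeros[of "take j is"] chen_iso_zeros[of "drop j is"] by (simp add: min_def)
  qed
  finally show ?thesis .
qed

lemma chen_index_Nil: "chen_index [] []"
  by (simp add: chen_index_def)

text \<open>The recursive clause is \<open>chen_decon_dstep\<close> applied to a fraction, rewritten
  by \<open>dstep_Phi\<close>.\<close>

lemma is_Delta_ch_chen_decon: "is_Delta_ch chen_decon"
  unfolding is_Delta_ch_def
proof (intro conjI allI impI)
  show "qlinear chen_decon" by (rule qlinear_chen_decon)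
  show "chen_decon (Phi [] []) = tens (Phi [] []) (Phi [] [])"
    using chen_decon_ones[of "[]"] by (simp add: chen_index_Nil)
next
  fix "is" :: "nat list"
  assume "is \<noteq> [] \<and> chen_index is (replicate (length is) 1)"
  then show "chen_decon (Phi is (replicate (length is) 1)) =
    (\<Sum>j\<le>length is. tens (Phi (take j is) (replicate j 1)) (Phi (drop j is) (replicate (length is - j) 1)))"
    using chen_decon_ones by blast
next
  fix "is" ss j
  assume *: "chen_index is ss \<and> j < length is"
  then have "ss ! j \<ge> 1" by (auto simp: chen_index_def)
  then have "chen_decon (Phi is (ss[j := ss ! j + 1])) = smul (1 / of_nat (ss ! j)) (chen_decon (dstep is j (Phi is ss)))"
    using * by (simp add: dstep_Phi qlinear_smul[OF qlinear_chen_decon])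
  then show "chen_decon (Phi is (ss[j := ss ! j + 1])) = smul (1 / of_nat (ss ! j))
      (tens_map id (dstep is j) (chen_decon (Phi is ss)) + tens_map (dstep is j) id (chen_decon (Phi is ss)))"
    by (simp only: chen_decon_dstep)
qed

lemma qlinear_QF_eqI:
  assumes "qlinear f" "qlinear g"
    and "\<And>is ss. chen_index is ss \<Longrightarrow> f (Phi is ss) = g (Phi is ss)"
  shows "f = g"
proof
  fix u
  show "f u = g u"
  proof (rule qlinear_eqI[OF assms(1,2)])
    fix c
    obtain w where w: "w \<in> chen_words" "c = chen_of w" by (rule chen_of_cases)
    let ?is = "map fst w" and ?ss = "map (\<lambda>a. Suc (snd a)) w"
    have "Phi ?is ?ss = single c 1"
      by (simp add: Phi_def chen_frac_eq w chen_of_def)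
    then show "f (single c 1) = g (single c 1)"
      using assms(3)[OF chen_index_word[OF w(1)]] by simp
  qed
qed

lemma is_Delta_chD:
  assumes "is_Delta_ch T"
  shows "qlinear T" "T (Phi [] []) = tens (Phi [] []) (Phi [] [])"
    and "is \<noteq> [] \<Longrightarrow> chen_index is (replicate (length is) 1) \<Longrightarrow>
      T (Phi is (replicate (length is) 1)) =
        (\<Sum>j\<le>length is. tens (Phi (take j is) (replicate j 1)) (Phi (drop j is) (replicate (length is - j) 1)))"
    and "chen_index is ss \<Longrightarrow> j < length is \<Longrightarrow> T (Phi is (ss[j := ss ! j + 1])) =
      smul (1 / of_nat (ss ! j)) (tens_map id (dstep is j) (T (Phi is ss)) + tens_map (dstep is j) id (T (Phi is ss)))"
  using assms unfolding is_Delta_ch_def by blast+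

text \<open>Uniqueness is by induction on the sum of the exponents: an exponent above
  \<open>1\<close> is lowered and the recursive clause applied; if there is none, the value is
  prescribed.\<close>

lemma Delta_ch_eq: "Delta_ch = chen_decon"
  unfolding Delta_ch_def
proof (rule the_equality)
  show "is_Delta_ch chen_decon" by (rule is_Delta_ch_chen_decon)
  fix T assume T: "is_Delta_ch T"
  note C = is_Delta_ch_chen_decon
  have "T (Phi is ss) = chen_decon (Phi is ss)" if "chen_index is ss" for "is" ss
    using that
  proof (induction "sum_list ss" arbitrary: ss rule: less_induct)
    case less
    show ?case
    proof (cases "\<forall>s\<in>set ss. s = 1")
      case True
      then have ss: "ss = replicate (length is) 1"
        using less(2) by (metis chen_index_def replicate_length_same)
      show ?thesis
      proof (cases "is = []")
        case True
        then show ?thesis using is_Delta_chD(2)[OF T] is_Delta_chD(2)[OF C] ss by simp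
      next
        case False
        moreover have "chen_index is (replicate (length is) 1)" using less(2) ss by simp
        ultimately have "T (Phi is (replicate (length is) 1)) = chen_decon (Phi is (replicate (length is) 1))"
          using is_Delta_chD(3)[OF T, of "is"] is_Delta_chD(3)[OF C, of "is"] by presburger
        then show ?thesis unfolding ss .
      qed
    next
      case False
      then obtain j where j: "j < length ss" "ss ! j \<noteq> 1" by (metis in_set_conv_nth)
      have pos: "\<And>s. s \<in> set ss \<Longrightarrow> 1 \<le> s" and len: "length is = length ss"
        using less(2) by (auto simp: chen_index_def)
      have j2: "2 \<le> ss ! j" using j pos[of "ss ! j"] by simp
      define ss' where "ss' = ss[j := ss ! j - 1]"
      have idx: "chen_index is ss'"
        using less(2) j2 by (auto simp: chen_index_def ss'_def dest!: subsetD[OF set_update_subset_insert])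
      have ss: "ss = ss'[j := ss' ! j + 1]" using j j2 by (simp add: ss'_def)
      have "sum_list ss' < sum_list ss"
        using j j2 elem_le_sum_list[of j ss] by (simp add: ss'_def sum_list_update)
      then have IH: "T (Phi is ss') = chen_decon (Phi is ss')" using less(1) idx by simp
      have "j < length is" using j len by simp
      then show ?thesis
        using is_Delta_chD(4)[OF T idx, of j] is_Delta_chD(4)[OF C idx, of j] IH ss by metis
    qed
  qed
  then show "T = chen_decon"
    by (intro qlinear_QF_eqI is_Delta_chD(1)[OF T] qlinear_chen_decon)
qed

section \<open>Passage from Chen fractions to compositions\<close>

lemma to_H_word_of: "chen_index is ss \<Longrightarrow> single (word_comp (word_of is ss)) 1 = brk ss"
  by (simp add: brk_def word_comp_def word_of)

lemma proj_H_eq: "proj_H = (\<lambda>u. to_H (of_QF u))"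
  unfolding proj_H_def
proof (rule the_equality)
  have *: "to_H (of_QF (Phi is ss)) = brk ss" if "chen_index is ss" for "is" ss
    using that by (simp add: Phi_eq word_of_chen_of word_of to_H_word_of)
  then show "qlinear (\<lambda>u. to_H (of_QF u)) \<and> to_H (of_QF (Phi [] [])) = one_H \<and>
     (\<forall>is ss. is \<noteq> [] \<and> chen_index is ss \<longrightarrow> to_H (of_QF (Phi is ss)) = brk ss)"
    by (auto intro!: qlinear_comp[OF qlinear_to_H qlinear_of_QF] simp: one_H_def chen_index_Nil)
  fix P assume P: "qlinear P \<and> P (Phi [] []) = one_H \<and>
     (\<forall>is ss. is \<noteq> [] \<and> chen_index is ss \<longrightarrow> P (Phi is ss) = brk ss)"
  show "P = (\<lambda>u. to_H (of_QF u))"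
  proof (rule qlinear_QF_eqI)
    fix "is" ss assume i: "chen_index is ss"
    show "P (Phi is ss) = to_H (of_QF (Phi is ss))"
    proof (cases "is = []")
      case True
      then have "ss = []" using i by (simp add: chen_index_def)
      then show ?thesis using True P *[OF i] by (simp add: one_H_def)
    next
      case False
      then show ?thesis using P *[OF i] i by simp
    qed
  qed (use P in \<open>auto intro: qlinear_comp[OF qlinear_to_H qlinear_of_QF]\<close>)
qed

lemma to_H_relabel: "to_H (relabel f p) = to_H p"
  by (simp add: to_H_def relabel_def lin_ext_lin_ext word_comp_def comp_def)

text \<open>Forgetting indices commutes with the change of basis, by
  \<open>relabel_theta\<close>.\<close>

lemma proj_H_chen_iso:
  "keys p \<subseteq> chen_words \<Longrightarrow> proj_H (chen_iso p) = word_iso (relabel (\<lambda>_. ()) p)"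
  by (simp add: proj_H_eq chen_iso_def of_QF_to_QF keys_theta_chen_words word_iso_def
      to_H_relabel flip: relabel_theta)

lemma qlinear_proj_H: "qlinear proj_H"
  unfolding proj_H_eq by (rule qlinear_comp[OF qlinear_to_H qlinear_of_QF])

definition word_iso_inv :: "H \<Rightarrow> (unit word \<Rightarrow>\<^sub>0 rat)" where
  "word_iso_inv u = theta_inv (lin_ext (\<lambda>c. single (comp_word c) 1) u)"

lemma qlinear_word_iso_inv: "qlinear word_iso_inv"
  unfolding word_iso_inv_def[abs_def] by (rule qlinear_comp[OF qlinear_theta_inv qlinear_lin_ext])

lemma word_iso_word_iso_inv [simp]: "word_iso (word_iso_inv u) = u"
  by (simp add: word_iso_def word_iso_inv_def to_H_def lin_ext_lin_ext lin_ext_id)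

lemma word_iso_inv_word_iso [simp]: "word_iso_inv (word_iso p) = p"
  by (simp add: word_iso_def word_iso_inv_def to_H_def lin_ext_lin_ext lin_ext_id)

lemma chen_index_upt:
  assumes "\<forall>s\<in>set ss. 1 \<le> s"
  shows "chen_index (map Suc [0..<length ss]) ss"
  using assms by (auto simp: chen_index_def distinct_map)

text \<open>Forgetting labels commutes with cutting a word (\<open>decon_relabel\<close>), so the
  projected coproduct depends on the exponents alone.\<close>

lemma Delta_desc_eq: "Delta_desc = (\<lambda>u. tens_map word_iso word_iso (decon (word_iso_inv u)))"
  (is "_ = ?D") unfolding Delta_desc_def
proof (rule the_equality)
  have brk: "tens_map proj_H proj_H (Delta_ch (Phi is ss)) = ?D (brk ss)" if i: "chen_index is ss" for "is" ss
  proof -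
    define p where "p = chen_iso_inv (Phi is ss)"
    let ?q = "relabel (\<lambda>_. ()) p"
    have p: "keys p \<subseteq> chen_words" "Phi is ss = chen_iso p"
      by (simp_all add: p_def keys_chen_iso_inv)
    have "word_iso ?q = proj_H (Phi is ss)" by (simp add: p proj_H_chen_iso)
    also have "\<dots> = brk ss"
      using i by (simp add: proj_H_eq Phi_eq word_of_chen_of word_of to_H_word_of)
    finally have q: "?q = word_iso_inv (brk ss)" by (metis word_iso_inv_word_iso)
    have "tens_map proj_H proj_H (Delta_ch (Phi is ss)) =
        tens_map (\<lambda>r. proj_H (chen_iso r)) (\<lambda>r. proj_H (chen_iso r)) (decon p)"
      by (simp add: Delta_ch_eq p chen_decon_chen_iso tens_map_tens_map[OF qlinear_proj_H qlinear_proj_H])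
    also have "\<dots> = tens_map (\<lambda>r. word_iso (relabel (\<lambda>_. ()) r)) (\<lambda>r. word_iso (relabel (\<lambda>_. ()) r)) (decon p)"
      by (rule tens_map_cong) (use keys_decon_chen_words[OF p(1)] in \<open>auto simp: proj_H_chen_iso\<close>)
    also have "\<dots> = tens_map word_iso word_iso (decon ?q)"
      by (simp only: decon_relabel[symmetric] tens_map_tens_map[OF qlinear_word_iso qlinear_word_iso])
    finally show ?thesis by (simp only: q)
  qed
  have one: "?D one_H = tens one_H one_H"
  proof -
    have "word_iso (single [] 1) = one_H" by (simp add: word_iso_def one_H_def brk_def word_comp_def)
    then have "word_iso_inv one_H = single [] 1" by (metis word_iso_inv_word_iso)
    with \<open>word_iso (single [] 1) = one_H\<close> show ?thesis by simp
  qed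
  have lin: "qlinear ?D"
    by (intro qlinear_comp[OF qlinear_tens_map] qlinear_comp[OF qlinear_decon] qlinear_word_iso_inv)
  then show "qlinear ?D \<and> ?D one_H = tens one_H one_H \<and>
     (\<forall>is ss. is \<noteq> [] \<and> chen_index is ss \<longrightarrow> ?D (brk ss) = tens_map proj_H proj_H (Delta_ch (Phi is ss)))"
    using one brk by auto
  fix D assume D: "qlinear D \<and> D one_H = tens one_H one_H \<and>
     (\<forall>is ss. is \<noteq> [] \<and> chen_index is ss \<longrightarrow> D (brk ss) = tens_map proj_H proj_H (Delta_ch (Phi is ss)))"
  show "D = ?D"
  proof
    fix u
    show "D u = ?D u"
    proof (rule qlinear_eqI[OF _ lin])
      fix c
      define ss where "ss = Rep_composition c"
      have c: "single c 1 = brk ss" by (simp add: brk_def ss_def Rep_composition_inverse)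
      show "D (single c 1) = ?D (single c 1)"
      proof (cases "ss = []")
        case True
        then show ?thesis using D one by (simp add: c one_H_def)
      next
        case False
        \<comment> \<open>The indices \<open>1, ..., k\<close> are admissible for every composition,
          so the defining clause determines \<open>D\<close> on the whole basis.\<close>
        have "chen_index (map Suc [0..<length ss]) ss"
          by (rule chen_index_upt) (use Rep_composition[of c] in \<open>simp add: ss_def\<close>)
        moreover have "map Suc [0..<length ss] \<noteq> []" using False by simp
        ultimately show ?thesis using D brk unfolding c by metis
      qed
    qed (use D in simp)
  qed
qed

lemma Delta_desc_word_iso: "Delta_desc (word_iso p) = tens_map word_iso word_iso (decon p)"
  by (simp add: Delta_desc_eq)

lemma word_iso_Nil: "word_iso (single [] 1) = one_H"
  by (simp add: word_iso_def one_H_def brk_def word_comp_def)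

lemma counit_H_word_iso: "counit_H (word_iso p) = shuf_counit p"
proof -
  have "lookup (to_H q) (Abs_composition []) = lookup q []" for q :: "unit word \<Rightarrow>\<^sub>0 rat"
  proof (rule lookup_eqI[OF qlinear_to_H qlinear_id(1)])
    fix w :: "unit word"
    have "word_comp w = Abs_composition [] \<longleftrightarrow> w = []"
      using comp_word_word_comp[of w] comp_word_word_comp[of "[]"] by (auto simp: word_comp_def)
    then show "lookup (to_H (single w 1)) (Abs_composition []) = lookup (single w 1) []"
      by (simp add: lookup_single when_def)
  qed
  then show ?thesis
    by (simp add: counit_H_def word_iso_def shuf_counit_def lookup_theta_Nil)
qed

lemma hopf_H: "rat_hopf_algebra shuffle_star one_H Delta_desc counit_H"
  by (rule rat_hopf_algebra_transport[OF shuf_hopf_algebra qlinear_word_iso bij_word_iso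
        word_iso_shuf word_iso_Nil Delta_desc_word_iso[symmetric] counit_H_word_iso])

section \<open>The grading by weight\<close>

lemma in_weight_part_iff: "u \<in> weight_part n \<longleftrightarrow> (\<forall>c\<in>keys u. weight c = n)"
proof
  assume "u \<in> weight_part n"
  then have "u \<in> Q.span {single c 1 |c. weight c = n}" by (simp add: weight_part_def)
  then have "keys u \<subseteq> {c. weight c = n}"
    by (rule Q.span_induct[where P = "\<lambda>u. keys u \<subseteq> {c. weight c = n}"])
       (simp_all add: Q.subspace_def keys_add_subset keys_smul_subset, auto)
  then show "\<forall>c\<in>keys u. weight c = n" by auto
next
  assume *: "\<forall>c\<in>keys u. weight c = n"
  have "lin_ext (\<lambda>c. single c 1) u \<in> Q.span {single c 1 |c. weight c = n}"
    unfolding lin_ext_def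
    by (intro Q.span_sum Q.span_scale Q.span_base) (use * in auto)
  then show "u \<in> weight_part n" by (simp add: weight_part_def lin_ext_id)
qed

lemma word_iso_weight:
  assumes "keys p \<subseteq> {w. wt w = n}"
  shows "word_iso p \<in> weight_part n"
proof -
  have "weight c = n" if "c \<in> keys (to_H (theta p))" for c
  proof -
    from that obtain v where v: "v \<in> keys (theta p)" "c = word_comp v"
      unfolding to_H_def by (rule keys_lin_extE) auto
    from v(1) obtain w where "w \<in> keys p" "v \<in> keys (theta_word w)"
      unfolding theta_def by (rule keys_lin_extE)
    then show ?thesis
      using assms keys_theta_word[of w] by (auto simp: v(2) weight_word_comp similar_def)
  qed
  then show ?thesis by (simp add: in_weight_part_iff word_iso_def)
qed

lemma word_iso_inv_weight:
  assumes "u \<in> weight_part n"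
  shows "keys (word_iso_inv u) \<subseteq> {w. wt w = n}"
proof -
  have "word_iso_inv u = lin_ext (\<lambda>c. theta_inv (single (comp_word c) 1)) u"
    by (simp add: word_iso_inv_def qlinear_lin_ext_out[OF qlinear_theta_inv])
  moreover have "keys (theta_inv (single (comp_word c) 1)) \<subseteq> {w. wt w = n}" if "c \<in> keys u" for c
    using keys_theta_inv_single[of "comp_word c"] that assms weight_word_comp[of "comp_word c"]
    by (auto simp: similar_def in_weight_part_iff)
  ultimately show ?thesis by (simp add: keys_lin_ext_subset)
qed

lemma keys_shuf_word: "keys (shuf_word u v) \<subseteq> {w. wt w = wt u + wt v}"
proof (induction u v rule: shuf_word.induct)
  case (3 a u b v)
  show ?case
    unfolding shuf_word.simps
    by (intro keys_add_subset subset_trans[OF keys_cons_lin]) (use 3 in auto)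
qed simp_all

text \<open>The component in degree \<open>n\<close> is forced to be the restriction of
  \<open>u\<close> to the compositions of weight \<open>n\<close>.\<close>

lemma weight_decomposition:
  "\<exists>!c. (\<forall>n. c n \<in> weight_part n) \<and> finite {n. c n \<noteq> 0} \<and> u = (\<Sum>n | c n \<noteq> 0. c n)"
proof (rule ex1I)
  define r where "r n = lin_ext (\<lambda>b. if weight b = n then single b 1 else 0) u" for n
  have r: "lookup (r n) b = (if weight b = n then lookup u b else 0)" for n b
  proof -
    have "lookup (r n) b = (\<Sum>a\<in>keys u. if a = b then (if weight b = n then lookup u b else 0) else 0)"
      unfolding r_def lookup_lin_ext by (intro sum.cong) (auto simp: lookup_single when_def)
    then show ?thesis by (auto simp: in_keys_iff)
  qed
  have fin: "finite {n. r n \<noteq> 0}"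
  proof (rule finite_subset)
    show "{n. r n \<noteq> 0} \<subseteq> weight ` keys u"
      by (auto simp: poly_mapping_eq_iff fun_eq_iff r in_keys_iff split: if_splits)
  qed simp
  have lookup_c: "lookup (\<Sum>n | c n \<noteq> 0. c n) b = lookup (c (weight b)) b"
    if "\<forall>n. c n \<in> weight_part n" "finite {n. c n \<noteq> 0}" for c :: "nat \<Rightarrow> H" and b
  proof -
    have 0: "lookup (c n) b = 0" if "n \<noteq> weight b" for n
      using \<open>\<forall>n. c n \<in> weight_part n\<close> that unfolding in_weight_part_iff by (metis in_keys_iff)
    have "lookup (\<Sum>n | c n \<noteq> 0. c n) b = (\<Sum>n\<in>{n. c n \<noteq> 0}. if n = weight b then lookup (c (weight b)) b else 0)"
      unfolding lookup_sum by (intro sum.cong) (auto simp: 0)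
    then show ?thesis using that(2) by auto
  qed
  have wp: "\<forall>n. r n \<in> weight_part n"
    by (auto simp: in_weight_part_iff in_keys_iff r split: if_splits)
  show "(\<forall>n. r n \<in> weight_part n) \<and> finite {n. r n \<noteq> 0} \<and> u = (\<Sum>n | r n \<noteq> 0. r n)"
    using wp fin lookup_c[OF wp fin] by (auto intro!: poly_mapping_eqI simp: r)
  fix c assume c: "(\<forall>n. c n \<in> weight_part n) \<and> finite {n. c n \<noteq> 0} \<and> u = (\<Sum>n | c n \<noteq> 0. c n)"
  show "c = r"
  proof
    fix n
    show "c n = r n"
    proof (rule poly_mapping_eqI)
      fix b
      show "lookup (c n) b = lookup (r n) b"
      proof (cases "weight b = n")
        case True
        then show ?thesis using c lookup_c[of c b] by (simp add: r)
      next
        case False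
        moreover have "b \<notin> keys (c n)" using c False by (auto simp: in_weight_part_iff)
        ultimately show ?thesis by (simp add: r in_keys_iff)
      qed
    qed
  qed
qed

lemma weight_eq_0_iff: "weight c = 0 \<longleftrightarrow> c = Abs_composition []"
proof
  assume "weight c = 0"
  then have "Rep_composition c = []"
    using Rep_composition[of c] by (cases "Rep_composition c") (auto simp: weight_def)
  then show "c = Abs_composition []" by (metis Rep_composition_inverse)
qed (simp add: weight_def Abs_composition_inverse)

theorem theorem4p8:
  shows "connected_graded_rat_bialgebra weight_part shuffle_star one_H Delta_desc counit_H \<and>
         rat_hopf_algebra shuffle_star one_H Delta_desc counit_H"
proof
  show "rat_hopf_algebra shuffle_star one_H Delta_desc counit_H" by (rule hopf_H)
  then have bialg: "rat_bialgebra shuffle_star one_H Delta_desc counit_H"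
    by (rule rat_hopf_algebra.axioms)
  show "connected_graded_rat_bialgebra weight_part shuffle_star one_H Delta_desc counit_H"
  proof (intro connected_graded_rat_bialgebra.intro bialg connected_graded_rat_bialgebra_axioms.intro)
    fix n show "Q.subspace (weight_part n)"
      unfolding weight_part_def by (rule Q.subspace_span)
  next
    fix u show "\<exists>!c. (\<forall>n. c n \<in> weight_part n) \<and> finite {n. c n \<noteq> 0} \<and> u = (\<Sum>n | c n \<noteq> 0. c n)"
      by (rule weight_decomposition)
  next
    show "one_H \<in> weight_part 0"
      by (simp add: in_weight_part_iff one_H_def brk_def weight_eq_0_iff)
  next
    fix u v m n assume "u \<in> weight_part m" "v \<in> weight_part n"
    then have uv: "keys (word_iso_inv u) \<subseteq> {w. wt w = m}" "keys (word_iso_inv v) \<subseteq> {w. wt w = n}"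
      by (auto dest: word_iso_inv_weight)
    have "keys (shuf (word_iso_inv u) (word_iso_inv v)) \<subseteq> {w. wt w = m + n}"
      unfolding shuf_def
    proof (intro keys_lin_ext_subset)
      fix a b assume "a \<in> keys (word_iso_inv u)" "b \<in> keys (word_iso_inv v)"
      then show "keys (shuf_word a b) \<subseteq> {w. wt w = m + n}"
        using uv keys_shuf_word[of a b] by blast
    qed
    from word_iso_weight[OF this] show "shuffle_star u v \<in> weight_part (m + n)"
      by (simp add: word_iso_shuf)
  next
    fix u n assume u: "u \<in> weight_part n"
    let ?p = "word_iso_inv u"
    let ?B = "{tens v w |v w p q. v \<in> weight_part p \<and> w \<in> weight_part q \<and> p + q = n}"
    \<comment> \<open>A cut splits the weight of \<open>w\<close> additively, and
      \<open>word_iso\<close> preserves the weight of each part.\<close>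
    have "tens_map word_iso word_iso (decon_word w) \<in> Q.span ?B" if w: "w \<in> keys ?p" for w
    proof -
      have "tens (word_iso (single (take j w) 1)) (word_iso (single (drop j w) 1)) \<in> ?B" for j
      proof -
        have "wt (take j w) + wt (drop j w) = wt (take j w @ drop j w)"
          by (simp only: map_append sum_list_append)
        also have "\<dots> = n" using word_iso_inv_weight[OF u] w by auto
        finally show ?thesis
          using word_iso_weight[of "single (take j w) 1" "wt (take j w)"]
            word_iso_weight[of "single (drop j w) 1" "wt (drop j w)"] by auto
      qed
      then have "(\<Sum>j\<le>length w. tens (word_iso (single (take j w) 1)) (word_iso (single (drop j w) 1))) \<in> Q.span ?B"
        by (intro Q.span_sum Q.span_base)
      then show ?thesis
        by (simp only: decon_word_sum qlinear_sum[OF qlinear_tens_map] tens_map_single Q.scale_one)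
    qed
    then have "lin_ext (\<lambda>w. tens_map word_iso word_iso (decon_word w)) ?p \<in> Q.span ?B"
      unfolding lin_ext_def by (intro Q.span_sum Q.span_scale)
    moreover have "Delta_desc u = lin_ext (\<lambda>w. tens_map word_iso word_iso (decon_word w)) ?p"
      by (simp add: Delta_desc_eq decon_def qlinear_lin_ext_out[OF qlinear_tens_map])
    ultimately show "Delta_desc u \<in> Q.span ?B" by simp
  next
    fix u and n :: nat assume "u \<in> weight_part n" "n \<noteq> 0"
    then have "Abs_composition [] \<notin> keys u"
      using weight_eq_0_iff[of "Abs_composition []"] by (auto simp: in_weight_part_iff)
    then show "counit_H u = 0" by (simp add: counit_H_def in_keys_iff)
  next
    have "{single c (1::rat) |c. weight c = 0} = {one_H}"
      by (auto simp: weight_eq_0_iff one_H_def brk_def)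
    then show "weight_part 0 = Q.span {one_H}" by (simp add: weight_part_def)
  qed
qed

end
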